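(* For $K\in\mathcal M$ and $\sigma\in\mathcal E_K$ let $$\gamma_{K,\sigma}=\int_{\triangle_{K,\sigma}}\Lambda_K^{-1}\frac{x-x_K}{d_{K,\sigma}}\cdot\frac{x-x_K}{d_{K,\sigma}}\,dx>0,$$ and consider the Modified Mixed scheme with points $(x_K)_{K\in\mathcal M}$ and matrices $\mathbb B^M_K$ given by $\mathbb B^M_{K,\sigma,\sigma}=\gamma_{K,\sigma}$ and $\mathbb B^M_{K,\sigma,\sigma'}=0$ for $\sigma\ne\sigma'$. Then this scheme is equivalent to the following Mixed Finite Element formulation: find $(p,\widehat F)\in H_{\mathcal M}\times\widehat{\mathcal F}$ such that $$\forall\widehat G\in\widehat{\mathcal F}:\ \int_\Omega\widehat\Lambda(x)^{-1}\widehat F(x)\cdot\widehat G(x)\,dx-\int_\Omega p(x)\,\mathrm{div}\,\widehat G(x)\,dx=0,$$ $$\forall q\in H_{\mathcal M}:\ \int_\Omega q(x)\,\mathrm{div}\,\widehat F(x)\,dx=\int_\Omega q(x)f(x)\,dx.$$ That is, for $p\in H_{\mathcal M}$ and $F\in\mathcal F$, the pair $(p,\widehat F)$ is a solution of this formulation if and only if there exist face values $(p_\sigma)_{\sigma\in\mathcal E}$ such that $\widetilde p=((p_K)_K,(p_\sigma)_\sigma)\in\widetilde H_{\mathcal M,0}$ and $(\widetilde p,F)$ is a solution of the Modified Mixed scheme.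
   Context: **Problem.** $\Omega\subset\mathbf{R}^d$ is a bounded (polytopal) open set, $f\in L^2(\Omega)$, $\Lambda:\Omega\to M_d(\mathbf{R})$ is bounded, measurable, symmetric and uniformly elliptic ($\Lambda(x)\xi\cdot\xi\ge\zeta|\xi|^2$ for some $\zeta>0$, a.e. $x$, all $\xi$). **Mesh.** $\mathcal M$ is a finite partition (up to a null set) of $\Omega$ into open polytopal cells $K$. $\mathcal E_K$ is the set of faces of $K$ (relatively open subsets of hyperplanes, disjoint, contained in $\partial K$, with closures covering $\partial K$); $\mathcal E$ is the set of all faces; each face is either contained in $\partial\Omega$ or interior, i.e. common to exactly two cells. $|K|,|\sigma|$ are measures, $\mathbf n_{K,\sigma}$ is the unit normal to $\sigma$ outward to $K$, $\bar x_\sigma$ the center of gravity of $\sigma$, $x_K\in K$ a point with respect to which $K$ is star-shaped, $d_{K,\sigma}>0$ the distance from $x_K$ to the hyperplane containing $\sigma$, $\triangle_{K,\sigma}$ the cone with vertex $x_K$ and basis $\sigma$ (these cones partition $K$ up to a null set), $\Lambda_K$ the mean of $\Lambda$ on $K$, and $\widehat\Lambda$ the function equal to $\Lambda_K$ on each $K$. **Spaces.** $H_{\mathcal M}$: families $p=(p_K)_{K\in\mathcal M}$, identified with piecewise constant functions equal to $p_K$ on $K$. $\widetilde H_{\mathcal M,0}$: families $\widetilde p=((p_K)_{K\in\mathcal M},(p_\sigma)_{\sigma\in\mathcal E})$ with $p_\sigma=0$ if $\sigma\subset\partial\Omega$. $\mathcal F$: families $F=(F_{K,\sigma})_{K\in\mathcal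 M,\sigma\in\mathcal E_K}$ with $F_{K,\sigma}+F_{L,\sigma}=0$ for each interior face common to $K,L$; $F_K=(F_{K,\sigma})_{\sigma\in\mathcal E_K}\in\mathcal F_K=\mathbf{R}^{\mathcal E_K}$. **Modified Mixed scheme.** Set $|K|\Lambda_K\mathbf v_K(F_K)=-\sum_{\sigma\in\mathcal E_K}|\sigma|F_{K,\sigma}(\bar x_\sigma-x_K)$ and $T_{K,\sigma}(F_K)=F_{K,\sigma}+\Lambda_K\mathbf v_K(F_K)\cdot\mathbf n_{K,\sigma}$. Find $(\widetilde p,F)\in\widetilde H_{\mathcal M,0}\times\mathcal F$ such that for all $K$: $\sum_{\sigma\in\mathcal E_K}|\sigma|F_{K,\sigma}=\int_Kf$, and for all $G_K\in\mathcal F_K$, $|K|\mathbf v_K(F_K)\cdot\Lambda_K\mathbf v_K(G_K)+T_K(G_K)^T\mathbb B^M_KT_K(F_K)=\sum_{\sigma\in\mathcal E_K}(p_K-p_\sigma)|\sigma|G_{K,\sigma}$. **Reconstructed fluxes.** For $F\in\mathcal F$, $\widehat F:\Omega\to\mathbf{R}^d$ is defined by $\widehat F(x)=-\Lambda_K\mathbf v_K(F_K)+T_{K,\sigma}(F_K)\frac{x-x_K}{d_{K,\sigma}}$ for all $K$, $\sigma\in\mathcal E_K$ and a.e. $x\in\triangle_{K,\sigma}$; it belongs to $H_{\mathrm{div}}(\Omega)$, and $\mathrm{div}$ is the distributional divergence. $\widehat{\mathcal F}=\{\widehat F:F\in\mathcal F\}$. *)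

theory Defs
  imports "HOL-Analysis.Analysis"
begin

section \<open>Function spaces and the distributional divergence\<close>

definition L2_on :: "(real^'n) set \<Rightarrow> (real^'n \<Rightarrow> 'b::euclidean_space) \<Rightarrow> bool" where
  "L2_on S f \<longleftrightarrow> f \<in> borel_measurable (lebesgue_on S) \<and>
     integrable (lebesgue_on S) (\<lambda>x. (norm (f x))\<^sup>2)"

definition partial_deriv :: "'n \<Rightarrow> (real^'n \<Rightarrow> real) \<Rightarrow> real^'n \<Rightarrow> real" where
  "partial_deriv i f x = frechet_derivative f (at x) (axis i 1)"

definition gradient :: "(real^'n \<Rightarrow> real) \<Rightarrow> real^'n \<Rightarrow> real^'n" where
  "gradient f x = (\<chi> i. partial_deriv i f x)"

fun C_diff :: "nat \<Rightarrow> (real^'n \<Rightarrow> real) \<Rightarrow> bool" where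
  "C_diff 0 f \<longleftrightarrow> continuous_on UNIV f"
| "C_diff (Suc k) f \<longleftrightarrow> f differentiable_on UNIV \<and> (\<forall>i. C_diff k (partial_deriv i f))"

text \<open>Test functions: smooth functions with compact support in \<open>S\<close>.\<close>

definition test_functions :: "(real^'n) set \<Rightarrow> (real^'n \<Rightarrow> real) set" where
  "test_functions S = {\<phi>. (\<forall>k. C_diff k \<phi>) \<and> (\<exists>C. compact C \<and> C \<subseteq> S \<and> (\<forall>x. x \<notin> C \<longrightarrow> \<phi> x = 0))}"

definition has_weak_div :: "(real^'n) set \<Rightarrow> (real^'n \<Rightarrow> real^'n) \<Rightarrow> (real^'n \<Rightarrow> real) \<Rightarrow> bool" where
  "has_weak_div S u g \<longleftrightarrow> L2_on S u \<and> L2_on S g \<and>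
     (\<forall>\<phi>\<in>test_functions S.
        (LINT x:S|lebesgue. u x \<bullet> gradient \<phi> x) = - (LINT x:S|lebesgue. g x * \<phi> x))"

text \<open>A representative of the distributional divergence, which is determined up to a null set;
  meaningful for \<open>u\<close> in the space $H_{\mathrm{div}}(S)$ only.\<close>

definition weak_div :: "(real^'n) set \<Rightarrow> (real^'n \<Rightarrow> real^'n) \<Rightarrow> real^'n \<Rightarrow> real" where
  "weak_div S u = (SOME g. has_weak_div S u g)"

section \<open>Measure and centre of gravity of a face\<close>

text \<open>Lebesgue measure of the affine subspace \<open>H\<close>: the image of the product Lebesgue measure under
  the isometric parametrisation of \<open>H\<close> given by an origin \<open>a\<close> and an orthonormal basis \<open>B\<close> of its
  direction. It does not depend on these choices. (Compare the definition of \<^const>\<open>lborel\<close>.)\<close>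

definition flat_lborel :: "(real^'n) set \<Rightarrow> (real^'n) measure" where
  "flat_lborel H =
    (let a = (SOME a. a \<in> H);
         B = (SOME B. pairwise orthogonal B \<and> (\<forall>b\<in>B. norm b = 1) \<and> span B = (\<lambda>x. x - a) ` H)
     in distr (\<Pi>\<^sub>M b\<in>B. lborel) borel (\<lambda>y. a + (\<Sum>b\<in>B. y b *\<^sub>R b)))"

definition face_area :: "(real^'n) set \<Rightarrow> real" where
  "face_area \<sigma> = measure (flat_lborel (affine hull \<sigma>)) \<sigma>"

definition face_center :: "(real^'n) set \<Rightarrow> real^'n" where
  "face_center \<sigma> = (1 / face_area \<sigma>) *\<^sub>R (LINT x:\<sigma>|flat_lborel (affine hull \<sigma>). x)"

section \<open>Polytopal meshes\<close>

text \<open>Cells and domains need not be convex.\<close>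

definition polytopal_open :: "(real^'n) set \<Rightarrow> bool" where
  "polytopal_open S \<longleftrightarrow> open S \<and>
     (\<exists>P. finite P \<and> (\<forall>p\<in>P. polytope p \<and> aff_dim p = int CARD('n) - 1) \<and> frontier S = \<Union>P)"

text \<open>The dimension condition makes \<open>affine hull \<sigma>\<close> the hyperplane containing \<open>\<sigma>\<close>, and
  \<open>\<sigma>\<close> nonempty.\<close>

definition hyperplane_piece :: "(real^'n) set \<Rightarrow> bool" where
  "hyperplane_piece \<sigma> \<longleftrightarrow> aff_dim \<sigma> = int CARD('n) - 1 \<and> rel_open \<sigma>"

definition face_dist :: "real^'n \<Rightarrow> (real^'n) set \<Rightarrow> real" where
  "face_dist a \<sigma> = infdist a (affine hull \<sigma>)"

definition face_cone :: "real^'n \<Rightarrow> (real^'n) set \<Rightarrow> (real^'n) set" where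
  "face_cone a \<sigma> = (\<Union>y\<in>\<sigma>. open_segment a y)"

definition outward_normal :: "(real^'n) set \<Rightarrow> (real^'n) set \<Rightarrow> real^'n" where
  "outward_normal K \<sigma> = (THE n. norm n = 1 \<and> (\<forall>y\<in>\<sigma>. \<forall>z\<in>\<sigma>. n \<bullet> (y - z) = 0) \<and>
     (\<forall>y\<in>\<sigma>. \<exists>\<epsilon>>0. \<forall>t. 0 < t \<and> t < \<epsilon> \<longrightarrow> y - t *\<^sub>R n \<in> K \<and> y + t *\<^sub>R n \<notin> K))"

text \<open>\<open>M\<close> is the set of cells, \<open>E K\<close> the set of faces of the cell \<open>K\<close>, and \<open>c K\<close> its chosen
  point $x_K$.\<close>

definition polytopal_mesh ::
  "(real^'n) set \<Rightarrow> (real^'n) set set \<Rightarrow> ((real^'n) set \<Rightarrow> (real^'n) set set) \<Rightarrow>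
   ((real^'n) set \<Rightarrow> real^'n) \<Rightarrow> bool" where
  "polytopal_mesh \<Omega> M E c \<longleftrightarrow>
     finite M \<and> disjoint M \<and> (\<forall>K\<in>M. polytopal_open K \<and> K \<subseteq> \<Omega>) \<and> negligible (\<Omega> - \<Union>M) \<and>
     (\<forall>K\<in>M. finite (E K) \<and> disjoint (E K) \<and> (\<forall>\<sigma>\<in>E K. hyperplane_piece \<sigma> \<and> \<sigma> \<subseteq> frontier K) \<and>
        frontier K = (\<Union>\<sigma>\<in>E K. closure \<sigma>)) \<and>
     (\<forall>\<sigma>\<in>(\<Union>K\<in>M. E K).
        (\<sigma> \<subseteq> frontier \<Omega> \<and> card {K\<in>M. \<sigma> \<in> E K} = 1) \<or>
        (\<not> \<sigma> \<subseteq> frontier \<Omega> \<and> card {K\<in>M. \<sigma> \<in> E K} = 2)) \<and>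
     (\<forall>K\<in>M. c K \<in> K \<and> (\<forall>y\<in>K. closed_segment (c K) y \<subseteq> K) \<and>
        (\<forall>\<sigma>\<in>E K. face_dist (c K) \<sigma> > 0) \<and>
        negligible (K - (\<Union>\<sigma>\<in>E K. face_cone (c K) \<sigma>)) \<and>
        negligible ((\<Union>\<sigma>\<in>E K. face_cone (c K) \<sigma>) - K) \<and>
        pairwise (\<lambda>\<sigma> \<tau>. negligible (face_cone (c K) \<sigma> \<inter> face_cone (c K) \<tau>)) (E K))"

section \<open>Diffusion tensor\<close>

definition diffusion_tensor :: "(real^'n) set \<Rightarrow> (real^'n \<Rightarrow> real^'n^'n) \<Rightarrow> bool" where
  "diffusion_tensor \<Omega> \<Lambda> \<longleftrightarrow> \<Lambda> \<in> borel_measurable (lebesgue_on \<Omega>) \<and>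
     (\<exists>C. AE x in lebesgue_on \<Omega>. norm (\<Lambda> x) \<le> C) \<and>
     (AE x in lebesgue_on \<Omega>. transpose (\<Lambda> x) = \<Lambda> x) \<and>
     (\<exists>\<zeta>>0. AE x in lebesgue_on \<Omega>. \<forall>\<xi>. (\<Lambda> x *v \<xi>) \<bullet> \<xi> \<ge> \<zeta> * (norm \<xi>)\<^sup>2)"

definition cell_tensor :: "(real^'n \<Rightarrow> real^'n^'n) \<Rightarrow> (real^'n) set \<Rightarrow> real^'n^'n" where
  "cell_tensor \<Lambda> K = (1 / measure lebesgue K) *\<^sub>R (LINT x:K|lebesgue. \<Lambda> x)"

definition piecewise_const ::
  "(real^'n) set set \<Rightarrow> ((real^'n) set \<Rightarrow> 'b::real_vector) \<Rightarrow> real^'n \<Rightarrow> 'b" where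
  "piecewise_const M p x = (\<Sum>K\<in>M. indicator K x *\<^sub>R p K)"

definition mean_tensor :: "(real^'n) set set \<Rightarrow> (real^'n \<Rightarrow> real^'n^'n) \<Rightarrow> real^'n \<Rightarrow> real^'n^'n" where
  "mean_tensor M \<Lambda> = piecewise_const M (cell_tensor \<Lambda>)"

section \<open>Discrete spaces\<close>

text \<open>Families indexed by cells, by faces, or by pairs of a cell and one of its faces are total
  functions, of which only the values at these indices are ever used. So the space
  $H_{\mathcal M}$ is the type \<open>(real^'n) set \<Rightarrow> real\<close>, with \<^const>\<open>piecewise_const\<close> turning a family
  into a function on the domain, and $\mathcal F_K$ is the same type, indexed by faces.\<close>

definition hybrid_space ::
  "(real^'n) set \<Rightarrow> (real^'n) set set \<Rightarrow> ((real^'n) set \<Rightarrow> (real^'n) set set) \<Rightarrow>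
   (((real^'n) set \<Rightarrow> real) \<times> ((real^'n) set \<Rightarrow> real)) set" where
  "hybrid_space \<Omega> M E = {(p, s). \<forall>\<sigma>\<in>(\<Union>K\<in>M. E K). \<sigma> \<subseteq> frontier \<Omega> \<longrightarrow> s \<sigma> = 0}"

definition flux_space ::
  "(real^'n) set set \<Rightarrow> ((real^'n) set \<Rightarrow> (real^'n) set set) \<Rightarrow>
   ((real^'n) set \<Rightarrow> (real^'n) set \<Rightarrow> real) set" where
  "flux_space M E = {F. \<forall>K\<in>M. \<forall>L\<in>M. \<forall>\<sigma>\<in>E K \<inter> E L. K \<noteq> L \<longrightarrow> F K \<sigma> + F L \<sigma> = 0}"

section \<open>The Modified Mixed scheme\<close>

definition cell_grad ::
  "(real^'n \<Rightarrow> real^'n^'n) \<Rightarrow> ((real^'n) set \<Rightarrow> (real^'n) set set) \<Rightarrow> ((real^'n) set \<Rightarrow> real^'n) \<Rightarrow>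
   (real^'n) set \<Rightarrow> ((real^'n) set \<Rightarrow> real) \<Rightarrow> real^'n" where
  "cell_grad \<Lambda> E c K g = (THE v. measure lebesgue K *\<^sub>R (cell_tensor \<Lambda> K *v v) =
     - (\<Sum>\<sigma>\<in>E K. (face_area \<sigma> * g \<sigma>) *\<^sub>R (face_center \<sigma> - c K)))"

definition flux_residual ::
  "(real^'n \<Rightarrow> real^'n^'n) \<Rightarrow> ((real^'n) set \<Rightarrow> (real^'n) set set) \<Rightarrow> ((real^'n) set \<Rightarrow> real^'n) \<Rightarrow>
   (real^'n) set \<Rightarrow> ((real^'n) set \<Rightarrow> real) \<Rightarrow> (real^'n) set \<Rightarrow> real" where
  "flux_residual \<Lambda> E c K g \<sigma> = g \<sigma> + (cell_tensor \<Lambda> K *v cell_grad \<Lambda> E c K g) \<bullet> outward_normal K \<sigma>"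

text \<open>\<open>B K\<close> is the matrix $\mathbb B^M_K$, indexed by the faces of \<open>K\<close>.\<close>

definition modified_mixed_solution ::
  "(real^'n) set \<Rightarrow> (real^'n) set set \<Rightarrow> ((real^'n) set \<Rightarrow> (real^'n) set set) \<Rightarrow>
   ((real^'n) set \<Rightarrow> real^'n) \<Rightarrow> (real^'n \<Rightarrow> real^'n^'n) \<Rightarrow> (real^'n \<Rightarrow> real) \<Rightarrow>
   ((real^'n) set \<Rightarrow> (real^'n) set \<Rightarrow> (real^'n) set \<Rightarrow> real) \<Rightarrow>
   ((real^'n) set \<Rightarrow> real) \<times> ((real^'n) set \<Rightarrow> real) \<Rightarrow>
   ((real^'n) set \<Rightarrow> (real^'n) set \<Rightarrow> real) \<Rightarrow> bool" where
  "modified_mixed_solution \<Omega> M E c \<Lambda> f B ph F \<longleftrightarrow>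
     ph \<in> hybrid_space \<Omega> M E \<and> F \<in> flux_space M E \<and>
     (\<forall>K\<in>M. (\<Sum>\<sigma>\<in>E K. face_area \<sigma> * F K \<sigma>) = (LINT x:K|lebesgue. f x)) \<and>
     (\<forall>K\<in>M. \<forall>g.
        measure lebesgue K *
          (cell_grad \<Lambda> E c K (F K) \<bullet> (cell_tensor \<Lambda> K *v cell_grad \<Lambda> E c K g)) +
        (\<Sum>\<sigma>\<in>E K. \<Sum>\<tau>\<in>E K.
           flux_residual \<Lambda> E c K g \<sigma> * B K \<sigma> \<tau> * flux_residual \<Lambda> E c K (F K) \<tau>) =
        (\<Sum>\<sigma>\<in>E K. (fst ph K - snd ph \<sigma>) * face_area \<sigma> * g \<sigma>))"

section \<open>The Mixed Finite Element formulation\<close>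

text \<open>The reconstructed flux $\widehat F$; the cones are disjoint up to null sets.\<close>

definition flux_hat ::
  "(real^'n) set set \<Rightarrow> ((real^'n) set \<Rightarrow> (real^'n) set set) \<Rightarrow> ((real^'n) set \<Rightarrow> real^'n) \<Rightarrow>
   (real^'n \<Rightarrow> real^'n^'n) \<Rightarrow> ((real^'n) set \<Rightarrow> (real^'n) set \<Rightarrow> real) \<Rightarrow> real^'n \<Rightarrow> real^'n" where
  "flux_hat M E c \<Lambda> F x = (\<Sum>K\<in>M. \<Sum>\<sigma>\<in>E K. indicator (face_cone (c K) \<sigma>) x *\<^sub>R
     (- (cell_tensor \<Lambda> K *v cell_grad \<Lambda> E c K (F K)) +
      flux_residual \<Lambda> E c K (F K) \<sigma> *\<^sub>R ((1 / face_dist (c K) \<sigma>) *\<^sub>R (x - c K))))"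

definition flux_hat_space ::
  "(real^'n) set set \<Rightarrow> ((real^'n) set \<Rightarrow> (real^'n) set set) \<Rightarrow> ((real^'n) set \<Rightarrow> real^'n) \<Rightarrow>
   (real^'n \<Rightarrow> real^'n^'n) \<Rightarrow> (real^'n \<Rightarrow> real^'n) set" where
  "flux_hat_space M E c \<Lambda> = flux_hat M E c \<Lambda> ` flux_space M E"

definition mixed_fe_solution ::
  "(real^'n) set \<Rightarrow> (real^'n) set set \<Rightarrow> ((real^'n) set \<Rightarrow> (real^'n) set set) \<Rightarrow>
   ((real^'n) set \<Rightarrow> real^'n) \<Rightarrow> (real^'n \<Rightarrow> real^'n^'n) \<Rightarrow> (real^'n \<Rightarrow> real) \<Rightarrow>
   ((real^'n) set \<Rightarrow> real) \<Rightarrow> (real^'n \<Rightarrow> real^'n) \<Rightarrow> bool" where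
  "mixed_fe_solution \<Omega> M E c \<Lambda> f p u \<longleftrightarrow>
     u \<in> flux_hat_space M E c \<Lambda> \<and>
     (\<forall>w\<in>flux_hat_space M E c \<Lambda>.
        (LINT x:\<Omega>|lebesgue. (matrix_inv (mean_tensor M \<Lambda> x) *v u x) \<bullet> w x) -
        (LINT x:\<Omega>|lebesgue. piecewise_const M p x * weak_div \<Omega> w x) = 0) \<and>
     (\<forall>q. (LINT x:\<Omega>|lebesgue. piecewise_const M q x * weak_div \<Omega> u x) =
        (LINT x:\<Omega>|lebesgue. piecewise_const M q x * f x))"

definition cone_gamma ::
  "(real^'n \<Rightarrow> real^'n^'n) \<Rightarrow> ((real^'n) set \<Rightarrow> real^'n) \<Rightarrow> (real^'n) set \<Rightarrow> (real^'n) set \<Rightarrow> real" where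
  "cone_gamma \<Lambda> c K \<sigma> = (LINT x:face_cone (c K) \<sigma>|lebesgue.
     (matrix_inv (cell_tensor \<Lambda> K) *v ((1 / face_dist (c K) \<sigma>) *\<^sub>R (x - c K))) \<bullet>
     ((1 / face_dist (c K) \<sigma>) *\<^sub>R (x - c K)))"

end

theory Submission
  imports Defs "HOL-Probability.Distributions"
begin

text \<open>Testing the local equations with $G_K$ and summing over the cells eliminates the face values.
  Conversely they are recovered as the Lagrange multipliers of the continuity of the normal fluxes.
  This is linear algebra once two identities are known: $\int_K \widehat\Lambda^{-1}\widehat F\cdot\widehat G$
  is the local bilinear form of the scheme, and $\int_K \mathrm{div}\,\widehat F = \sum_\sigma |\sigma| F_{K,\sigma}$.

  Both rest on the divergence theorem for a radial field on a cone, which is integration along rays,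
  and for a constant field on a cell. The latter follows from the former and from the fact that the
  gauge of the star-shaped cell is Lipschitz and equals $\mathbf n_{K,\sigma}\cdot(x-x_K)/d_{K,\sigma}$ on
  each cone; it yields $\sum_\sigma|\sigma|\mathbf n_{K,\sigma}=0$ and
  $\sum_\sigma|\sigma|(\bar x_\sigma-x_K)\mathbf n_{K,\sigma}^T=|K|I$, by which the cross terms vanish.\<close>

section \<open>Lebesgue measure in orthonormal and conical coordinates\<close>

text \<open>The obstacle is that a cell may be nonconvex and that its faces come with no description
  of their edges, so fluxes of a constant field cannot be matched across the lateral sides of
  neighbouring cones. A radial field is tangent to these sides and causes no trouble. For a constant
  field the boundary is smeared out: \<open>tent\<close>, equal to 1 minus the gauge in the cell and
  to 0 outside, has gradient -\<open>N \<sigma>\<close> / \<open>d \<sigma>\<close> on each cone,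
  and integration by parts against it is mere translation invariance of Lebesgue measure, without
  boundary term. The price is a weight in front of the derivative, removed afterwards by a radial
  operator that also turns cone integrals into face integrals.

  Two definitions by choice shape the rest. \<open>flat_lborel\<close> picks an origin and an
  orthonormal basis, so cone coordinates are derived for arbitrary ones, with the Gaussian fixing
  the normalisation. \<open>weak_div\<close> picks a representative; it enters the formulation only
  through integrals over cells, which are determined by testing with smooth functions that converge
  to the indicator of a cell.\<close>

lemma nn_integral_lborel_translate:
  fixes g :: "'a::euclidean_space \<Rightarrow> ennreal"
  assumes [measurable]: "g \<in> borel_measurable borel"
  shows "(\<integral>\<^sup>+y. g (a + y) \<partial>lborel) = (\<integral>\<^sup>+y. g y \<partial>lborel)"
  by (subst (2) lborel_distr_plus[of a, symmetric]) (simp add: nn_integral_distr)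

lemma nn_integral_lborel_reflect:
  fixes g :: "'a::euclidean_space \<Rightarrow> ennreal"
  assumes [measurable]: "g \<in> borel_measurable borel"
  shows "(\<integral>\<^sup>+y. g (a - y) \<partial>lborel) = (\<integral>\<^sup>+y. g y \<partial>lborel)"
  by (subst (2) lborel_affine[of "-1" a]) (simp_all add: nn_integral_density nn_integral_distr)

text \<open>This is the uniqueness of Haar measure: the integral of
  \<open>indicator A (\<psi> z) * g (\<psi> z + y)\<close> over both variables is evaluated in two
  ways. The measure is given as an image under \<open>\<psi>\<close> because sigma-finiteness,
  needed for Fubini, is known for \<open>N\<close> but not beforehand for its image.\<close>

lemma translation_invariant_eq_lborel:
  fixes \<psi> :: "'b \<Rightarrow> 'a::euclidean_space" and g :: "'a \<Rightarrow> ennreal"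
  assumes N: "sigma_finite_measure N" and [measurable]: "\<psi> \<in> borel_measurable N"
    and trans: "\<And>f a. f \<in> borel_measurable borel \<Longrightarrow>
        (\<integral>\<^sup>+z. f (\<psi> z + a) \<partial>N) = (\<integral>\<^sup>+z. f (\<psi> z) \<partial>N)"
    and [measurable]: "g \<in> borel_measurable borel"
    and g: "(\<integral>\<^sup>+z. g (\<psi> z) \<partial>N) = (\<integral>\<^sup>+x. g x \<partial>lborel)"
    and g0: "(\<integral>\<^sup>+x. g x \<partial>lborel) \<noteq> 0" "(\<integral>\<^sup>+x. g x \<partial>lborel) \<noteq> \<infinity>"
  shows "distr N borel \<psi> = lborel"
proof (rule measure_eqI)
  fix A assume "A \<in> sets (distr N borel \<psi>)"
  then have A[measurable]: "A \<in> sets borel" by simp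
  interpret N: sigma_finite_measure N by fact
  interpret P: pair_sigma_finite N "lborel :: 'a measure" ..
  let ?f = "indicator A :: 'a \<Rightarrow> ennreal"
  let ?G = "\<integral>\<^sup>+x. g x \<partial>lborel"
  have "(\<integral>\<^sup>+z. ?f (\<psi> z) \<partial>N) * ?G = (\<integral>\<^sup>+z. ?f (\<psi> z) * ?G \<partial>N)"
    by (simp add: nn_integral_multc)
  also have "\<dots> = (\<integral>\<^sup>+z. (\<integral>\<^sup>+y. ?f (\<psi> z) * g (\<psi> z + y) \<partial>lborel) \<partial>N)"
    by (intro nn_integral_cong) (simp add: nn_integral_cmult nn_integral_lborel_translate)
  also have "\<dots> = (\<integral>\<^sup>+y. (\<integral>\<^sup>+z. ?f (\<psi> z) * g (\<psi> z + y) \<partial>N) \<partial>lborel)"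
    by (rule P.Fubini'[symmetric]) measurable
  \<comment> \<open>Invariance with the shift \<open>- y\<close> moves the translation from
    \<open>g\<close> to the indicator; afterwards the \<open>y\<close>-integral of the indicator is
    the measure of \<open>A\<close>, for every \<open>z\<close>.\<close>
  also have "\<dots> = (\<integral>\<^sup>+y. (\<integral>\<^sup>+z. ?f (\<psi> z - y) * g (\<psi> z) \<partial>N) \<partial>lborel)"
  proof (rule nn_integral_cong)
    fix y :: 'a
    show "(\<integral>\<^sup>+z. ?f (\<psi> z) * g (\<psi> z + y) \<partial>N) = (\<integral>\<^sup>+z. ?f (\<psi> z - y) * g (\<psi> z) \<partial>N)"
      using trans[of "\<lambda>x. ?f x * g (x + y)" "- y"] by simp
  qed
  also have "\<dots> = (\<integral>\<^sup>+z. (\<integral>\<^sup>+y. ?f (\<psi> z - y) * g (\<psi> z) \<partial>lborel) \<partial>N)"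
    by (rule P.Fubini') measurable
  also have "\<dots> = (\<integral>\<^sup>+z. (\<integral>\<^sup>+y. ?f y \<partial>lborel) * g (\<psi> z) \<partial>N)"
    by (intro nn_integral_cong) (simp add: nn_integral_multc nn_integral_lborel_reflect)
  also have "\<dots> = emeasure lborel A * ?G"
    by (simp add: nn_integral_cmult g)
  finally have "(\<integral>\<^sup>+z. ?f (\<psi> z) \<partial>N) * ?G = emeasure lborel A * ?G" .
  moreover have "(\<integral>\<^sup>+z. ?f (\<psi> z) \<partial>N) = emeasure (distr N borel \<psi>) A"
    using nn_integral_distr[of \<psi> N borel ?f] by simp
  ultimately have "emeasure (distr N borel \<psi>) A * ?G = emeasure lborel A * ?G"
    by simp
  then show "emeasure (distr N borel \<psi>) A = emeasure lborel A"
    using g0 by (metis ennreal_mult_cancel_left infinity_ennreal_def mult.commute)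
qed simp

interpretation lborel_product: product_sigma_finite "\<lambda>_::'i. lborel :: real measure"
  by standard

text \<open>Both sides define measures that agree on boxes, where the claim is the one-dimensional
  substitution in every coordinate. A common factor \<open>t\<close> with a shift per coordinate
  covers both uses: translations with \<open>t = 1\<close>, and the dilation of a slice of a cone.
  The bounded abstraction keeps the map inside the extensional functions on
  \<open>I\<close>.\<close>

lemma nn_integral_PiM_affine:
  fixes F :: "('i \<Rightarrow> real) \<Rightarrow> ennreal"
  assumes I: "finite I" and t: "t \<noteq> 0"
    and [measurable]: "F \<in> borel_measurable (Pi\<^sub>M I (\<lambda>_. lborel))"
  shows "(\<integral>\<^sup>+y. F y \<partial>Pi\<^sub>M I (\<lambda>_. lborel)) =
    ennreal (\<bar>t\<bar> ^ card I) * (\<integral>\<^sup>+y. F (\<lambda>i\<in>I. s i + t * y i) \<partial>Pi\<^sub>M I (\<lambda>_. lborel))"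
proof -
  let ?M = "Pi\<^sub>M I (\<lambda>_. lborel :: real measure)"
  let ?T = "\<lambda>y::'i \<Rightarrow> real. \<lambda>i\<in>I. s i + t * y i"
  have T[measurable]: "?T \<in> measurable ?M ?M"
    by measurable
  have "density (distr ?M ?M ?T) (\<lambda>_. ennreal (\<bar>t\<bar> ^ card I)) = ?M"
  proof (rule lborel_product.PiM_eqI[OF I])
    fix A assume A: "\<And>i. i \<in> I \<Longrightarrow> A i \<in> sets (lborel :: real measure)"
    then have A'[measurable]: "\<And>i. i \<in> I \<Longrightarrow> A i \<in> sets borel" by simp
    have PA: "Pi\<^sub>E I A \<in> sets ?M" using A I by (intro sets_PiM_I_finite) auto
    have pre: "?T -` Pi\<^sub>E I A \<inter> space ?M = Pi\<^sub>E I (\<lambda>i. (\<lambda>x. s i + t * x) -` A i)"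
      by (auto simp: space_PiM PiE_def Pi_def extensional_def)
    have one: "emeasure lborel (A i) = ennreal \<bar>t\<bar> * emeasure lborel ((\<lambda>x. s i + t * x) -` A i)"
      if "i \<in> I" for i
    proof -
      note [measurable] = A'[OF that]
      have m: "(\<lambda>x. s i + t * x) -` A i \<in> sets borel"
        using measurable_sets[of "\<lambda>x. s i + t * x" borel borel "A i"] A'[OF that] by simp
      have "emeasure lborel (A i) = (\<integral>\<^sup>+x. indicator (A i) x \<partial>lborel)"
        using A'[OF that] by simp
      also have "\<dots> = ennreal \<bar>t\<bar> * (\<integral>\<^sup>+x. indicator (A i) (s i + t * x) \<partial>lborel)"
        by (rule nn_integral_real_affine) (use t in auto)
      also have "(\<integral>\<^sup>+x. indicator (A i) (s i + t * x) \<partial>lborel) =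
          (\<integral>\<^sup>+x. indicator ((\<lambda>x. s i + t * x) -` A i) x \<partial>lborel)"
        by (intro nn_integral_cong) (simp add: indicator_def)
      also have "\<dots> = emeasure lborel ((\<lambda>x. s i + t * x) -` A i)"
        using m by simp
      finally show ?thesis .
    qed
    have "emeasure (density (distr ?M ?M ?T) (\<lambda>_. ennreal (\<bar>t\<bar> ^ card I))) (Pi\<^sub>E I A) =
        ennreal (\<bar>t\<bar> ^ card I) * emeasure ?M (?T -` Pi\<^sub>E I A \<inter> space ?M)"
      using PA by (simp add: emeasure_density_const emeasure_distr)
    also have "\<dots> = ennreal (\<bar>t\<bar> ^ card I) * (\<Prod>i\<in>I. emeasure lborel ((\<lambda>x. s i + t * x) -` A i))"
    proof -
      have "emeasure ?M (Pi\<^sub>E I (\<lambda>i. (\<lambda>x. s i + t * x) -` A i)) =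
          (\<Prod>i\<in>I. emeasure lborel ((\<lambda>x. s i + t * x) -` A i))"
      proof (rule lborel_product.emeasure_PiM[OF I])
        fix i assume "i \<in> I"
        from A'[OF this] show "(\<lambda>x. s i + t * x) -` A i \<in> sets lborel"
          using measurable_sets[of "\<lambda>x. s i + t * x" borel borel "A i"] by simp
      qed
      then show ?thesis by (simp only: pre)
    qed
    also have "\<dots> = (\<Prod>i\<in>I. emeasure lborel (A i))"
      by (simp add: one prod.distrib ennreal_power)
    finally show "emeasure (density (distr ?M ?M ?T) (\<lambda>_. ennreal (\<bar>t\<bar> ^ card I))) (Pi\<^sub>E I A) =
        (\<Prod>i\<in>I. emeasure lborel (A i))" .
  qed simp
  then have "(\<integral>\<^sup>+y. F y \<partial>?M) = (\<integral>\<^sup>+y. F y \<partial>density (distr ?M ?M ?T) (\<lambda>_. ennreal (\<bar>t\<bar> ^ card I)))"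
    by simp
  also have "\<dots> = ennreal (\<bar>t\<bar> ^ card I) * (\<integral>\<^sup>+y. F (?T y) \<partial>?M)"
    by (simp add: nn_integral_density nn_integral_distr nn_integral_cmult)
  finally show ?thesis .
qed

lemma orthonormal_basis_independent:
  fixes B :: "'a::euclidean_space set"
  assumes "pairwise orthogonal B" "\<And>b. b \<in> B \<Longrightarrow> norm b = 1"
  shows "independent B" and "finite B"
proof -
  have "0 \<notin> B" using assms(2) by force
  then show "independent B" using assms(1) pairwise_orthogonal_independent by blast
  then show "finite B" by (rule independent_imp_finite)
qed

lemma orthonormal_expansion:
  fixes B :: "'a::euclidean_space set"
  assumes B: "pairwise orthogonal B" "\<And>b. b \<in> B \<Longrightarrow> norm b = 1" and x: "x \<in> span B"
  shows "(\<Sum>b\<in>B. (x \<bullet> b) *\<^sub>R b) = x"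
proof -
  have fin: "finite B" by (rule orthonormal_basis_independent(2)[OF B])
  have dot: "(\<Sum>b\<in>B. f b *\<^sub>R b) \<bullet> b' = f b'" if "b' \<in> B" for f b'
  proof -
    have "(\<Sum>b\<in>B. f b *\<^sub>R b) \<bullet> b' = (\<Sum>b\<in>B. if b = b' then f b' else 0)"
      unfolding inner_sum_left
      using B that by (intro sum.cong) (auto simp: pairwise_def orthogonal_def norm_eq_1)
    then show ?thesis using fin that by simp
  qed
  obtain f where f: "x = (\<Sum>b\<in>B. f b *\<^sub>R b)"
    using x unfolding span_finite[OF fin] by auto
  show ?thesis by (subst (2) f, intro sum.cong) (simp_all add: f dot)
qed

text \<open>Only positivity and finiteness matter: the Gaussian is the reference function
  \<open>g\<close> for \<open>translation_invariant_eq_lborel\<close>, where its integral is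
  cancelled.\<close>

lemma nn_integral_gauss:
  "(\<integral>\<^sup>+x. ennreal (exp (- x\<^sup>2)) \<partial>lborel) \<noteq> 0"
  "(\<integral>\<^sup>+x. ennreal (exp (- x\<^sup>2)) \<partial>lborel) \<noteq> \<infinity>"
proof -
  show "(\<integral>\<^sup>+x. ennreal (exp (- x\<^sup>2)) \<partial>lborel) \<noteq> 0"
    by (subst nn_integral_0_iff) (auto simp: emeasure_lborel_UNIV)
  have "integrable lborel (\<lambda>x::real. exp (- x\<^sup>2))"
  proof -
    have i: "integrable lborel (\<lambda>x::real. indicator {0..} x *\<^sub>R exp (- x\<^sup>2))"
      using gaussian_moment_0 by (rule integrable.intros)
    have "integrable lborel (\<lambda>x::real. indicator {0..} (-x) *\<^sub>R exp (- (-x)\<^sup>2))"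
      using lborel_integrable_real_affine[OF i, of "-1" 0] by simp
    then have "integrable lborel (\<lambda>x::real. indicator {0..} x *\<^sub>R exp (- x\<^sup>2) +
        indicator {0..} (-x) *\<^sub>R exp (- (-x)\<^sup>2))"
      using i by (rule Bochner_Integration.integrable_add[rotated])
    then show ?thesis
      by (rule Bochner_Integration.integrable_bound) (auto simp: indicator_def)
  qed
  then show "(\<integral>\<^sup>+x. ennreal (exp (- x\<^sup>2)) \<partial>lborel) \<noteq> \<infinity>"
    by (simp add: integrable_iff_bounded)
qed

text \<open>By uniqueness of Haar measure the image is a multiple of \<open>lborel\<close>. The
  factor is 1 because exp(-|x|^2) is the same product of one-dimensional Gaussians in every
  orthonormal basis; \<open>gauss\<close> is stated for any orthonormal set so that it applies to
  \<open>B\<close> and to \<open>Basis\<close> alike.\<close>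

lemma distr_orthonormal_lborel:
  fixes B :: "'a::euclidean_space set"
  assumes B: "pairwise orthogonal B" "\<And>b. b \<in> B \<Longrightarrow> norm b = 1" and span: "span B = UNIV"
  shows "distr (\<Pi>\<^sub>M b\<in>B. lborel) borel (\<lambda>y. \<Sum>b\<in>B. y b *\<^sub>R b) = lborel"
proof -
  note fin = orthonormal_basis_independent(2)[OF B]
  let ?g = "\<lambda>x::'a. ennreal (exp (- (norm x)\<^sup>2))"
  let ?G = "\<integral>\<^sup>+x. ennreal (exp (- x\<^sup>2)) \<partial>lborel"
  have gauss: "(\<integral>\<^sup>+z. ?g (\<Sum>b\<in>C. z b *\<^sub>R b) \<partial>Pi\<^sub>M C (\<lambda>_. lborel)) = ?G ^ card C"
    if "finite C" "pairwise orthogonal C" "\<And>b. b \<in> C \<Longrightarrow> norm b = 1" for C :: "'a set"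
  proof -
    have "?g (\<Sum>b\<in>C. z b *\<^sub>R b) = (\<Prod>b\<in>C. ennreal (exp (- (z b)\<^sup>2)))" for z
    proof -
      have "(norm (\<Sum>b\<in>C. z b *\<^sub>R b))\<^sup>2 = (\<Sum>b\<in>C. (norm (z b *\<^sub>R b))\<^sup>2)"
        using that by (intro norm_sum_Pythagorean) (auto simp: pairwise_def orthogonal_def)
      also have "\<dots> = (\<Sum>b\<in>C. (z b)\<^sup>2)"
        using that by (intro sum.cong) auto
      finally show ?thesis using that(1) by (simp add: exp_sum prod_ennreal sum_negf[symmetric])
    qed
    then have "(\<integral>\<^sup>+z. ?g (\<Sum>b\<in>C. z b *\<^sub>R b) \<partial>Pi\<^sub>M C (\<lambda>_. lborel)) =
        (\<integral>\<^sup>+z. (\<Prod>b\<in>C. ennreal (exp (- (z b)\<^sup>2))) \<partial>Pi\<^sub>M C (\<lambda>_. lborel))"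
      by simp
    also have "\<dots> = (\<Prod>b\<in>C. ?G)"
      using that(1) by (intro lborel_product.product_nn_integral_prod) auto
    finally show ?thesis by simp
  qed
  have "(\<integral>\<^sup>+x. ?g x \<partial>lborel) = (\<integral>\<^sup>+z. ?g (\<Sum>b\<in>Basis. z b *\<^sub>R b) \<partial>Pi\<^sub>M Basis (\<lambda>_. lborel))"
    by (subst lborel_eq) (simp add: nn_integral_distr)
  also have "\<dots> = ?G ^ DIM('a)"
    by (rule gauss) (auto simp: pairwise_def orthogonal_def inner_Basis)
  finally have g1: "(\<integral>\<^sup>+x. ?g x \<partial>lborel) = ?G ^ DIM('a)" .
  have card: "card B = DIM('a)"
    using dim_eq_card_independent[OF orthonormal_basis_independent(1)[OF B]] span
    by (metis dim_UNIV dim_span)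
  show ?thesis
  proof (rule translation_invariant_eq_lborel[where g = ?g])
    show "sigma_finite_measure (\<Pi>\<^sub>M b\<in>B. lborel :: real measure)"
      by (rule lborel_product.sigma_finite[OF fin])
    show "(\<integral>\<^sup>+z. ?g (\<Sum>b\<in>B. z b *\<^sub>R b) \<partial>Pi\<^sub>M B (\<lambda>_. lborel)) = (\<integral>\<^sup>+x. ?g x \<partial>lborel)"
      unfolding g1 card[symmetric] by (rule gauss) (use fin B in auto)
    show "(\<integral>\<^sup>+x. ?g x \<partial>lborel) \<noteq> 0" "(\<integral>\<^sup>+x. ?g x \<partial>lborel) \<noteq> \<infinity>"
      unfolding g1 using nn_integral_gauss
      by (simp_all add: power_eq_top_ennreal)
  next
    fix f :: "'a \<Rightarrow> ennreal" and a
    assume [measurable]: "f \<in> borel_measurable borel"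
    have "(\<integral>\<^sup>+z. f (\<Sum>b\<in>B. z b *\<^sub>R b) \<partial>Pi\<^sub>M B (\<lambda>_. lborel)) =
        (\<integral>\<^sup>+z. f (\<Sum>b\<in>B. (\<lambda>b\<in>B. a \<bullet> b + 1 * z b) b *\<^sub>R b) \<partial>Pi\<^sub>M B (\<lambda>_. lborel))"
      using nn_integral_PiM_affine[OF fin, of 1 "\<lambda>z. f (\<Sum>b\<in>B. z b *\<^sub>R b)" "\<lambda>b. a \<bullet> b"] by simp
    also have "\<dots> = (\<integral>\<^sup>+z. f ((\<Sum>b\<in>B. z b *\<^sub>R b) + a) \<partial>Pi\<^sub>M B (\<lambda>_. lborel))"
    proof (rule nn_integral_cong)
      fix z
      have "(\<Sum>b\<in>B. (\<lambda>b\<in>B. a \<bullet> b + 1 * z b) b *\<^sub>R b) = (\<Sum>b\<in>B. (a \<bullet> b) *\<^sub>R b) + (\<Sum>b\<in>B. z b *\<^sub>R b)"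
        by (simp add: scaleR_add_left sum.distrib)
      also have "(\<Sum>b\<in>B. (a \<bullet> b) *\<^sub>R b) = a"
        by (rule orthonormal_expansion[OF B]) (simp_all add: span)
      finally show "f (\<Sum>b\<in>B. (\<lambda>b\<in>B. a \<bullet> b + 1 * z b) b *\<^sub>R b) = f ((\<Sum>b\<in>B. z b *\<^sub>R b) + a)"
        by (simp add: add.commute)
    qed
    finally show "(\<integral>\<^sup>+z. f ((\<Sum>b\<in>B. z b *\<^sub>R b) + a) \<partial>Pi\<^sub>M B (\<lambda>_. lborel)) =
        (\<integral>\<^sup>+z. f (\<Sum>b\<in>B. z b *\<^sub>R b) \<partial>Pi\<^sub>M B (\<lambda>_. lborel))" by simp
  qed measurable
qed

text \<open>The two choices inside \<open>flat_lborel\<close> are exposed here once, with only the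
  properties that characterise them. Later integration works with any origin and basis of this kind;
  in particular the origin need not be the foot of a perpendicular.\<close>

lemma flat_lborel_hyperplane:
  fixes n :: "real^'n"
  assumes n: "norm n = 1" and H: "H = {x. n \<bullet> x = \<beta>}"
  obtains a B where "n \<bullet> a = \<beta>" and "pairwise orthogonal B" and "\<forall>b\<in>B. norm b = 1"
    and "span B = {x. n \<bullet> x = 0}"
    and "flat_lborel H = distr (\<Pi>\<^sub>M b\<in>B. lborel) borel (\<lambda>y. a + (\<Sum>b\<in>B. y b *\<^sub>R b))"
proof -
  define a where "a = (SOME a. a \<in> H)"
  have "\<beta> *\<^sub>R n \<in> H" using n H by (simp add: norm_eq_1)
  then have aH: "a \<in> H" unfolding a_def by (rule someI)
  have dir: "(\<lambda>x. x - a) ` H = {x. n \<bullet> x = 0}"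
  proof (intro equalityI subsetI)
    fix x assume "x \<in> {x. n \<bullet> x = 0}"
    then have "x + a \<in> H" using aH H by (simp add: inner_add_right)
    then show "x \<in> (\<lambda>x. x - a) ` H" by force
  qed (use aH H in \<open>auto simp: inner_diff_right\<close>)
  define P where "P B \<longleftrightarrow> pairwise orthogonal B \<and> (\<forall>b\<in>B. norm b = 1) \<and>
    span B = (\<lambda>x. x - a) ` H" for B
  define B where "B = (SOME B. P B)"
  have "subspace {x. n \<bullet> x = 0}" by (rule subspace_hyperplane)
  then have "\<exists>B. P B"
    using orthonormal_basis_subspace[of "{x. n \<bullet> x = 0}"] unfolding P_def dir by metis
  then have PB: "P B" unfolding B_def by (rule someI_ex)
  show thesis
  proof (rule that[of a B])
    show "flat_lborel H = distr (\<Pi>\<^sub>M b\<in>B. lborel) borel (\<lambda>y. a + (\<Sum>b\<in>B. y b *\<^sub>R b))"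
      unfolding flat_lborel_def Let_def B_def P_def a_def by (rule refl)
  qed (use PB aH H dir in \<open>auto simp: P_def\<close>)
qed

section \<open>Conical coordinates over a hyperplane\<close>

lemma orthonormal_insert_normal:
  fixes n :: "real^'n"
  assumes n: "norm n = 1" and B: "pairwise orthogonal B" "\<And>b. b \<in> B \<Longrightarrow> norm b = 1"
    and span: "span B = {x. n \<bullet> x = 0}"
  shows "finite B" and "n \<notin> B" and "pairwise orthogonal (insert n B)"
    and "span (insert n B) = UNIV" and "card B = CARD('n) - 1"
proof -
  show fin: "finite B" by (rule orthonormal_basis_independent(2)[OF B])
  have nb: "n \<bullet> b = 0" if "b \<in> B" for b
    using span_base[OF that] span by auto
  show nB: "n \<notin> B" using nb[of n] n by (auto simp: norm_eq_1)
  show pw: "pairwise orthogonal (insert n B)"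
    using B(1) nb by (auto simp: pairwise_insert orthogonal_def inner_commute)
  show sp: "span (insert n B) = UNIV"
  proof -
    have "x \<in> span (insert n B)" for x
    proof -
      have "x - (n \<bullet> x) *\<^sub>R n \<in> span B"
        using n by (simp add: span inner_diff_right norm_eq_1)
      then show ?thesis by (auto simp: span_insert)
    qed
    then show ?thesis by auto
  qed
  have "card (insert n B) = CARD('n)"
  proof -
    have "independent (insert n B)"
      using orthonormal_basis_independent(1)[OF pw] n B(2) by auto
    from dim_eq_card_independent[OF this] show ?thesis
      by (metis sp dim_UNIV dim_span DIM_cart DIM_real mult.right_neutral)
  qed
  then show "card B = CARD('n) - 1" using fin nB by simp
qed

text \<open>The coordinates are \<open>x = c + t *\<^sub>R (y - c)\<close> with \<open>y\<close> in
  the hyperplane. The height of \<open>x\<close> over \<open>c\<close> in direction \<open>n\<close>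
  is \<open>d * t\<close>, which gives the factor \<open>d\<close>; the slice at that height is the
  hyperplane dilated by \<open>t\<close>, which gives \<open>t ^ (CARD('n) - 1)\<close>. One scalar
  substitution and one dilation suffice, so no Jacobian determinant occurs.\<close>

lemma cone_nn_integral:
  fixes n :: "real^'n" and F :: "real^'n \<Rightarrow> ennreal"
  assumes n: "norm n = 1" and B: "pairwise orthogonal B" "\<And>b. b \<in> B \<Longrightarrow> norm b = 1"
    and span: "span B = {x. n \<bullet> x = 0}" and d: "0 < d" and a: "n \<bullet> (a - c) = d"
    and [measurable]: "F \<in> borel_measurable borel"
  shows "(\<integral>\<^sup>+x. indicator {x. 0 < n \<bullet> (x - c)} x * F x \<partial>lborel) =
    (\<integral>\<^sup>+t. (\<integral>\<^sup>+y. indicator {0<..} t * ennreal (d * t ^ (CARD('n) - 1)) *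
        F (c + t *\<^sub>R (a + (\<Sum>b\<in>B. y b *\<^sub>R b) - c)) \<partial>Pi\<^sub>M B (\<lambda>_. lborel)) \<partial>lborel)"
proof -
  note ins = orthonormal_insert_normal[OF n B span]
  note [simp] = ins(1,2)
  let ?F = "\<lambda>x. indicator {x. 0 < n \<bullet> (x - c)} x * F x"
  let ?M = "Pi\<^sub>M B (\<lambda>_. lborel) :: (real^'n \<Rightarrow> real) measure"
  have "(\<integral>\<^sup>+x. ?F x \<partial>lborel) = (\<integral>\<^sup>+x. ?F (c + x) \<partial>lborel)"
    by (rule nn_integral_lborel_translate[symmetric]) measurable
  also have "\<dots> = (\<integral>\<^sup>+z. ?F (c + (\<Sum>b\<in>insert n B. z b *\<^sub>R b)) \<partial>Pi\<^sub>M (insert n B) (\<lambda>_. lborel))"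
    using n B(2) by (subst distr_orthonormal_lborel[OF ins(3) _ ins(4), symmetric])
      (auto simp: nn_integral_distr)
  also have "\<dots> = (\<integral>\<^sup>+\<tau>. (\<integral>\<^sup>+z. ?F (c + (\<Sum>b\<in>insert n B. (z(n := \<tau>)) b *\<^sub>R b)) \<partial>?M) \<partial>lborel)"
    by (rule lborel_product.product_nn_integral_insert_rev) simp_all
  also have "\<dots> = (\<integral>\<^sup>+\<tau>. (\<integral>\<^sup>+z. ?F (c + \<tau> *\<^sub>R n + (\<Sum>b\<in>B. z b *\<^sub>R b)) \<partial>?M) \<partial>lborel)"
  proof -
    have "(\<Sum>b\<in>insert n B. (z(n := \<tau>)) b *\<^sub>R b) = \<tau> *\<^sub>R n + (\<Sum>b\<in>B. z b *\<^sub>R b)" for z \<tau>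
    proof -
      have "(\<Sum>b\<in>B. (z(n := \<tau>)) b *\<^sub>R b) = (\<Sum>b\<in>B. z b *\<^sub>R b)"
        by (intro sum.cong) (use ins(2) in auto)
      then show ?thesis by simp
    qed
    then show ?thesis by (simp add: add.assoc)
  qed
  also have "\<dots> = ennreal \<bar>d\<bar> *
      (\<integral>\<^sup>+t. (\<integral>\<^sup>+z. ?F (c + (0 + d * t) *\<^sub>R n + (\<Sum>b\<in>B. z b *\<^sub>R b)) \<partial>?M) \<partial>lborel)"
  proof (rule nn_integral_real_affine)
    interpret sigma_finite_measure ?M by (rule lborel_product.sigma_finite) simp
    show "(\<lambda>\<tau>. \<integral>\<^sup>+z. ?F (c + \<tau> *\<^sub>R n + (\<Sum>b\<in>B. z b *\<^sub>R b)) \<partial>?M) \<in> borel_measurable borel"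
      by measurable
  qed (use d in simp)
  also have "\<dots> = (\<integral>\<^sup>+t. ennreal d * (\<integral>\<^sup>+z. ?F (c + (d * t) *\<^sub>R n + (\<Sum>b\<in>B. z b *\<^sub>R b)) \<partial>?M) \<partial>lborel)"
  proof -
    interpret sigma_finite_measure ?M by (rule lborel_product.sigma_finite) simp
    show ?thesis using d by (subst nn_integral_cmult) simp_all
  qed
  also have "\<dots> = (\<integral>\<^sup>+t. (\<integral>\<^sup>+y. indicator {0<..} t * ennreal (d * t ^ (CARD('n) - 1)) *
        F (c + t *\<^sub>R (a + (\<Sum>b\<in>B. y b *\<^sub>R b) - c)) \<partial>?M) \<partial>lborel)"
  proof (rule nn_integral_cong)
    fix t :: real
    have pos: "0 < n \<bullet> (c + (d * t) *\<^sub>R n + (\<Sum>b\<in>B. z b *\<^sub>R b) - c) \<longleftrightarrow> 0 < t" for z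
    proof -
      have "(\<Sum>b\<in>B. z b *\<^sub>R b) \<in> span B" by (intro span_sum span_scale span_base)
      then have "n \<bullet> (\<Sum>b\<in>B. z b *\<^sub>R b) = 0" using span by simp
      then show ?thesis using n d by (simp add: inner_add_right norm_eq_1 zero_less_mult_iff)
    qed
    show "ennreal d * (\<integral>\<^sup>+z. ?F (c + (d * t) *\<^sub>R n + (\<Sum>b\<in>B. z b *\<^sub>R b)) \<partial>?M) =
      (\<integral>\<^sup>+y. indicator {0<..} t * ennreal (d * t ^ (CARD('n) - 1)) *
        F (c + t *\<^sub>R (a + (\<Sum>b\<in>B. y b *\<^sub>R b) - c)) \<partial>?M)"
    proof (cases "0 < t")
      case False
      then show ?thesis using pos by (simp add: indicator_def)
    next
      case True
      \<comment> \<open>The origin \<open>a\<close> may be off the axis through \<open>c\<close> in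
        direction \<open>n\<close>. Its components along \<open>B\<close> shift the slice at height
        \<open>d * t\<close> by \<open>t\<close> times these components.\<close>
      let ?s = "\<lambda>b. t * ((a - c) \<bullet> b)"
      have exp: "(\<Sum>b\<in>B. ((a - c) \<bullet> b) *\<^sub>R b) = a - c - d *\<^sub>R n"
      proof -
        have "(\<Sum>b\<in>insert n B. ((a - c) \<bullet> b) *\<^sub>R b) = a - c"
          using n B(2) ins(4) by (intro orthonormal_expansion[OF ins(3)]) auto
        then show ?thesis using a by (simp add: inner_commute algebra_simps)
      qed
      have "(\<integral>\<^sup>+z. ?F (c + (d * t) *\<^sub>R n + (\<Sum>b\<in>B. z b *\<^sub>R b)) \<partial>?M) =
          (\<integral>\<^sup>+z. F (c + (d * t) *\<^sub>R n + (\<Sum>b\<in>B. z b *\<^sub>R b)) \<partial>?M)"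
        using pos True by (simp add: indicator_def)
      also have "\<dots> = ennreal (\<bar>t\<bar> ^ card B) *
          (\<integral>\<^sup>+y. F (c + (d * t) *\<^sub>R n + (\<Sum>b\<in>B. (\<lambda>b\<in>B. ?s b + t * y b) b *\<^sub>R b)) \<partial>?M)"
        using True by (intro nn_integral_PiM_affine) simp_all
      also have "\<dots> = ennreal (t ^ (CARD('n) - 1)) *
          (\<integral>\<^sup>+y. F (c + t *\<^sub>R (a + (\<Sum>b\<in>B. y b *\<^sub>R b) - c)) \<partial>?M)"
      proof -
        have "c + (d * t) *\<^sub>R n + (\<Sum>b\<in>B. (\<lambda>b\<in>B. ?s b + t * y b) b *\<^sub>R b) =
            c + t *\<^sub>R (a + (\<Sum>b\<in>B. y b *\<^sub>R b) - c)" for y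
        proof -
          have "(\<Sum>b\<in>B. (\<lambda>b\<in>B. ?s b + t * y b) b *\<^sub>R b) =
              t *\<^sub>R (\<Sum>b\<in>B. ((a - c) \<bullet> b) *\<^sub>R b) + t *\<^sub>R (\<Sum>b\<in>B. y b *\<^sub>R b)"
            by (simp add: scaleR_add_left sum.distrib scaleR_sum_right)
          then show ?thesis unfolding exp by (simp add: scaleR_add_right scaleR_diff_right mult.commute)
        qed
        then show ?thesis by (simp only: abs_of_pos[OF True] ins(5))
      qed
      finally show ?thesis
        using True d by (simp add: nn_integral_cmult ennreal_mult mult.assoc)
    qed
  qed
  finally show ?thesis .
qed

text \<open>The ray from \<open>c\<close> through \<open>x\<close> meets the hyperplane at the
  factor \<open>d / (n \<bullet> (x - c))\<close>, and \<open>x\<close> lies before that point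
  exactly when the height is below \<open>d\<close>. The union of segments becomes a condition that
  is visibly Borel, and open for a relatively open face.\<close>

lemma face_cone_alt:
  fixes n :: "real^'n"
  assumes d: "0 < d" and \<sigma>: "\<And>y. y \<in> \<sigma> \<Longrightarrow> n \<bullet> (y - c) = d"
  shows "face_cone c \<sigma> =
    {x. 0 < n \<bullet> (x - c) \<and> n \<bullet> (x - c) < d \<and> c + (d / (n \<bullet> (x - c))) *\<^sub>R (x - c) \<in> \<sigma>}"
    (is "_ = ?R")
proof (intro equalityI subsetI)
  fix x assume "x \<in> face_cone c \<sigma>"
  then obtain y where y: "y \<in> \<sigma>" "x \<in> open_segment c y" by (auto simp: face_cone_def)
  then obtain u where u: "0 < u" "u < 1" "x = (1 - u) *\<^sub>R c + u *\<^sub>R y" by (auto simp: in_segment)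
  then have x: "x - c = u *\<^sub>R (y - c)" by (simp add: algebra_simps)
  then have "n \<bullet> (x - c) = u * d" using \<sigma>[OF y(1)] by simp
  then show "x \<in> ?R" using x u d y(1) by simp
next
  fix x assume x: "x \<in> ?R"
  define u where "u = (n \<bullet> (x - c)) / d"
  define y where "y = c + (d / (n \<bullet> (x - c))) *\<^sub>R (x - c)"
  have u: "0 < u" "u < 1" using x d by (auto simp: u_def)
  have "u *\<^sub>R (y - c) = x - c" using x d by (simp add: y_def u_def)
  then have "x = (1 - u) *\<^sub>R c + u *\<^sub>R y" by (simp add: algebra_simps)
  moreover have "y \<noteq> c" using \<sigma>[of y] x d by (auto simp: y_def)
  ultimately have "x \<in> open_segment c y" using u by (auto simp: in_segment)
  then show "x \<in> face_cone c \<sigma>" using x by (auto simp: face_cone_def y_def)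
qed

lemma face_cone_measurable:
  fixes n :: "real^'n"
  assumes d: "0 < d" and \<sigma>: "\<And>y. y \<in> \<sigma> \<Longrightarrow> n \<bullet> (y - c) = d" and [measurable]: "\<sigma> \<in> sets borel"
  shows "face_cone c \<sigma> \<in> sets borel"
proof -
  have "{x \<in> space borel. 0 < n \<bullet> (x - c) \<and> n \<bullet> (x - c) < d \<and>
      c + (d / (n \<bullet> (x - c))) *\<^sub>R (x - c) \<in> \<sigma>} \<in> sets borel"
    by measurable
  then show ?thesis using face_cone_alt[OF d \<sigma>] by simp
qed

text \<open>By \<open>cone_nn_integral\<close> on indicators, Lebesgue measure on the half-space is
  the image of a weighted product of the \<open>t\<close>-axis and the hyperplane; signed integrals
  then follow from Fubini. The integrability that Fubini yields is kept as a second claim because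
  finiteness of the face measure is read off from it.\<close>

lemma cone_integral:
  fixes n :: "real^'n" and F :: "real^'n \<Rightarrow> real"
  assumes n: "norm n = 1" and d: "0 < d" and hull: "affine hull \<sigma> = {x. n \<bullet> (x - c) = d}"
    and [measurable]: "\<sigma> \<in> sets borel" "F \<in> borel_measurable borel"
    and F: "set_integrable lborel (face_cone c \<sigma>) F"
  shows "(LINT x:face_cone c \<sigma>|lborel. F x) =
    (LINT y:\<sigma>|flat_lborel (affine hull \<sigma>).
       LINT t:{0<..<1}|lborel. d * t ^ (CARD('n) - 1) * F (c + t *\<^sub>R (y - c)))" (is ?eq)
    and "set_integrable (flat_lborel (affine hull \<sigma>)) \<sigma>
       (\<lambda>y. LINT t:{0<..<1}|lborel. d * t ^ (CARD('n) - 1) * F (c + t *\<^sub>R (y - c)))" (is ?int)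
proof -
  have \<sigma>: "n \<bullet> (y - c) = d" if "y \<in> \<sigma>" for y
    using hull_subset[of \<sigma> affine] that hull by auto
  note [measurable] = face_cone_measurable[OF d \<sigma>]
  have "affine hull \<sigma> = {x. n \<bullet> x = d + n \<bullet> c}"
    using hull by (simp add: inner_diff_right algebra_simps)
  from flat_lborel_hyperplane[OF n this] obtain a B where a: "n \<bullet> a = d + n \<bullet> c"
    and B0: "pairwise orthogonal B" "\<forall>b\<in>B. norm b = 1" "span B = {x. n \<bullet> x = 0}"
    and flat: "flat_lborel (affine hull \<sigma>) =
      distr (\<Pi>\<^sub>M b\<in>B. lborel) borel (\<lambda>y. a + (\<Sum>b\<in>B. y b *\<^sub>R b))" .
  then have B: "pairwise orthogonal B" "\<And>b. b \<in> B \<Longrightarrow> norm b = 1" "span B = {x. n \<bullet> x = 0}"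
    by auto
  have a': "n \<bullet> (a - c) = d" using a by (simp add: inner_diff_right)
  have fin: "finite B" by (rule orthonormal_insert_normal(1)[OF n B])
  let ?M = "Pi\<^sub>M B (\<lambda>_. lborel) :: (real^'n \<Rightarrow> real) measure"
  define p where "p y = a + (\<Sum>b\<in>B. y b *\<^sub>R b)" for y :: "real^'n \<Rightarrow> real"
  have [measurable]: "p \<in> borel_measurable ?M" unfolding p_def by measurable
  have np: "n \<bullet> (p y - c) = d" for y
  proof -
    have "(\<Sum>b\<in>B. y b *\<^sub>R b) \<in> span B" by (intro span_sum span_scale span_base)
    then show ?thesis using B(3) a by (simp add: p_def inner_add_right inner_diff_right)
  qed
  define \<Phi> where "\<Phi> = (\<lambda>(t, y). c + t *\<^sub>R (p y - c))"
  define w where "w = (\<lambda>(t, y::real^'n \<Rightarrow> real). indicator {0<..} t * ennreal (d * t ^ (CARD('n) - 1)))"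
  interpret M: sigma_finite_measure ?M by (rule lborel_product.sigma_finite) (rule fin)
  interpret P: pair_sigma_finite "lborel :: real measure" ?M ..
  have [measurable]: "\<Phi> \<in> borel_measurable (lborel \<Otimes>\<^sub>M ?M)" unfolding \<Phi>_def by measurable
  have [measurable]: "w \<in> borel_measurable (lborel \<Otimes>\<^sub>M ?M)" unfolding w_def by measurable
  let ?H = "{x. 0 < n \<bullet> (x - c)}"
  have eq: "density lborel (indicator ?H) = distr (density (lborel \<Otimes>\<^sub>M ?M) w) borel \<Phi>"
  proof (rule measure_eqI)
    fix A assume "A \<in> sets (density lborel (indicator ?H))"
    then have A[measurable]: "A \<in> sets borel" by simp
    have "emeasure (density lborel (indicator ?H)) A = (\<integral>\<^sup>+x. indicator ?H x * indicator A x \<partial>lborel)"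
      by (simp add: emeasure_density)
    also have "\<dots> = (\<integral>\<^sup>+t. (\<integral>\<^sup>+y. w (t, y) * indicator A (\<Phi> (t, y)) \<partial>?M) \<partial>lborel)"
      unfolding w_def \<Phi>_def p_def split by (rule cone_nn_integral[OF n B d a']) measurable
    also have "\<dots> = (\<integral>\<^sup>+z. w z * indicator A (\<Phi> z) \<partial>(lborel \<Otimes>\<^sub>M ?M))"
      by (rule M.nn_integral_fst) measurable
    also have "\<dots> = (\<integral>\<^sup>+z. indicator A (\<Phi> z) \<partial>density (lborel \<Otimes>\<^sub>M ?M) w)"
      by (subst nn_integral_density) measurable
    also have "\<dots> = (\<integral>\<^sup>+x. indicator A x \<partial>distr (density (lborel \<Otimes>\<^sub>M ?M) w) borel \<Phi>)"
      by (subst nn_integral_distr) measurable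
    also have "\<dots> = emeasure (distr (density (lborel \<Otimes>\<^sub>M ?M) w) borel \<Phi>) A"
      by simp
    finally show "emeasure (density lborel (indicator ?H)) A =
        emeasure (distr (density (lborel \<Otimes>\<^sub>M ?M) w) borel \<Phi>) A" .
  qed simp
  let ?C = "face_cone c \<sigma>"
  let ?G = "\<lambda>x. indicator ?C x * F x"
  \<comment> \<open>A real-valued copy of the weight \<open>w\<close>, as Bochner integrals take
    real densities.\<close>
  define w' where "w' = (\<lambda>(t, y::real^'n \<Rightarrow> real). indicator {0<..} t * (d * t ^ (CARD('n) - 1)) :: real)"
  have [measurable]: "w' \<in> borel_measurable (lborel \<Otimes>\<^sub>M ?M)" unfolding w'_def by measurable
  have w'0: "0 \<le> w' z" for z using d by (auto simp: w'_def split: prod.splits simp: indicator_def)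
  have ww': "w = (\<lambda>z. ennreal (w' z))" by (auto simp: w_def w'_def fun_eq_iff indicator_def)
  have C_H: "?C \<subseteq> ?H" using face_cone_alt[OF d \<sigma>] by auto
  have densH: "density lborel (indicator ?H) = density lborel (\<lambda>x. ennreal (indicator ?H x :: real))"
    by (simp add: ennreal_indicator)
  have iH: "integrable (density lborel (indicator ?H)) ?G"
  proof -
    have "(\<lambda>x. (indicator ?H x :: real) *\<^sub>R ?G x) = ?G"
      using C_H by (auto simp: indicator_def fun_eq_iff)
    then show ?thesis
      unfolding densH using F by (subst integrable_density) (simp_all add: set_integrable_def)
  qed
  have i2: "integrable (lborel \<Otimes>\<^sub>M ?M) (\<lambda>z. w' z * ?G (\<Phi> z))"
    using iH unfolding eq ww'
    by (subst (asm) integrable_distr_eq, measurable, subst (asm) integrable_density)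
       (simp_all add: w'0)
  \<comment> \<open>In these coordinates the cone is a product: the unit interval for
    \<open>t\<close> and the face for the point on the hyperplane.\<close>
  have inC: "indicator {0<..} t * indicator ?C (\<Phi> (t, y)) = (indicator {0<..<1} t * indicator \<sigma> (p y) :: real)"
    for t y
  proof (cases "0 < t")
    case True
    have "\<Phi> (t, y) - c = t *\<^sub>R (p y - c)" by (simp add: \<Phi>_def)
    then have "\<Phi> (t, y) \<in> ?C \<longleftrightarrow> 0 < t * d \<and> t * d < d \<and> c + (d / (t * d)) *\<^sub>R t *\<^sub>R (p y - c) \<in> \<sigma>"
      by (simp only: face_cone_alt[OF d \<sigma>] mem_Collect_eq inner_scaleR_right np)
    then have "\<Phi> (t, y) \<in> ?C \<longleftrightarrow> t < 1 \<and> p y \<in> \<sigma>"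
      using True d by simp
    then show ?thesis using True by (simp add: indicator_def)
  qed (simp add: indicator_def)
  have inner: "(LINT t|lborel. w' (t, y) * ?G (\<Phi> (t, y))) = indicator \<sigma> (p y) *
      (LINT t:{0<..<1}|lborel. d * t ^ (CARD('n) - 1) * F (c + t *\<^sub>R (p y - c)))" for y
  proof -
    have "w' (t, y) * ?G (\<Phi> (t, y)) = indicator \<sigma> (p y) *
      (indicator {0<..<1} t *\<^sub>R (d * t ^ (CARD('n) - 1) * F (c + t *\<^sub>R (p y - c))))" for t
    proof -
      have "w' (t, y) * ?G (\<Phi> (t, y)) =
        (indicator {0<..} t * indicator ?C (\<Phi> (t, y))) * (d * t ^ (CARD('n) - 1) * F (c + t *\<^sub>R (p y - c)))"
        by (simp add: w'_def \<Phi>_def)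
      then show ?thesis unfolding inC by simp
    qed
    then show ?thesis by (simp add: set_lebesgue_integral_def)
  qed
  show ?int
    using P.integrable_snd[of "\<lambda>t y. w' (t, y) * ?G (\<Phi> (t, y))"] i2
    unfolding flat p_def[symmetric] set_integrable_def
    by (subst integrable_distr_eq) (simp_all add: case_prod_beta' inner set_lebesgue_integral_def)
  have "(LINT x:?C|lborel. F x) = integral\<^sup>L (density lborel (indicator ?H)) ?G"
    unfolding densH set_lebesgue_integral_def
  proof (subst integral_density)
    show "(LINT x|lborel. indicator ?C x *\<^sub>R F x) = (LINT x|lborel. (indicator ?H x :: real) *\<^sub>R ?G x)"
      using C_H by (intro Bochner_Integration.integral_cong) (auto simp: indicator_def)
  qed simp_all
  also have "\<dots> = (LINT z|(lborel \<Otimes>\<^sub>M ?M). w' z * ?G (\<Phi> z))"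
    unfolding eq ww'
    by (subst integral_distr, measurable, subst integral_density) (simp_all add: w'0)
  also have "\<dots> = (LINT y|?M. LINT t|lborel. w' (t, y) * ?G (\<Phi> (t, y)))"
    using P.integral_snd[of "\<lambda>t y. w' (t, y) * ?G (\<Phi> (t, y))"] i2
    by (simp add: case_prod_beta')
  also have "\<dots> = (LINT y|?M. indicator \<sigma> (p y) *
      (LINT t:{0<..<1}|lborel. d * t ^ (CARD('n) - 1) * F (c + t *\<^sub>R (p y - c))))"
    by (simp only: inner)
  also have "\<dots> = (LINT y:\<sigma>|flat_lborel (affine hull \<sigma>).
       LINT t:{0<..<1}|lborel. d * t ^ (CARD('n) - 1) * F (c + t *\<^sub>R (y - c)))"
    unfolding flat p_def[symmetric] set_lebesgue_integral_def
    by (subst integral_distr) simp_all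
  finally show ?eq .
qed

lemma set_lebesgue_integral_lebesgue:
  fixes F :: "'a::euclidean_space \<Rightarrow> 'b::{banach,second_countable_topology}"
  assumes "S \<in> sets borel" "F \<in> borel_measurable borel"
  shows "(LINT x:S|lebesgue. F x) = (LINT x:S|lborel. F x)"
  unfolding set_lebesgue_integral_def
  by (rule integral_completion) (use assms in measurable)

lemma set_integrable_lebesgue:
  fixes F :: "'a::euclidean_space \<Rightarrow> 'b::{banach,second_countable_topology}"
  assumes "S \<in> sets borel" "F \<in> borel_measurable borel"
  shows "set_integrable lebesgue S F \<longleftrightarrow> set_integrable lborel S F"
  unfolding set_integrable_def
  by (rule integrable_completion) (use assms in measurable)

lemma set_integrable_continuous_bounded:
  fixes F :: "'a::euclidean_space \<Rightarrow> 'b::{banach,second_countable_topology}"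
  assumes S: "bounded S" "S \<in> sets borel" and F: "continuous_on UNIV F"
  shows "set_integrable lborel S F"
proof (rule set_integrable_subset)
  have "compact (closure S)" using S(1) by simp
  then show "set_integrable lborel (closure S) F"
    unfolding set_integrable_def
    using borel_integrable_compact[of "closure S" F] continuous_on_subset[OF F] by simp
qed (use S closure_subset in auto)

lemma set_integral_FTC_Ioo:
  fixes f F :: "real \<Rightarrow> real"
  assumes "\<And>t. (F has_real_derivative f t) (at t)" and "continuous_on UNIV f"
  shows "(LINT t:{0<..<1}|lborel. f t) = F 1 - F 0"
proof -
  have "(LBINT t=ereal 0..ereal 1. f t) = F 1 - F 0"
    by (rule interval_integral_FTC_finite)
      (use assms in \<open>auto intro: continuous_on_subset has_vector_derivative_at_within
        simp: has_real_derivative_iff_has_vector_derivative\<close>)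
  then show ?thesis
    by (simp add: interval_lebesgue_integral_def)
qed

lemma set_integrable_unit_interval:
  fixes f :: "real \<Rightarrow> real"
  assumes "continuous_on UNIV f"
  shows "set_integrable lborel {0<..<1} f"
  by (rule set_integrable_continuous_bounded)
    (use assms bounded_subset[OF bounded_closed_interval[of 0 1]] in auto)

section \<open>Integrals over one cone and over its face\<close>

locale hyperplane_cone =
  fixes c n :: "real^'n" and d :: real and \<sigma> :: "(real^'n) set"
  assumes n: "norm n = 1" and d: "0 < d"
    and hull: "affine hull \<sigma> = {x. n \<bullet> (x - c) = d}"
    and rel_open_face: "rel_open \<sigma>" and bounded_face: "bounded \<sigma>"
begin

abbreviation "Cone \<equiv> face_cone c \<sigma>"
abbreviation "flat \<equiv> flat_lborel (affine hull \<sigma>)"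

lemma on_face: "y \<in> \<sigma> \<Longrightarrow> n \<bullet> (y - c) = d"
  using hull_subset[of \<sigma> affine] hull by auto

lemma face_open: "\<exists>U. open U \<and> \<sigma> = {x. n \<bullet> (x - c) = d} \<inter> U"
  using rel_open_face unfolding rel_open hull[symmetric] openin_open by auto

lemma face_borel: "\<sigma> \<in> sets borel"
proof -
  obtain U where "open U" "\<sigma> = {x. n \<bullet> (x - c) = d} \<inter> U" using face_open by blast
  moreover have "closed {x. n \<bullet> (x - c) = d}"
    by (intro closed_Collect_eq continuous_intros)
  ultimately show ?thesis by auto
qed

lemma cone_alt: "Cone =
    {x. 0 < n \<bullet> (x - c) \<and> n \<bullet> (x - c) < d \<and> c + (d / (n \<bullet> (x - c))) *\<^sub>R (x - c) \<in> \<sigma>}"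
  by (rule face_cone_alt[OF d on_face])

lemma cone_borel: "Cone \<in> sets borel"
  by (rule face_cone_measurable[OF d on_face face_borel])

text \<open>Unlike \<open>Cone\<close>, the infinite cone contains the face itself. Its openness
  gives every face point a neighbourhood, reaching to both sides of the hyperplane, on which the
  gauge of a cell is affine.\<close>

lemma open_radial_face: "open {x. 0 < n \<bullet> (x - c) \<and> c + (d / (n \<bullet> (x - c))) *\<^sub>R (x - c) \<in> \<sigma>}"
proof -
  obtain U where U: "open U" "\<sigma> = {x. n \<bullet> (x - c) = d} \<inter> U" using face_open by blast
  let ?S = "{x. 0 < n \<bullet> (x - c)}" and ?r = "\<lambda>x. c + (d / (n \<bullet> (x - c))) *\<^sub>R (x - c)"
  have S: "open ?S" by (intro open_Collect_less continuous_intros)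
  have "continuous_on ?S ?r" by (intro continuous_intros) auto
  then have "open (?S \<inter> ?r -` U)" using continuous_on_open_vimage[OF S, of ?r] U(1)
    by (simp only: Int_commute)
  moreover have "?S \<inter> ?r -` U = {x. 0 < n \<bullet> (x - c) \<and> ?r x \<in> \<sigma>}"
    using d by (auto simp: U(2))
  ultimately show ?thesis by simp
qed

lemma open_cone: "open Cone"
proof -
  have "open {x. n \<bullet> (x - c) < d}" by (intro open_Collect_less continuous_intros)
  then have "open ({x. 0 < n \<bullet> (x - c) \<and> c + (d / (n \<bullet> (x - c))) *\<^sub>R (x - c) \<in> \<sigma>} \<inter>
      {x. n \<bullet> (x - c) < d})"
    using open_radial_face by (rule open_Int[rotated])
  then show ?thesis unfolding cone_alt by (simp add: Int_def conj_commute conj_left_commute)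
qed

lemma bounded_cone: "bounded Cone"
proof -
  obtain r where r: "\<And>y. y \<in> \<sigma> \<Longrightarrow> dist c y \<le> r" using bounded_face bounded_any_center by metis
  have "dist c x \<le> r" if x: "x \<in> Cone" for x
  proof -
    from x obtain y where y: "y \<in> \<sigma>" "x \<in> open_segment c y"
      unfolding face_cone_def by blast
    then have "dist c x \<le> dist c y"
      using dist_in_open_segment[of x c y] by (simp add: dist_commute)
    then show ?thesis using r[OF y(1)] by simp
  qed
  then show ?thesis unfolding bounded_def by blast
qed

lemma face_nonempty: "\<sigma> \<noteq> {}"
proof
  assume "\<sigma> = {}"
  moreover have "c + d *\<^sub>R n \<in> affine hull \<sigma>" unfolding hull using n by (simp add: norm_eq_1)
  ultimately show False by simp
qed

lemma cone_nonempty: "Cone \<noteq> {}"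
proof -
  obtain y where y: "y \<in> \<sigma>" using face_nonempty by blast
  then have "y \<noteq> c" using on_face[OF y] d by auto
  then have "open_segment c y \<noteq> {}" by (simp add: eq_commute)
  then show ?thesis using y by (auto simp: face_cone_def)
qed

lemma cone_integrable:
  fixes F :: "real^'n \<Rightarrow> 'b::{banach,second_countable_topology}"
  shows "continuous_on UNIV F \<Longrightarrow> set_integrable lborel Cone F"
  by (intro set_integrable_continuous_bounded bounded_cone cone_borel)

lemma cone_integral_continuous:
  fixes F :: "real^'n \<Rightarrow> real"
  assumes F: "continuous_on UNIV F"
  shows "(LINT x:Cone|lebesgue. F x) = (LINT y:\<sigma>|flat.
      LINT t:{0<..<1}|lborel. d * t ^ (CARD('n) - 1) * F (c + t *\<^sub>R (y - c)))"
    and "set_integrable flat \<sigma>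
       (\<lambda>y. LINT t:{0<..<1}|lborel. d * t ^ (CARD('n) - 1) * F (c + t *\<^sub>R (y - c)))"
  using cone_integral[OF n d hull face_borel borel_measurable_continuous_onI[OF F] cone_integrable[OF F]]
    set_lebesgue_integral_lebesgue[OF cone_borel borel_measurable_continuous_onI[OF F]]
  by simp_all

lemma integral_power: "(LINT t:{0<..<1}|lborel. t ^ k :: real) = 1 / (real k + 1)"
proof -
  have "(LINT t:{0<..<1}|lborel. t ^ k :: real) = 1 / (real k + 1) * 1 ^ Suc k - 1 / (real k + 1) * 0 ^ Suc k"
  proof (rule set_integral_FTC_Ioo)
    fix t :: real
    show "((\<lambda>t. 1 / (real k + 1) * t ^ Suc k) has_real_derivative t ^ k) (at t)"
      by (rule DERIV_cong[OF DERIV_cmult[OF DERIV_pow]]) (simp add: field_simps)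
  qed (intro continuous_intros)
  then show ?thesis by simp
qed

lemma pred_card: "real (CARD('n) - Suc 0) + 1 = CARD('n)"
  "t ^ (CARD('n) - Suc 0) * t = (t::real) ^ CARD('n)"
  by (cases "CARD('n)"; simp)+

lemma sets_flat [simp]: "sets flat = sets borel" "space flat = UNIV"
  by (simp_all add: flat_lborel_def Let_def)

text \<open>For the constant 1 the inner integral over \<open>t\<close> is the constant
  \<open>d / CARD('n)\<close>, so integrability over the bounded cone forces the face to have finite
  measure.\<close>

lemma face_integrable_one: "set_integrable flat \<sigma> (\<lambda>_. 1::real)"
proof -
  have "set_integrable flat \<sigma> (\<lambda>y. d / CARD('n))"
    using cone_integral_continuous(2)[of "\<lambda>_. 1"] 
    by (simp add: integral_power pred_card)
  from set_integrable_mult_right[of "CARD('n) / d", OF this] show ?thesis using d by simp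
qed

lemma face_integrable:
  fixes F :: "real^'n \<Rightarrow> 'b::{banach,second_countable_topology}"
  assumes F: "continuous_on UNIV F"
  shows "set_integrable flat \<sigma> F"
proof -
  have "compact (closure \<sigma>)" using bounded_face by simp
  then have "bounded (F ` closure \<sigma>)"
    by (intro compact_imp_bounded compact_continuous_image continuous_on_subset[OF F]) auto
  then obtain b where "\<And>y. y \<in> closure \<sigma> \<Longrightarrow> norm (F y) \<le> b" by (auto simp: bounded_iff)
  then have b: "\<And>y. y \<in> \<sigma> \<Longrightarrow> norm (F y) \<le> b" using closure_subset by blast
  have [measurable]: "F \<in> borel_measurable borel" "\<sigma> \<in> sets borel"
    using F face_borel by (auto intro: borel_measurable_continuous_onI)
  have 1: "set_integrable flat \<sigma> (\<lambda>_. b)"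
    using set_integrable_mult_right[of b flat \<sigma> "\<lambda>_. 1"] face_integrable_one by simp
  have "F \<in> borel_measurable flat" "indicator \<sigma> \<in> borel_measurable flat"
    by (simp_all add: measurable_cong_sets[OF sets_flat(1) refl])
  then have meas: "(\<lambda>y. indicator \<sigma> y *\<^sub>R F y) \<in> borel_measurable flat"
    by (intro borel_measurable_scaleR)
  show ?thesis
    using 1 meas unfolding set_integrable_def
    by (rule Bochner_Integration.integrable_bound) (use b in \<open>force simp: indicator_def\<close>)
qed

lemma face_area_eq: "face_area \<sigma> = (LINT y:\<sigma>|flat. 1)"
  unfolding face_area_def set_lebesgue_integral_def using face_borel by simp

lemma measure_cone: "measure lebesgue Cone = face_area \<sigma> * d / CARD('n)"
proof -
  have "measure lebesgue Cone = (LINT x:Cone|lebesgue. 1)"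
    using cone_borel by (simp add: set_lebesgue_integral_def)
  also have "\<dots> = (LINT y:\<sigma>|flat. d / CARD('n))"
    using cone_integral_continuous(1)[of "\<lambda>_. 1"] by (simp add: integral_power pred_card)
  finally show ?thesis
    by (simp add: face_area_eq flip: set_integral_mult_left)
qed

lemma measure_cone_pos: "0 < measure lebesgue Cone"
  using open_cone cone_nonempty bounded_cone
  by (metis bounded_set_imp_lmeasurable lmeasurable_open measure_le_0_iff measure_nonneg negligible_iff_measure not_less open_not_negligible)

text \<open>The cone is open and nonempty, and its volume is a positive multiple of the area.
  Positivity makes \<open>face_center\<close> an actual mean value and later allows division by the
  area of a face.\<close>

lemma face_area_pos: "0 < face_area \<sigma>"
  using measure_cone_pos d unfolding measure_cone
  by (simp add: zero_less_divide_iff zero_less_mult_iff)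

lemma face_moment: "(LINT y:\<sigma>|flat. (y - c) \<bullet> e) = face_area \<sigma> * ((face_center \<sigma> - c) \<bullet> e)"
proof -
  have inty: "set_integrable flat \<sigma> (\<lambda>y. y)"
    by (intro face_integrable continuous_intros)
  have "(LINT y:\<sigma>|flat. (y - c) \<bullet> e) = (LINT y:\<sigma>|flat. y \<bullet> e) - (LINT y:\<sigma>|flat. c \<bullet> e)"
    unfolding inner_diff_left by (intro set_integral_diff face_integrable continuous_intros)
  also have "(LINT y:\<sigma>|flat. y \<bullet> e) = (LINT y:\<sigma>|flat. y) \<bullet> e"
    using inty unfolding set_lebesgue_integral_def set_integrable_def
    by (subst integral_inner_left[symmetric]) auto
  also have "(LINT y:\<sigma>|flat. c \<bullet> e) = (c \<bullet> e) * face_area \<sigma>"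
    unfolding face_area_eq by (simp flip: set_integral_mult_right)
  also have "(LINT y:\<sigma>|flat. y) = face_area \<sigma> *\<^sub>R face_center \<sigma>"
    using face_area_pos by (simp add: face_center_def)
  finally show ?thesis by (simp add: algebra_simps)
qed

text \<open>The factor x - c adds one power of \<open>t\<close> to the Jacobian, whence
  \<open>CARD('n) + 1\<close> in the denominator in place of \<open>CARD('n)\<close>. This number is
  the same for all cones, on which the cancellation of the cross terms in the energy relies.\<close>

lemma cone_moment:
  "(LINT x:Cone|lebesgue. (x - c) \<bullet> e) =
    face_area \<sigma> * d / (CARD('n) + 1) * ((face_center \<sigma> - c) \<bullet> e)"
proof -
  have "(LINT x:Cone|lebesgue. (x - c) \<bullet> e) =
      (LINT y:\<sigma>|flat. LINT t:{0<..<1}|lborel. d * ((y - c) \<bullet> e) * t ^ CARD('n))"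
  proof -
    have "d * t ^ (CARD('n) - 1) * ((c + t *\<^sub>R (y - c) - c) \<bullet> e) = d * ((y - c) \<bullet> e) * t ^ CARD('n)" for t y
      by (simp add: pred_card(2)[symmetric])
    moreover have "continuous_on UNIV (\<lambda>x. (x - c) \<bullet> e)" by (intro continuous_intros)
    ultimately show ?thesis by (simp only: cone_integral_continuous(1))
  qed
  also have "\<dots> = (LINT y:\<sigma>|flat. d / (CARD('n) + 1) * ((y - c) \<bullet> e))"
    by (simp add: integral_power)
  also have "\<dots> = d / (CARD('n) + 1) * (LINT y:\<sigma>|flat. (y - c) \<bullet> e)"
    by (simp only: set_integral_mult_right)
  finally show ?thesis by (simp add: face_moment)
qed

text \<open>The integrand is the divergence of \<open>\<phi>\<close> times the field x - c.
  Multiplied by the Jacobian it is, along a ray, the derivative of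
  \<open>d * t ^ CARD('n) * \<phi> (c + t *\<^sub>R (y - c))\<close>, which is 0 at the vertex and
  \<open>d * \<phi> y\<close> on the face.\<close>

lemma cone_radial_divergence:
  fixes \<phi> :: "real^'n \<Rightarrow> real" and G :: "real^'n \<Rightarrow> real^'n"
  assumes \<phi>: "\<And>x. (\<phi> has_derivative (\<lambda>h. G x \<bullet> h)) (at x)" and G: "continuous_on UNIV G"
  shows "(LINT x:Cone|lebesgue. G x \<bullet> (x - c) + CARD('n) * \<phi> x) = d * (LINT y:\<sigma>|flat. \<phi> y)"
proof -
  have c\<phi>: "continuous_on UNIV \<phi>"
    using \<phi> by (meson continuous_at_imp_continuous_on has_derivative_continuous)
  let ?f = "\<lambda>y t. d * t ^ (CARD('n) - 1) *
      (G (c + t *\<^sub>R (y - c)) \<bullet> (t *\<^sub>R (y - c)) + CARD('n) * \<phi> (c + t *\<^sub>R (y - c)))"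
  have "(LINT t:{0<..<1}|lborel. ?f y t) = d * \<phi> y" for y
  proof -
    let ?F = "\<lambda>t. d * t ^ CARD('n) * \<phi> (c + t *\<^sub>R (y - c))"
    have "(LINT t:{0<..<1}|lborel. ?f y t) = ?F 1 - ?F 0"
    proof (rule set_integral_FTC_Ioo)
      fix t :: real
      have 1: "((\<lambda>t. \<phi> (c + t *\<^sub>R (y - c))) has_real_derivative G (c + t *\<^sub>R (y - c)) \<bullet> (y - c)) (at t)"
        unfolding has_field_derivative_def
        by (rule has_derivative_eq_rhs[OF has_derivative_compose[OF _ \<phi>]])
           (auto intro!: derivative_eq_intros simp: fun_eq_iff)
      have 2: "((\<lambda>t. d * t ^ CARD('n)) has_real_derivative d * (CARD('n) * t ^ (CARD('n) - 1))) (at t)"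
        by (auto intro!: derivative_eq_intros)
      have t: "t ^ CARD('n) = t ^ (CARD('n) - 1) * t"
        by (simp add: pred_card(2))
      show "(?F has_real_derivative ?f y t) (at t)"
        by (rule DERIV_cong[OF DERIV_mult[OF 2 1]]) (simp add: t algebra_simps)
    next
      show "continuous_on UNIV (?f y)"
        by (intro continuous_intros continuous_on_compose2[OF G] continuous_on_compose2[OF c\<phi>]) auto
    qed
    then show ?thesis by simp
  qed
  then show ?thesis
    using G c\<phi> by (subst cone_integral_continuous(1)) (auto intro!: continuous_intros)
qed

text \<open>The weight is what \<open>tent\<close> is on this cone. It vanishes on the face, so no
  face term appears, and a weighted integral is exchanged for an unweighted one; this is how the
  weight is removed in the divergence theorem on a cell.\<close>

lemma cone_weighted_radial_divergence:
  fixes \<phi> :: "real^'n \<Rightarrow> real" and G :: "real^'n \<Rightarrow> real^'n"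
  assumes \<phi>: "\<And>x. (\<phi> has_derivative (\<lambda>h. G x \<bullet> h)) (at x)" and G: "continuous_on UNIV G"
  shows "(LINT x:Cone|lebesgue. (1 - n \<bullet> (x - c) / d) * (G x \<bullet> (x - c) + (CARD('n) + 1) * \<phi> x)) =
    (LINT x:Cone|lebesgue. \<phi> x)"
proof -
  have c\<phi>: "continuous_on UNIV \<phi>"
    using \<phi> by (meson continuous_at_imp_continuous_on has_derivative_continuous)
  let ?f = "\<lambda>y t. d * t ^ (CARD('n) - 1) * ((1 - n \<bullet> (t *\<^sub>R (y - c)) / d) *
      (G (c + t *\<^sub>R (y - c)) \<bullet> (t *\<^sub>R (y - c)) + (CARD('n) + 1) * \<phi> (c + t *\<^sub>R (y - c))))"
  let ?g = "\<lambda>y t. d * t ^ (CARD('n) - 1) * \<phi> (c + t *\<^sub>R (y - c))"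
  have cont: "continuous_on UNIV (?f y)" "continuous_on UNIV (?g y)" for y
    by (intro continuous_intros continuous_on_compose2[OF G] continuous_on_compose2[OF c\<phi>];
      use d in simp)+
  have "(LINT t:{0<..<1}|lborel. ?f y t) = (LINT t:{0<..<1}|lborel. ?g y t)" if "y \<in> \<sigma>" for y
  proof -
    \<comment> \<open>On the ray the weight is 1 - t, and this primitive vanishes at both ends. With
      D the dimension, its derivative contains -t^D = (1 - t) t^(D-1) - t^(D-1); this split is the
      origin of the coefficient D + 1 and of the unweighted term.\<close>
    let ?F = "\<lambda>t. d * ((1 - t) * t ^ CARD('n)) * \<phi> (c + t *\<^sub>R (y - c))"
    have "(LINT t:{0<..<1}|lborel. ?f y t - ?g y t) = ?F 1 - ?F 0"
    proof (rule set_integral_FTC_Ioo)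
      fix t :: real
      have 1: "((\<lambda>t. \<phi> (c + t *\<^sub>R (y - c))) has_real_derivative G (c + t *\<^sub>R (y - c)) \<bullet> (y - c)) (at t)"
        unfolding has_field_derivative_def
        by (rule has_derivative_eq_rhs[OF has_derivative_compose[OF _ \<phi>]])
           (auto intro!: derivative_eq_intros simp: fun_eq_iff)
      have 2: "((\<lambda>t. d * ((1 - t) * t ^ CARD('n))) has_real_derivative
          d * ((1 - t) * (CARD('n) * t ^ (CARD('n) - 1)) - t ^ CARD('n))) (at t)"
        by (auto intro!: derivative_eq_intros)
      have t: "t ^ CARD('n) = t ^ (CARD('n) - 1) * t"
        by (simp add: pred_card(2))
      have nt: "n \<bullet> (t *\<^sub>R (y - c)) / d = t" using on_face[OF that] d by simp
      show "(?F has_real_derivative ?f y t - ?g y t) (at t)"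
        unfolding nt by (rule DERIV_cong[OF DERIV_mult[OF 2 1]]) (simp add: t algebra_simps)
    next
      show "continuous_on UNIV (\<lambda>t. ?f y t - ?g y t)"
        using cont by (intro continuous_on_diff)
    qed
    moreover have "(LINT t:{0<..<1}|lborel. ?f y t - ?g y t) =
        (LINT t:{0<..<1}|lborel. ?f y t) - (LINT t:{0<..<1}|lborel. ?g y t)"
      by (intro set_integral_diff set_integrable_unit_interval cont)
    moreover have "?F 1 - ?F 0 = 0" by (simp add: zero_power)
    ultimately show ?thesis by linarith
  qed
  then have "(LINT y:\<sigma>|flat. LINT t:{0<..<1}|lborel. ?f y t) =
      (LINT y:\<sigma>|flat. LINT t:{0<..<1}|lborel. ?g y t)"
    by (intro set_lebesgue_integral_cong) (use face_borel in auto)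
  then show ?thesis
    using G c\<phi> d by (simp add: cone_integral_continuous(1) continuous_intros)
qed

end

section \<open>The gauge of a star-shaped polytopal cell\<close>

text \<open>Bisection along the segment. The local bound compares points with the centre only, so a
  short interval around a parameter is split there, and the two bounds add up because the lengths of
  the two pieces do.\<close>

lemma lipschitz_of_locally_lipschitz:
  fixes f :: "'a::real_normed_vector \<Rightarrow> real"
  assumes L: "0 \<le> L"
    and loc: "\<And>x. \<exists>e>0. \<forall>y. dist x y < e \<longrightarrow> \<bar>f y - f x\<bar> \<le> L * dist x y"
  shows "\<bar>f y - f x\<bar> \<le> L * dist x y"
proof -
  define w where "w s = x + s *\<^sub>R (y - x)" for s :: real
  have dw: "dist (w s) (w t) = \<bar>s - t\<bar> * dist x y" for s t
  proof -
    have "w s - w t = (s - t) *\<^sub>R (y - x)" by (simp add: w_def algebra_simps)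
    then show ?thesis by (simp add: dist_norm norm_minus_commute)
  qed
  define P where "P a b \<longleftrightarrow> \<bar>f (w b) - f (w a)\<bar> \<le> L * (b - a) * dist x y" for a b
  have "P 0 1"
  proof (rule Bolzano[of 0 1 P])
    fix a b c assume "P a b" "P b c"
    then show "P a c" by (simp add: P_def algebra_simps)
  next
    fix s :: real
    obtain e where e: "e > 0" "\<And>z. dist (w s) z < e \<Longrightarrow> \<bar>f z - f (w s)\<bar> \<le> L * dist (w s) z"
      using loc by blast
    let ?\<delta> = "e / (dist x y + 1)"
    have "P a b" if ab: "a \<le> s" "s \<le> b" "b - a < ?\<delta>" for a b
    proof -
      have "\<bar>f (w r) - f (w s)\<bar> \<le> L * \<bar>r - s\<bar> * dist x y" if "\<bar>r - s\<bar> < ?\<delta>" for r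
      proof -
        have "\<bar>r - s\<bar> * dist x y \<le> \<bar>r - s\<bar> * (dist x y + 1)" by (intro mult_left_mono) auto
        also have "\<dots> < e"
          using that by (simp add: pos_less_divide_eq add_nonneg_pos)
        finally show ?thesis using e(2)[of "w r"] dw[of s r] by (simp add: abs_minus_commute mult.assoc)
      qed
      from this[of a] this[of b] ab have
        "\<bar>f (w a) - f (w s)\<bar> \<le> L * (s - a) * dist x y" "\<bar>f (w b) - f (w s)\<bar> \<le> L * (b - s) * dist x y"
        by auto
      then show ?thesis by (simp add: P_def algebra_simps)
    qed
    moreover have "?\<delta> > 0" using e(1) by (simp add: add_nonneg_pos)
    ultimately show "\<exists>\<delta>>0. \<forall>a b. a \<le> s \<and> s \<le> b \<and> b - a < \<delta> \<longrightarrow> P a b" by blast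
  qed simp
  then show ?thesis by (simp add: P_def w_def)
qed

text \<open>The unit normal pointing away from \<open>c\<close>, fixed by the equation of the
  hyperplane alone. \<open>outward_normal\<close> is a definite description involving the cell, and
  its existence and uniqueness need the gauge; until \<open>outward_normal_eq\<close> this vector
  takes its place.\<close>

definition face_normal :: "real^'n \<Rightarrow> (real^'n) set \<Rightarrow> real^'n" where
  "face_normal c \<sigma> = (SOME n. norm n = 1 \<and> affine hull \<sigma> = {x. n \<bullet> (x - c) = face_dist c \<sigma>})"

lemma face_normal:
  fixes \<sigma> :: "(real^'n) set"
  assumes "hyperplane_piece \<sigma>" and d: "0 < face_dist c \<sigma>"
  shows "norm (face_normal c \<sigma>) = 1"
    and "affine hull \<sigma> = {x. face_normal c \<sigma> \<bullet> (x - c) = face_dist c \<sigma>}"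
proof -
  have "aff_dim \<sigma> = DIM(real^'n) - 1" using assms(1) by (simp add: hyperplane_piece_def)
  then obtain a b where a: "a \<noteq> 0" and H: "affine hull \<sigma> = {x. a \<bullet> x = b}"
    unfolding aff_dim_eq_hyperplane by blast
  define \<beta> where "\<beta> = (b - a \<bullet> c) / norm a"
  \<comment> \<open>The sign of the signed distance \<open>\<beta>\<close> orients \<open>a\<close>
    so that the hyperplane lies on the positive side of \<open>c\<close>.\<close>
  define n where "n = (sgn \<beta> / norm a) *\<^sub>R a"
  have "c \<notin> affine hull \<sigma>" using d by (auto simp: face_dist_def)
  then have \<beta>: "\<beta> \<noteq> 0" using a by (auto simp: \<beta>_def H)
  have n1: "norm n = 1" using a \<beta> by (simp add: n_def abs_sgn_eq)
  have "a \<bullet> x = b \<longleftrightarrow> n \<bullet> (x - c) = \<bar>\<beta>\<bar>" for x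
  proof -
    have "n \<bullet> (x - c) = sgn \<beta> * ((a \<bullet> x - a \<bullet> c) / norm a)"
      by (simp add: n_def inner_diff_right diff_divide_distrib right_diff_distrib)
    moreover have "\<bar>\<beta>\<bar> = sgn \<beta> * \<beta>" by (simp add: abs_sgn mult.commute)
    ultimately show ?thesis using \<beta> a by (simp add: \<beta>_def sgn_0_0)
  qed
  then have H': "affine hull \<sigma> = {x. n \<bullet> (x - c) = \<bar>\<beta>\<bar>}" using H by auto
  have "face_dist c \<sigma> = \<bar>\<beta>\<bar>"
  proof (rule antisym)
    have "c + \<bar>\<beta>\<bar> *\<^sub>R n \<in> affine hull \<sigma>" using n1 by (simp add: H' norm_eq_1)
    then have "face_dist c \<sigma> \<le> dist c (c + \<bar>\<beta>\<bar> *\<^sub>R n)" unfolding face_dist_def by (rule infdist_le)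
    then show "face_dist c \<sigma> \<le> \<bar>\<beta>\<bar>" using n1 by (simp add: dist_norm)
  next
    have ne: "affine hull \<sigma> \<noteq> {}"
    proof -
      have "c + \<bar>\<beta>\<bar> *\<^sub>R n \<in> affine hull \<sigma>" using n1 by (simp add: H' norm_eq_1)
      then show ?thesis by blast
    qed
    have "\<bar>\<beta>\<bar> \<le> dist c y" if "y \<in> affine hull \<sigma>" for y
      using that Cauchy_Schwarz_ineq2[of n "y - c"] n1 by (simp add: H' dist_norm norm_minus_commute)
    then show "\<bar>\<beta>\<bar> \<le> face_dist c \<sigma>"
      using ne unfolding face_dist_def infdist_def by (auto intro!: cINF_greatest)
  qed
  then have "\<exists>n. norm n = 1 \<and> affine hull \<sigma> = {x. n \<bullet> (x - c) = face_dist c \<sigma>}"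
    using n1 H' by metis
  then have "norm (face_normal c \<sigma>) = 1 \<and>
      affine hull \<sigma> = {x. face_normal c \<sigma> \<bullet> (x - c) = face_dist c \<sigma>}"
    unfolding face_normal_def by (rule someI_ex)
  then show "norm (face_normal c \<sigma>) = 1"
    and "affine hull \<sigma> = {x. face_normal c \<sigma> \<bullet> (x - c) = face_dist c \<sigma>}" by auto
qed

locale star_cell =
  fixes K :: "(real^'n) set" and c :: "real^'n" and E :: "(real^'n) set set"
  assumes open_cell: "open K" and bounded_cell: "bounded K" and center: "c \<in> K"
    and star: "\<And>y. y \<in> K \<Longrightarrow> closed_segment c y \<subseteq> K"
    and finite_faces: "finite E"
    and face: "\<And>\<sigma>. \<sigma> \<in> E \<Longrightarrow> hyperplane_piece \<sigma>"
    and frontier_eq: "frontier K = (\<Union>\<sigma>\<in>E. closure \<sigma>)"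
    and dist_pos: "\<And>\<sigma>. \<sigma> \<in> E \<Longrightarrow> 0 < face_dist c \<sigma>"
    and negl1: "negligible (K - (\<Union>\<sigma>\<in>E. face_cone c \<sigma>))"
    and negl2: "negligible ((\<Union>\<sigma>\<in>E. face_cone c \<sigma>) - K)"
    and negl3: "pairwise (\<lambda>\<sigma> \<tau>. negligible (face_cone c \<sigma> \<inter> face_cone c \<tau>)) E"
begin

abbreviation "N \<equiv> face_normal c"
abbreviation "d \<equiv> face_dist c"

lemma face_frontier: "\<sigma> \<in> E \<Longrightarrow> \<sigma> \<subseteq> frontier K"
  using frontier_eq closure_subset by blast

lemma hyperplane_cone: "\<sigma> \<in> E \<Longrightarrow> hyperplane_cone c (N \<sigma>) (d \<sigma>) \<sigma>"
proof
  assume \<sigma>: "\<sigma> \<in> E"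
  show "rel_open \<sigma>" using face[OF \<sigma>] by (simp add: hyperplane_piece_def)
  show "bounded \<sigma>"
    using bounded_subset[OF bounded_closure[OF bounded_cell]] face_frontier[OF \<sigma>]
    by (auto simp: frontier_def)
qed (use face_normal[OF face dist_pos] dist_pos in auto)

lemma frontier_on_hyperplane:
  assumes "y \<in> frontier K"
  obtains \<sigma> where "\<sigma> \<in> E" "N \<sigma> \<bullet> (y - c) = d \<sigma>"
proof -
  obtain \<sigma> where \<sigma>: "\<sigma> \<in> E" "y \<in> closure \<sigma>" using assms frontier_eq by blast
  have "closure \<sigma> \<subseteq> affine hull \<sigma>"
    by (rule closure_minimal) (auto simp: hull_subset closed_affine_hull)
  then show thesis using that[OF \<sigma>(1)] \<sigma> face_normal(2)[OF face dist_pos] by auto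
qed

lemma star_point: "y \<in> K \<Longrightarrow> 0 \<le> s \<Longrightarrow> s \<le> 1 \<Longrightarrow> c + s *\<^sub>R (y - c) \<in> K"
proof -
  assume "y \<in> K" "0 \<le> s" "s \<le> 1"
  moreover have "c + s *\<^sub>R (y - c) = (1 - s) *\<^sub>R c + s *\<^sub>R y" by (simp add: algebra_simps)
  ultimately show ?thesis using star[of y] unfolding closed_segment_def by blast
qed

text \<open>A boundary point seen from \<open>c\<close> through another one would give a radial segment in the
  boundary, but each of the finitely many hyperplanes meets a ray from \<open>c\<close> at most once.\<close>

lemma closure_star_point:
  assumes y: "y \<in> closure K" and s: "0 \<le> s" "s < 1"
  shows "c + s *\<^sub>R (y - c) \<in> K"
proof (rule ccontr)
  assume out: "c + s *\<^sub>R (y - c) \<notin> K"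
  have "r \<in> (\<lambda>\<sigma>. d \<sigma> / (N \<sigma> \<bullet> (y - c))) ` E" if r: "s \<le> r" "r < 1" for r
  proof -
    let ?z = "c + r *\<^sub>R (y - c)"
    have "0 < r" using out center s r by (cases "s = 0") auto
    have "?z \<notin> K"
    proof
      assume "?z \<in> K"
      from star_point[OF this, of "s / r"] have "c + s *\<^sub>R (y - c) \<in> K"
        using s r \<open>0 < r\<close> by simp
      with out show False ..
    qed
    moreover have "?z \<in> closure K"
    proof -
      have "(\<lambda>x. c + r *\<^sub>R (x - c)) ` closure K \<subseteq> closure K"
      proof (rule image_closure_subset)
        show "(\<lambda>x. c + r *\<^sub>R (x - c)) ` K \<subseteq> closure K"
          using star_point[of _ r] r \<open>0 < r\<close> closure_subset by fastforce
      qed (auto intro!: continuous_intros)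
      then show ?thesis using y by blast
    qed
    ultimately have "?z \<in> frontier K" by (simp add: frontier_def interior_open[OF open_cell])
    then obtain \<sigma> where \<sigma>: "\<sigma> \<in> E" "N \<sigma> \<bullet> (?z - c) = d \<sigma>" by (rule frontier_on_hyperplane)
    then have "r * (N \<sigma> \<bullet> (y - c)) = d \<sigma>" by simp
    moreover from this have "N \<sigma> \<bullet> (y - c) \<noteq> 0" using dist_pos[OF \<sigma>(1)] by auto
    ultimately have "r = d \<sigma> / (N \<sigma> \<bullet> (y - c))" by (simp add: nonzero_eq_divide_eq)
    then show ?thesis using \<sigma>(1) by blast
  qed
  then have "{s..<1} \<subseteq> (\<lambda>\<sigma>. d \<sigma> / (N \<sigma> \<bullet> (y - c))) ` E" by auto
  then have "finite {s..<1}" using finite_faces finite_subset by blast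
  then show False using s by (simp add: infinite_Ico)
qed

section \<open>The gauge and its description by the faces\<close>

definition gauge_set :: "real^'n \<Rightarrow> real set" where
  "gauge_set x = {t. 0 < t \<and> c + (1 / t) *\<^sub>R (x - c) \<in> K}"

definition radial_gauge :: "real^'n \<Rightarrow> real" where "radial_gauge x = Inf (gauge_set x)"

lemma gauge_set_mono:
  assumes "t \<in> gauge_set x" "t \<le> u" shows "u \<in> gauge_set x"
proof -
  have t: "0 < t" "c + (1 / t) *\<^sub>R (x - c) \<in> K" using assms(1) by (auto simp: gauge_set_def)
  from star_point[OF this(2), of "t / u"] show ?thesis
    using t(1) assms(2) by (simp add: gauge_set_def)
qed

lemma gauge_set_nonempty: "gauge_set x \<noteq> {}"
proof -
  obtain e where e: "e > 0" "ball c e \<subseteq> K" using open_cell center open_contains_ball by blast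
  define t where "t = (norm (x - c) + 1) / e"
  have t: "t > 0" using e by (simp add: t_def add_nonneg_pos)
  have "norm (x - c) < t * e" using e by (simp add: t_def)
  then have "dist c (c + (1 / t) *\<^sub>R (x - c)) < e"
    using t by (simp add: dist_norm divide_less_eq mult.commute)
  then have "t \<in> gauge_set x" using e t by (auto simp: gauge_set_def)
  then show ?thesis by blast
qed

lemma gauge_set_bdd: "bdd_below (gauge_set x)"
  by (rule bdd_belowI[of _ 0]) (auto simp: gauge_set_def)

lemma gauge_nonneg: "0 \<le> radial_gauge x"
  unfolding radial_gauge_def by (rule cInf_greatest[OF gauge_set_nonempty]) (auto simp: gauge_set_def)

text \<open>Since the cell is open, the scaled point stays inside when \<open>t\<close> is decreased
  slightly; the infimum is therefore strictly below every admissible \<open>t\<close>.\<close>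

lemma gauge_less_iff:
  assumes t: "0 < t" shows "radial_gauge x < t \<longleftrightarrow> c + (1 / t) *\<^sub>R (x - c) \<in> K"
proof
  assume "radial_gauge x < t"
  then obtain u where "u \<in> gauge_set x" "u < t"
    unfolding radial_gauge_def using cInf_lessD[OF gauge_set_nonempty] by blast
  then have "t \<in> gauge_set x" using gauge_set_mono by force
  then show "c + (1 / t) *\<^sub>R (x - c) \<in> K" by (simp add: gauge_set_def)
next
  assume K: "c + (1 / t) *\<^sub>R (x - c) \<in> K"
  have "open ({0<..} \<inter> (\<lambda>u. c + (1 / u) *\<^sub>R (x - c)) -` K)"
  proof -
    have "continuous_on {0<..} (\<lambda>u. c + (1 / u) *\<^sub>R (x - c))" by (intro continuous_intros) auto
    then have "open ((\<lambda>u. c + (1 / u) *\<^sub>R (x - c)) -` K \<inter> {0<..})"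
      using open_cell continuous_on_open_vimage[of "{0<..}" "\<lambda>u. c + (1 / u) *\<^sub>R (x - c)"] by simp
    then show ?thesis by (simp add: Int_commute)
  qed
  moreover have "t \<in> {0<..} \<inter> (\<lambda>u. c + (1 / u) *\<^sub>R (x - c)) -` K" using K t by simp
  ultimately obtain e where e: "e > 0" "ball t e \<subseteq> {0<..} \<inter> (\<lambda>u. c + (1 / u) *\<^sub>R (x - c)) -` K"
    using open_contains_ball by blast
  have "t - e / 2 \<in> ball t e" using e(1) by (simp add: dist_real_def)
  then have "t - e / 2 \<in> {0<..} \<inter> (\<lambda>u. c + (1 / u) *\<^sub>R (x - c)) -` K" using e(2) by blast
  then have "t - e / 2 \<in> gauge_set x" by (simp add: gauge_set_def)
  then have "radial_gauge x \<le> t - e / 2" unfolding radial_gauge_def by (rule cInf_lower[OF _ gauge_set_bdd])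
  then show "radial_gauge x < t" using e(1) by simp
qed

text \<open>From right to left, \<open>closure_star_point\<close> says that the segment from
  \<open>c\<close> to a point of the closure lies in the cell up to its end, so every
  \<open>u > t\<close> is admissible. From left to right the point is a limit of points of the
  cell.\<close>

lemma gauge_le_iff:
  assumes t: "0 < t" shows "radial_gauge x \<le> t \<longleftrightarrow> c + (1 / t) *\<^sub>R (x - c) \<in> closure K"
proof
  assume le: "radial_gauge x \<le> t"
  have "(\<lambda>k. c + (1 / (t + 1 / real (Suc k))) *\<^sub>R (x - c)) \<longlonglongrightarrow> c + (1 / (t + 0)) *\<^sub>R (x - c)"
    using t by (intro tendsto_intros LIMSEQ_Suc lim_1_over_n) auto
  moreover have "c + (1 / (t + 1 / real (Suc k))) *\<^sub>R (x - c) \<in> K" for k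
    using le t gauge_less_iff[of "t + 1 / real (Suc k)" x] by (simp add: add_pos_pos add_strict_increasing2 le_less_trans)
  ultimately show "c + (1 / t) *\<^sub>R (x - c) \<in> closure K"
    unfolding closure_sequential by (auto intro!: exI)
next
  assume cl: "c + (1 / t) *\<^sub>R (x - c) \<in> closure K"
  show "radial_gauge x \<le> t"
  proof (rule dense_ge)
    fix u assume u: "t < u"
    have "c + (t / u) *\<^sub>R (c + (1 / t) *\<^sub>R (x - c) - c) \<in> K"
      by (rule closure_star_point[OF cl]) (use t u in auto)
    then have "radial_gauge x < u" using gauge_less_iff[of u x] t u by simp
    then show "radial_gauge x \<le> u" by simp
  qed
qed

lemma gauge_less_1_iff: "radial_gauge x < 1 \<longleftrightarrow> x \<in> K"
  using gauge_less_iff[of 1 x] by simp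

text \<open>Strict sublevel sets are preimages of the open cell under a dilation and the others are
  preimages of its closure; these give upper and lower semicontinuity.\<close>

lemma continuous_gauge: "continuous_on UNIV radial_gauge"
  unfolding continuous_on_def
proof (intro ballI order_tendstoI)
  fix x a assume "a < radial_gauge x"
  show "\<forall>\<^sub>F y in at x within UNIV. a < radial_gauge y"
  proof (cases "a < 0")
    case True
    then show ?thesis using gauge_nonneg by (auto intro!: always_eventually intro: less_le_trans)
  next
    case False
    obtain b where b: "a < b" "b < radial_gauge x" using \<open>a < radial_gauge x\<close> dense by blast
    then have b0: "0 < b" using False by simp
    have "open (- ((\<lambda>y. c + (1 / b) *\<^sub>R (y - c)) -` closure K))"
      by (intro open_Compl closed_vimage continuous_intros closed_closure)
    moreover have "x \<in> - ((\<lambda>y. c + (1 / b) *\<^sub>R (y - c)) -` closure K)"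
      using b gauge_le_iff[OF b0, of x] by auto
    ultimately have "\<forall>\<^sub>F y in at x. y \<in> - ((\<lambda>y. c + (1 / b) *\<^sub>R (y - c)) -` closure K)"
      using eventually_at_topological by blast
    then show ?thesis
    proof (rule eventually_mono)
      fix y assume "y \<in> - ((\<lambda>y. c + (1 / b) *\<^sub>R (y - c)) -` closure K)"
      then have "\<not> radial_gauge y \<le> b" using gauge_le_iff[OF b0, of y] by simp
      then show "a < radial_gauge y" using b by simp
    qed
  qed
next
  fix x a assume a: "radial_gauge x < a"
  then have a0: "0 < a" using gauge_nonneg[of x] by simp
  have "open ((\<lambda>y. c + (1 / a) *\<^sub>R (y - c)) -` K)"
    by (intro open_vimage continuous_intros open_cell)
  moreover have "x \<in> (\<lambda>y. c + (1 / a) *\<^sub>R (y - c)) -` K"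
    using a gauge_less_iff[OF a0, of x] by auto
  ultimately have "\<forall>\<^sub>F y in at x. y \<in> (\<lambda>y. c + (1 / a) *\<^sub>R (y - c)) -` K"
    using eventually_at_topological by blast
  then show "\<forall>\<^sub>F y in at x within UNIV. radial_gauge y < a"
    by (rule eventually_mono) (use gauge_less_iff[OF a0] in auto)
qed

lemma faces_nonempty: "E \<noteq> {}"
proof
  assume "E = {}"
  then have "frontier K = {}" using frontier_eq by simp
  then have "K = UNIV" using center by (auto simp: frontier_eq_empty)
  then show False using bounded_cell by simp
qed

text \<open>The point where the ray through \<open>x\<close> leaves the cell lies on the hyperplane
  of some face, so the gauge is everywhere a selection from finitely many affine functions.
  Boundedness makes \<open>c\<close> the only zero of the gauge, and there all these functions
  vanish.\<close>

lemma gauge_selection: "\<exists>\<sigma>\<in>E. radial_gauge x = N \<sigma> \<bullet> (x - c) / d \<sigma>"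
proof (cases "radial_gauge x = 0")
  case True
  have "x = c"
  proof (rule ccontr)
    assume "x \<noteq> c"
    then have nz: "0 < norm (x - c)" by simp
    obtain b where b: "\<And>y. y \<in> K \<Longrightarrow> dist c y \<le> b" using bounded_cell bounded_any_center by metis
    have b0: "0 \<le> b" using b[OF center] by simp
    define t where "t = norm (x - c) / (b + 1)"
    have t: "0 < t" using nz b0 by (simp add: t_def)
    then have "c + (1 / t) *\<^sub>R (x - c) \<in> K" using gauge_less_iff[OF t, of x] True by simp
    from b[OF this] have "norm (x - c) / t \<le> b" using t by (simp add: dist_norm)
    moreover have "norm (x - c) / t = b + 1" using nz b0 by (simp add: t_def)
    ultimately show False by simp
  qed
  then show ?thesis using faces_nonempty True by auto
next
  case False
  then have t: "0 < radial_gauge x" using gauge_nonneg[of x] by simp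
  have "c + (1 / radial_gauge x) *\<^sub>R (x - c) \<in> closure K" "c + (1 / radial_gauge x) *\<^sub>R (x - c) \<notin> K"
    using gauge_le_iff[OF t, of x] gauge_less_iff[OF t, of x] by auto
  then have "c + (1 / radial_gauge x) *\<^sub>R (x - c) \<in> frontier K"
    by (simp add: frontier_def interior_open[OF open_cell])
  then obtain \<sigma> where \<sigma>: "\<sigma> \<in> E" "N \<sigma> \<bullet> (c + (1 / radial_gauge x) *\<^sub>R (x - c) - c) = d \<sigma>"
    by (rule frontier_on_hyperplane)
  then have "(1 / radial_gauge x) * (N \<sigma> \<bullet> (x - c)) = d \<sigma>"
    by (simp only: add_diff_cancel_left' inner_scaleR_right)
  then have "N \<sigma> \<bullet> (x - c) = d \<sigma> * radial_gauge x" using t by (simp add: field_simps)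
  then have "radial_gauge x = N \<sigma> \<bullet> (x - c) / d \<sigma>" using dist_pos[OF \<sigma>(1)] by simp
  then show ?thesis using \<sigma>(1) by blast
qed

text \<open>The sum of the Lipschitz constants of the affine functions in
  \<open>gauge_selection\<close>, a crude but convenient bound for their maximum.\<close>

definition Lip :: real where "Lip = (\<Sum>\<sigma>\<in>E. 1 / d \<sigma>)"

lemma Lip_nonneg: "0 \<le> Lip"
  unfolding Lip_def using dist_pos by (intro sum_nonneg) (simp add: less_imp_le)

text \<open>A continuous selection from finitely many affine functions: one that differs from the
  gauge at \<open>x\<close> also differs from it near \<open>x\<close>. Hence the function selected
  at a nearby \<open>y\<close> gives the value at \<open>x\<close> too, and the increment is that of
  a single affine function of slope \<open>1 / d \<sigma>\<close>.\<close>

lemma lipschitz_gauge: "\<bar>radial_gauge y - radial_gauge x\<bar> \<le> Lip * dist x y"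
proof (rule lipschitz_of_locally_lipschitz[OF Lip_nonneg])
  fix x
  define l where "l \<sigma> z = N \<sigma> \<bullet> (z - c) / d \<sigma>" for \<sigma> z
  have "\<forall>\<^sub>F y in nhds x. l \<sigma> y \<noteq> radial_gauge y \<or> l \<sigma> x = radial_gauge x" if "\<sigma> \<in> E" for \<sigma>
  proof (cases "l \<sigma> x = radial_gauge x")
    case False
    have cont: "continuous_on UNIV (\<lambda>y. l \<sigma> y - radial_gauge y)"
      unfolding l_def by (intro continuous_intros continuous_gauge) (use dist_pos[OF that] in auto)
    then have "open ((\<lambda>y. l \<sigma> y - radial_gauge y) -` (- {0}))"
      by (intro open_vimage) auto
    moreover have "x \<in> (\<lambda>y. l \<sigma> y - radial_gauge y) -` (- {0})" using False by simp
    ultimately have "\<forall>\<^sub>F y in nhds x. y \<in> (\<lambda>y. l \<sigma> y - radial_gauge y) -` (- {0})"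
      by (rule eventually_nhds_in_open)
    then show ?thesis by (rule eventually_mono) simp
  qed simp
  then have "\<forall>\<^sub>F y in nhds x. \<forall>\<sigma>\<in>E. l \<sigma> y \<noteq> radial_gauge y \<or> l \<sigma> x = radial_gauge x"
    using finite_faces by (simp add: eventually_ball_finite)
  then obtain e where e: "e > 0" "\<And>y \<sigma>. dist y x < e \<Longrightarrow> \<sigma> \<in> E \<Longrightarrow> l \<sigma> y \<noteq> radial_gauge y \<or> l \<sigma> x = radial_gauge x"
    unfolding eventually_nhds_metric by blast
  have "\<bar>radial_gauge y - radial_gauge x\<bar> \<le> Lip * dist x y" if "dist x y < e" for y
  proof -
    obtain \<sigma> where \<sigma>: "\<sigma> \<in> E" "radial_gauge y = l \<sigma> y" using gauge_selection unfolding l_def by blast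
    then have "radial_gauge x = l \<sigma> x" using e(2)[of y \<sigma>] that by (simp add: dist_commute)
    then have "\<bar>radial_gauge y - radial_gauge x\<bar> = \<bar>N \<sigma> \<bullet> (y - x)\<bar> / d \<sigma>"
      using \<sigma> dist_pos[OF \<sigma>(1)] by (simp add: l_def inner_diff_right diff_divide_distrib[symmetric])
    also have "\<dots> \<le> dist x y / d \<sigma>"
      using Cauchy_Schwarz_ineq2[of "N \<sigma>" "y - x"] dist_pos[OF \<sigma>(1)]
        face_normal(1)[OF face[OF \<sigma>(1)] dist_pos[OF \<sigma>(1)]]
      by (intro divide_right_mono) (simp_all add: dist_norm norm_minus_commute)
    also have "\<dots> \<le> Lip * dist x y"
    proof -
      have "1 / d \<sigma> \<le> Lip" unfolding Lip_def
        using finite_faces \<sigma>(1) dist_pos by (intro member_le_sum) (auto simp: less_imp_le)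
      from mult_right_mono[OF this zero_le_dist] show ?thesis by simp
    qed
    finally show ?thesis .
  qed
  then show "\<exists>e>0. \<forall>y. dist x y < e \<longrightarrow> \<bar>radial_gauge y - radial_gauge x\<bar> \<le> Lip * dist x y" using e(1) by blast
qed

text \<open>The radial projection of \<open>x\<close> lies on the frontier, hence in the closure but
  not in the cell, and the two characterisations of the gauge leave only this value. Points beyond
  the face are included, as the outward normal requires.\<close>

lemma gauge_on_radial_face:
  assumes \<sigma>: "\<sigma> \<in> E" and pos: "0 < N \<sigma> \<bullet> (x - c)"
    and x: "c + (d \<sigma> / (N \<sigma> \<bullet> (x - c))) *\<^sub>R (x - c) \<in> \<sigma>"
  shows "radial_gauge x = N \<sigma> \<bullet> (x - c) / d \<sigma>"
proof -
  let ?t = "N \<sigma> \<bullet> (x - c) / d \<sigma>"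
  have t: "0 < ?t" using pos dist_pos[OF \<sigma>] by simp
  have "c + (1 / ?t) *\<^sub>R (x - c) \<in> frontier K" using x face_frontier[OF \<sigma>] by auto
  then have "c + (1 / ?t) *\<^sub>R (x - c) \<in> closure K" "c + (1 / ?t) *\<^sub>R (x - c) \<notin> K"
    by (simp_all add: frontier_def interior_open[OF open_cell])
  then show ?thesis using gauge_le_iff[OF t, of x] gauge_less_iff[OF t, of x] by simp
qed

text \<open>Moving by a small \<open>s\<close> from a face point along \<open>N \<sigma>\<close>
  changes the gauge from 1 to \<open>1 + s / d \<sigma>\<close>, so \<open>N \<sigma>\<close> leaves
  the cell. Any candidate is orthogonal to the directions of the hyperplane, hence is plus or minus
  \<open>N \<sigma>\<close>, and the minus sign would put the same point inside and outside the
  cell.\<close>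

lemma outward_normal_eq:
  assumes \<sigma>: "\<sigma> \<in> E" shows "outward_normal K \<sigma> = N \<sigma>"
proof -
  interpret C: hyperplane_cone c "N \<sigma>" "d \<sigma>" \<sigma> by (rule hyperplane_cone[OF \<sigma>])
  let ?P = "\<lambda>n. norm n = 1 \<and> (\<forall>y\<in>\<sigma>. \<forall>z\<in>\<sigma>. n \<bullet> (y - z) = 0) \<and>
     (\<forall>y\<in>\<sigma>. \<exists>\<epsilon>>0. \<forall>t. 0 < t \<and> t < \<epsilon> \<longrightarrow> y - t *\<^sub>R n \<in> K \<and> y + t *\<^sub>R n \<notin> K)"
  have side: "\<exists>\<epsilon>>0. \<forall>t. 0 < t \<and> t < \<epsilon> \<longrightarrow> y - t *\<^sub>R N \<sigma> \<in> K \<and> y + t *\<^sub>R N \<sigma> \<notin> K"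
    if y: "y \<in> \<sigma>" for y
  proof -
    let ?R = "{x. 0 < N \<sigma> \<bullet> (x - c) \<and> c + (d \<sigma> / (N \<sigma> \<bullet> (x - c))) *\<^sub>R (x - c) \<in> \<sigma>}"
    have "y \<in> ?R" using y C.on_face[OF y] C.d by simp
    then obtain e where e: "e > 0" "ball y e \<subseteq> ?R"
      using C.open_radial_face open_contains_ball by blast
    have "y - t *\<^sub>R N \<sigma> \<in> K \<and> y + t *\<^sub>R N \<sigma> \<notin> K" if t: "0 < t" "t < e" for t
    proof -
      have gr: "radial_gauge (y + s *\<^sub>R N \<sigma>) = 1 + s / d \<sigma>" if s: "\<bar>s\<bar> < e" for s
      proof -
        have "y + s *\<^sub>R N \<sigma> \<in> ball y e" using s C.n by (simp add: dist_norm)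
        then have "y + s *\<^sub>R N \<sigma> \<in> ?R" using e(2) by blast
        then have "radial_gauge (y + s *\<^sub>R N \<sigma>) = N \<sigma> \<bullet> (y + s *\<^sub>R N \<sigma> - c) / d \<sigma>"
          using gauge_on_radial_face[OF \<sigma>] by simp
        also have "N \<sigma> \<bullet> (y + s *\<^sub>R N \<sigma> - c) = d \<sigma> + s"
          using C.on_face[OF y] C.n by (simp add: inner_add_right inner_diff_right norm_eq_1)
        finally show ?thesis using C.d by (simp add: add_divide_distrib)
      qed
      have "0 < t / d \<sigma>" using t C.d by simp
      moreover have "radial_gauge (y - t *\<^sub>R N \<sigma>) = 1 - t / d \<sigma>" using gr[of "- t"] t by simp
      moreover have "radial_gauge (y + t *\<^sub>R N \<sigma>) = 1 + t / d \<sigma>" using gr[of t] t by simp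
      ultimately show ?thesis
        using gauge_less_1_iff[of "y - t *\<^sub>R N \<sigma>"] gauge_less_1_iff[of "y + t *\<^sub>R N \<sigma>"] by simp
    qed
    then show ?thesis using e(1) by blast
  qed
  show ?thesis unfolding outward_normal_def
  proof (rule the_equality)
    show "?P (N \<sigma>)"
    proof (intro conjI ballI side C.n)
      fix y z assume "y \<in> \<sigma>" "z \<in> \<sigma>"
      then show "N \<sigma> \<bullet> (y - z) = 0"
        using C.on_face[of y] C.on_face[of z] by (simp add: inner_diff_right)
    qed
  next
    fix n assume n: "?P n"
    then have n1: "norm n = 1" and n2: "\<And>y z. y \<in> \<sigma> \<Longrightarrow> z \<in> \<sigma> \<Longrightarrow> n \<bullet> (y - z) = 0" by blast+
    obtain y where y: "y \<in> \<sigma>" using C.face_nonempty by blast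
    \<comment> \<open>Orthogonality to differences of face points passes to the affine hull, which
      is the full hyperplane.\<close>
    have perp: "n \<bullet> v = 0" if v: "N \<sigma> \<bullet> v = 0" for v
    proof -
      have "y + v \<in> affine hull \<sigma>" using C.on_face[OF y] v by (simp add: C.hull inner_diff_right inner_add_right)
      moreover have "affine hull \<sigma> \<subseteq> {x. n \<bullet> x = n \<bullet> y}"
        using n2[OF _ y] by (intro hull_minimal affine_hyperplane subsetI) (simp add: inner_diff_right)
      ultimately have "n \<bullet> (y + v) = n \<bullet> y" by blast
      then show ?thesis by (simp add: inner_add_right)
    qed
    let ?k = "n \<bullet> N \<sigma>"
    have "n \<bullet> (n - ?k *\<^sub>R N \<sigma>) = 0" "N \<sigma> \<bullet> (n - ?k *\<^sub>R N \<sigma>) = 0"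
      using C.n perp[of "n - ?k *\<^sub>R N \<sigma>"] by (simp_all add: inner_diff_right inner_commute norm_eq_1)
    then have "(n - ?k *\<^sub>R N \<sigma>) \<bullet> (n - ?k *\<^sub>R N \<sigma>) = 0" by (simp add: inner_diff_left)
    then have nk: "n = ?k *\<^sub>R N \<sigma>" by simp
    then have "\<bar>?k\<bar> = 1" using n1 C.n by (metis mult.right_neutral norm_scaleR)
    moreover have "?k \<noteq> -1"
    proof
      assume "?k = -1"
      then have n': "n = - N \<sigma>" using nk by simp
      obtain e1 where e1: "e1 > 0" "\<And>t. 0 < t \<Longrightarrow> t < e1 \<Longrightarrow> y - t *\<^sub>R n \<in> K"
        using n y by blast
      obtain e2 where e2: "e2 > 0" "\<And>t. 0 < t \<Longrightarrow> t < e2 \<Longrightarrow> y + t *\<^sub>R N \<sigma> \<notin> K"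
        using side[OF y] by blast
      obtain t where "0 < t" "t < min e1 e2" using dense[of 0 "min e1 e2"] e1(1) e2(1) by auto
      with e1(2)[of t] e2(2)[of t] n' show False by simp
    qed
    ultimately have "?k = 1" by (simp add: abs_if split: if_splits)
    then show "n = N \<sigma>" using nk by simp
  qed
qed

end

section \<open>The divergence theorem on a cell\<close>

lemma integrable_continuous_support:
  fixes F :: "'a::euclidean_space \<Rightarrow> real"
  assumes F: "continuous_on UNIV F" and 0: "\<And>x. x \<notin> cball 0 \<rho> \<Longrightarrow> F x = 0"
  shows "integrable lborel F"
proof -
  have "set_integrable lborel (cball 0 \<rho>) F"
    by (rule set_integrable_continuous_bounded) (use F in auto)
  moreover have "(\<lambda>x. indicator (cball 0 \<rho>) x *\<^sub>R F x) = F"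
    using 0 by (auto simp: indicator_def fun_eq_iff)
  ultimately show ?thesis by (simp add: set_integrable_def)
qed

lemma integral_lborel_translate:
  fixes F :: "'a::euclidean_space \<Rightarrow> real"
  assumes F: "F \<in> borel_measurable borel"
  shows "(\<integral>x. F (x + a) \<partial>lborel) = (\<integral>x. F x \<partial>lborel)"
  by (subst (2) lborel_distr_plus[of a, symmetric], subst integral_distr)
    (use F in \<open>simp_all add: add.commute\<close>)

lemma directional_difference_quotient:
  fixes \<phi> :: "'a::euclidean_space \<Rightarrow> real"
  assumes \<phi>: "(\<phi> has_derivative (\<lambda>h. G x \<bullet> h)) (at x)" and s: "s \<longlonglongrightarrow> 0" "\<And>k. s k \<noteq> 0"
  shows "(\<lambda>k. (\<phi> (x - s k *\<^sub>R a) - \<phi> x) / s k) \<longlonglongrightarrow> - (G x \<bullet> a)"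
proof -
  have "((\<lambda>t. \<phi> (x - t *\<^sub>R a)) has_derivative (\<lambda>t. G x \<bullet> (- (t *\<^sub>R a)))) (at 0)"
    by (rule has_derivative_compose[where g = \<phi>])
      (use \<phi> in \<open>auto intro!: derivative_eq_intros simp: fun_eq_iff\<close>)
  then have "((\<lambda>t. \<phi> (x - t *\<^sub>R a)) has_real_derivative - (G x \<bullet> a)) (at 0)"
    unfolding has_field_derivative_def by (rule has_derivative_eq_rhs) (auto simp: fun_eq_iff)
  then have "((\<lambda>t. (\<phi> (x - t *\<^sub>R a) - \<phi> x) / t) \<longlongrightarrow> - (G x \<bullet> a)) (at 0)"
    by (simp add: has_field_derivative_iff)
  moreover have "filterlim s (at 0) sequentially" using s by (simp add: filterlim_at)
  ultimately show ?thesis by (rule filterlim_compose)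
qed

text \<open>Completeness of Lebesgue measure supplies the measurability of \<open>g\<close>; it is
  obtained by passing through absolute integrability on the whole space.\<close>

lemma integrable_spike_lebesgue:
  fixes f g :: "'a::euclidean_space \<Rightarrow> real"
  assumes f: "integrable lebesgue f" and T: "negligible T" "\<And>x. x \<notin> T \<Longrightarrow> g x = f x"
  shows "integrable lebesgue g" and "integral\<^sup>L lebesgue g = integral\<^sup>L lebesgue f"
proof -
  have "f absolutely_integrable_on UNIV" using f by (simp add: set_integrable_def)
  then have "g absolutely_integrable_on UNIV"
    by (rule absolutely_integrable_spike) (use T in auto)
  then show g: "integrable lebesgue g" by (simp add: set_integrable_def)
  have "AE x in lebesgue. x \<notin> T" using T(1) by (intro AE_not_in) (simp add: negligible_iff_null_sets)
  then have "AE x in lebesgue. g x = f x" by eventually_elim (rule T(2))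
  then show "integral\<^sup>L lebesgue g = integral\<^sup>L lebesgue f"
    using f g by (intro integral_cong_AE) auto
qed

section \<open>Splitting integrals over a cell into its cones\<close>

context star_cell
begin

lemma measure_pos: "0 < measure lebesgue K"
proof -
  have "negligible K \<longleftrightarrow> measure lebesgue K = 0"
    using bounded_cell open_cell by (intro negligible_iff_measure0) (auto intro: bounded_set_imp_lmeasurable)
  then show ?thesis using open_not_negligible[OF open_cell] center measure_nonneg[of lebesgue K]
    by (auto simp: less_le)
qed

lemma frontier_negligible: "negligible (frontier K)"
proof -
  have "negligible (closure \<sigma>)" if "\<sigma> \<in> E" for \<sigma>
  proof (rule negligible_subset)
    interpret C: hyperplane_cone c "N \<sigma>" "d \<sigma>" \<sigma> by (rule hyperplane_cone[OF that])
    show "closure \<sigma> \<subseteq> {x. N \<sigma> \<bullet> x = d \<sigma> + N \<sigma> \<bullet> c}"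
    proof -
      have "closure \<sigma> \<subseteq> affine hull \<sigma>"
        by (rule closure_minimal) (auto simp: hull_subset closed_affine_hull)
      then show ?thesis by (auto simp: C.hull inner_diff_right)
    qed
    show "negligible {x. N \<sigma> \<bullet> x = d \<sigma> + N \<sigma> \<bullet> c}"
      by (rule negligible_hyperplane) (use C.n in auto)
  qed
  then show ?thesis unfolding frontier_eq using finite_faces by (intro negligible_Union) auto
qed

text \<open>Off this null set the cones partition the cell exactly. The frontier is included so that
  a remaining point outside the cell has a neighbourhood disjoint from it, as the difference
  quotients of \<open>tent\<close> require.\<close>

definition null_part :: "(real^'n) set" where
  "null_part = (K - (\<Union>\<sigma>\<in>E. face_cone c \<sigma>)) \<union> ((\<Union>\<sigma>\<in>E. face_cone c \<sigma>) - K) \<union> frontier K \<union>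
     (\<Union>\<sigma>\<in>E. \<Union>\<tau>\<in>E - {\<sigma>}. face_cone c \<sigma> \<inter> face_cone c \<tau>)"

lemma negligible_null_part: "negligible null_part"
proof -
  have "negligible (\<Union>\<sigma>\<in>E. \<Union>\<tau>\<in>E - {\<sigma>}. face_cone c \<sigma> \<inter> face_cone c \<tau>)"
  proof (rule negligible_Union)
    fix S assume "S \<in> (\<lambda>\<sigma>. \<Union>\<tau>\<in>E - {\<sigma>}. face_cone c \<sigma> \<inter> face_cone c \<tau>) ` E"
    then obtain \<sigma> where \<sigma>: "\<sigma> \<in> E" "S = (\<Union>\<tau>\<in>E - {\<sigma>}. face_cone c \<sigma> \<inter> face_cone c \<tau>)" by blast
    show "negligible S" unfolding \<sigma>(2)
    proof (rule negligible_Union)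
      fix T assume "T \<in> (\<lambda>\<tau>. face_cone c \<sigma> \<inter> face_cone c \<tau>) ` (E - {\<sigma>})"
      then show "negligible T" using \<sigma>(1) negl3 unfolding pairwise_def by blast
    qed (use finite_faces in auto)
  qed (use finite_faces in auto)
  then show ?thesis unfolding null_part_def using negl1 negl2 frontier_negligible by (intro negligible_Un)
qed

lemma AE_not_null_part: "AE x in lebesgue. x \<notin> null_part"
  using negligible_null_part by (intro AE_not_in) (simp add: negligible_iff_null_sets)

lemma unique_cone:
  assumes "x \<notin> null_part" "x \<in> K"
  obtains \<sigma> where "\<sigma> \<in> E" "x \<in> face_cone c \<sigma>" "\<And>\<tau>. \<tau> \<in> E \<Longrightarrow> x \<in> face_cone c \<tau> \<longleftrightarrow> \<tau> = \<sigma>"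
proof -
  obtain \<sigma> where \<sigma>: "\<sigma> \<in> E" "x \<in> face_cone c \<sigma>" using assms unfolding null_part_def by blast
  have "\<tau> = \<sigma>" if "\<tau> \<in> E" "x \<in> face_cone c \<tau>" for \<tau>
    using assms \<sigma> that unfolding null_part_def by blast
  then show thesis using that \<sigma> by blast
qed

lemma not_in_cone: "x \<notin> null_part \<Longrightarrow> x \<notin> K \<Longrightarrow> \<sigma> \<in> E \<Longrightarrow> x \<notin> face_cone c \<sigma>"
  unfolding null_part_def by blast

lemma sum_cones:
  fixes w :: "(real^'n) set \<Rightarrow> 'b::real_vector"
  assumes "\<sigma> \<in> E" "\<And>\<tau>. \<tau> \<in> E \<Longrightarrow> x \<in> face_cone c \<tau> \<longleftrightarrow> \<tau> = \<sigma>"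
  shows "(\<Sum>\<tau>\<in>E. indicator (face_cone c \<tau>) x *\<^sub>R w \<tau>) = w \<sigma>"
proof -
  have "(\<Sum>\<tau>\<in>E. indicator (face_cone c \<tau>) x *\<^sub>R w \<tau>) = (\<Sum>\<tau>\<in>E. if \<tau> = \<sigma> then w \<sigma> else 0)"
    using assms(2) by (intro sum.cong) (auto simp: indicator_def)
  then show ?thesis using assms(1) finite_faces by simp
qed

lemma cone_set_integrable:
  fixes F :: "real^'n \<Rightarrow> 'b::{banach,second_countable_topology}"
  assumes "\<sigma> \<in> E" "continuous_on UNIV F"
  shows "set_integrable lebesgue (face_cone c \<sigma>) F"
proof -
  interpret C: hyperplane_cone c "N \<sigma>" "d \<sigma>" \<sigma> by (rule hyperplane_cone[OF assms(1)])
  show ?thesis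
    using C.cone_integrable[OF assms(2)] set_integrable_lebesgue[OF C.cone_borel, of F] assms(2)
    by (simp add: borel_measurable_continuous_onI)
qed

text \<open>\<open>F\<close> is prescribed only off a null set and only where exactly one cone is
  responsible. This suits functions given as sums over cone indicators, while each
  \<open>Fs \<sigma>\<close> is continuous on the whole space; for fluxes, \<open>T\<close> is the
  exceptional set of the entire mesh.\<close>

lemma cell_integral_split:
  fixes F :: "real^'n \<Rightarrow> real"
  assumes T: "negligible T" and Fs: "\<And>\<sigma>. \<sigma> \<in> E \<Longrightarrow> continuous_on UNIV (Fs \<sigma>)"
    and eq: "\<And>\<sigma> x. x \<notin> T \<Longrightarrow> \<sigma> \<in> E \<Longrightarrow> x \<in> K \<Longrightarrow> (\<And>\<tau>. \<tau> \<in> E \<Longrightarrow> x \<in> face_cone c \<tau> \<longleftrightarrow> \<tau> = \<sigma>) \<Longrightarrow> F x = Fs \<sigma> x"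
  shows "(LINT x:K|lebesgue. F x) = (\<Sum>\<sigma>\<in>E. LINT x:face_cone c \<sigma>|lebesgue. Fs \<sigma> x)"
    and "set_integrable lebesgue K F"
proof -
  let ?S = "\<lambda>x. \<Sum>\<sigma>\<in>E. indicator (face_cone c \<sigma>) x *\<^sub>R Fs \<sigma> x"
  have int: "integrable lebesgue (\<lambda>x. indicator (face_cone c \<sigma>) x *\<^sub>R Fs \<sigma> x)" if "\<sigma> \<in> E" for \<sigma>
    using cone_set_integrable[OF that Fs[OF that]] by (simp add: set_integrable_def)
  then have intS: "integrable lebesgue ?S" by (rule Bochner_Integration.integrable_sum)
  have ae: "indicator K x *\<^sub>R F x = ?S x" if x: "x \<notin> null_part \<union> T" for x
  proof -
    from x have elim: "x \<notin> null_part" and xT: "x \<notin> T" by auto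
    show ?thesis
    proof (cases "x \<in> K")
      case True
      then obtain \<sigma> where \<sigma>: "\<sigma> \<in> E" "\<And>\<tau>. \<tau> \<in> E \<Longrightarrow> x \<in> face_cone c \<tau> \<longleftrightarrow> \<tau> = \<sigma>"
        using unique_cone[OF elim] by metis
      show ?thesis
        using eq[OF xT \<sigma>(1) True \<sigma>(2)] sum_cones[OF \<sigma>, of "\<lambda>\<tau>. Fs \<tau> x"] True by simp
    next
      case False
      then show ?thesis using not_in_cone[OF elim] by simp
    qed
  qed
  show "set_integrable lebesgue K F"
    unfolding set_integrable_def by (rule integrable_spike_lebesgue(1)[OF intS negligible_Un[OF negligible_null_part T] ae])
  have "(LINT x:K|lebesgue. F x) = integral\<^sup>L lebesgue ?S"
    unfolding set_lebesgue_integral_def by (rule integrable_spike_lebesgue(2)[OF intS negligible_Un[OF negligible_null_part T] ae])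
  also have "\<dots> = (\<Sum>\<sigma>\<in>E. LINT x:face_cone c \<sigma>|lebesgue. Fs \<sigma> x)"
    unfolding set_lebesgue_integral_def by (rule Bochner_Integration.integral_sum[OF int])
  finally show "(LINT x:K|lebesgue. F x) = (\<Sum>\<sigma>\<in>E. LINT x:face_cone c \<sigma>|lebesgue. Fs \<sigma> x)" .
qed

lemma cell_measure: "measure lebesgue K = (\<Sum>\<sigma>\<in>E. measure lebesgue (face_cone c \<sigma>))"
proof -
  have "measure lebesgue K = (LINT x:K|lebesgue. 1)"
    using open_cell by (simp add: set_lebesgue_integral_def)
  also have "\<dots> = (\<Sum>\<sigma>\<in>E. LINT x:face_cone c \<sigma>|lebesgue. 1)"
    by (rule cell_integral_split(1)[OF negligible_empty]) auto
  also have "\<dots> = (\<Sum>\<sigma>\<in>E. measure lebesgue (face_cone c \<sigma>))"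
    using hyperplane_cone.cone_borel[OF hyperplane_cone]
    by (intro sum.cong) (simp_all add: set_lebesgue_integral_def)
  finally show ?thesis .
qed

text \<open>A pyramid of height 1 with its apex over \<open>c\<close>, falling linearly along every
  ray to 0 at the frontier; the maximum cuts it off outside the cell.\<close>

definition tent :: "real^'n \<Rightarrow> real" where "tent x = max 0 (1 - radial_gauge x)"

lemma tent_outside: "x \<notin> K \<Longrightarrow> tent x = 0"
  using gauge_less_1_iff[of x] by (simp add: tent_def)

lemma tent_bounds: "0 \<le> tent x" "tent x \<le> 1"
  using gauge_nonneg[of x] by (simp_all add: tent_def)

lemma continuous_tent: "continuous_on UNIV tent"
  unfolding tent_def by (intro continuous_intros continuous_gauge)

lemma lipschitz_tent: "\<bar>tent y - tent x\<bar> \<le> Lip * dist x y"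
  using lipschitz_gauge[where x = x and y = y] mult_nonneg_nonneg[OF Lip_nonneg zero_le_dist[of x y]]
  by (auto simp: tent_def max_def abs_if split: if_splits)

lemma tent_on_cone:
  assumes \<sigma>: "\<sigma> \<in> E" and x: "x \<in> face_cone c \<sigma>"
  shows "tent x = 1 - N \<sigma> \<bullet> (x - c) / d \<sigma>"
proof -
  interpret C: hyperplane_cone c "N \<sigma>" "d \<sigma>" \<sigma> by (rule hyperplane_cone[OF \<sigma>])
  have x': "0 < N \<sigma> \<bullet> (x - c)" "N \<sigma> \<bullet> (x - c) < d \<sigma>"
    "c + (d \<sigma> / (N \<sigma> \<bullet> (x - c))) *\<^sub>R (x - c) \<in> \<sigma>"
    using x unfolding C.cone_alt by auto
  then show ?thesis using gauge_on_radial_face[OF \<sigma> x'(1,3)] C.d by (simp add: tent_def)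
qed

text \<open>Integration by parts, with the derivative moved onto \<open>tent\<close>. It is carried
  out with difference quotients: translation invariance gives the identity before the limit,
  dominated convergence on both sides gives the limit, and the boundary of the cell is never
  seen.\<close>

lemma tent_divergence:
  fixes \<phi> :: "real^'n \<Rightarrow> real" and G :: "real^'n \<Rightarrow> real^'n"
  assumes \<phi>: "\<And>x. (\<phi> has_derivative (\<lambda>h. G x \<bullet> h)) (at x)" and G: "continuous_on UNIV G"
  shows "(LINT x:K|lebesgue. tent x * (G x \<bullet> a)) =
    (\<Sum>\<sigma>\<in>E. (N \<sigma> \<bullet> a) / d \<sigma> * (LINT x:face_cone c \<sigma>|lebesgue. \<phi> x))"
proof -
  have c\<phi>: "continuous_on UNIV \<phi>"
    using \<phi> by (meson continuous_at_imp_continuous_on has_derivative_continuous)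
  obtain r where r: "\<And>x. x \<in> K \<Longrightarrow> norm x \<le> r" using bounded_cell bounded_iff by blast
  \<comment> \<open>The ball of this radius contains the cell and its translates by multiples of
    \<open>a\<close> with factor at most 1 in absolute value.\<close>
  define \<rho> where "\<rho> = r + norm a"
  have r\<rho>: "r \<le> \<rho>" by (simp add: \<rho>_def)
  have comp: "compact (cball 0 \<rho> :: (real^'n) set)" by simp
  have "bounded (\<phi> ` cball 0 \<rho>)"
    by (rule compact_imp_bounded[OF compact_continuous_image[OF continuous_on_subset[OF c\<phi>] comp]]) simp
  then obtain b\<phi> where "\<forall>y\<in>\<phi> ` cball 0 \<rho>. norm y \<le> b\<phi>" unfolding bounded_iff by blast
  then have b\<phi>: "\<And>x. x \<in> cball 0 \<rho> \<Longrightarrow> norm (\<phi> x) \<le> b\<phi>" by blast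
  have "bounded (G ` cball 0 \<rho>)"
    by (rule compact_imp_bounded[OF compact_continuous_image[OF continuous_on_subset[OF G] comp]]) simp
  then obtain bG where "\<forall>y\<in>G ` cball 0 \<rho>. norm y \<le> bG" unfolding bounded_iff by blast
  then have bG: "\<And>x. x \<in> cball 0 \<rho> \<Longrightarrow> norm (G x) \<le> bG" by blast
  define s where "s k = 1 / real (Suc k)" for k
  have s: "0 < s k" "s k \<le> 1" "s k \<noteq> 0" for k by (auto simp: s_def)
  have s0: "s \<longlonglongrightarrow> 0" unfolding s_def by (intro LIMSEQ_Suc lim_1_over_n)
  have in\<rho>: "norm x \<le> \<rho>" if "x + s k *\<^sub>R a \<in> K" for x k
  proof -
    have "norm x \<le> norm (x + s k *\<^sub>R a) + norm (s k *\<^sub>R a)" by (metis add_diff_cancel_right' norm_triangle_ineq4)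
    also have "\<dots> \<le> \<rho>" unfolding \<rho>_def using r[OF that] s[of k]
      by (intro add_mono) (simp_all add: mult_left_le_one_le)
    finally show ?thesis .
  qed
  have in\<rho>': "norm (x - s k *\<^sub>R a) \<le> \<rho>" if "x \<in> K" for x k
  proof -
    have "norm (x - s k *\<^sub>R a) \<le> norm x + norm (s k *\<^sub>R a)" by (rule norm_triangle_ineq4)
    also have "\<dots> \<le> \<rho>" unfolding \<rho>_def using r[OF that] s[of k]
      by (intro add_mono) (simp_all add: mult_left_le_one_le)
    finally show ?thesis .
  qed
  have ch: "continuous_on UNIV (\<lambda>x. tent (x + v))" for v
    by (rule continuous_on_compose2[OF continuous_tent]) (auto intro: continuous_intros)
  have c\<phi>v: "continuous_on UNIV (\<lambda>x. \<phi> (x - v))" for v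
    by (rule continuous_on_compose2[OF c\<phi>]) (auto intro: continuous_intros)
  \<comment> \<open>The difference quotient of \<open>tent\<close> along \<open>a\<close> is paired
    with that of \<open>\<phi>\<close> in the opposite direction; a shift by
    \<open>s k *\<^sub>R a\<close> gives \<open>A k\<close> and \<open>B k\<close> the same
    integral.\<close>
  define A where "A k x = (tent (x + s k *\<^sub>R a) - tent x) / s k * \<phi> x" for k x
  define B where "B k x = tent x * ((\<phi> (x - s k *\<^sub>R a) - \<phi> x) / s k)" for k x
  have cA: "continuous_on UNIV (A k)" and cB: "continuous_on UNIV (B k)" for k
    unfolding A_def B_def using s(3)[of k] by (auto intro!: continuous_intros ch c\<phi>v c\<phi> continuous_tent)
  have AB: "integral\<^sup>L lborel (A k) = integral\<^sup>L lborel (B k)" for k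
  proof -
    have c1: "continuous_on UNIV (\<lambda>x. tent (x + s k *\<^sub>R a) * \<phi> x)"
      and c2: "continuous_on UNIV (\<lambda>x. tent x * \<phi> x)"
      and c3: "continuous_on UNIV (\<lambda>x. tent x * \<phi> (x - s k *\<^sub>R a))"
      by (intro continuous_intros ch c\<phi>v c\<phi> continuous_tent)+
    have i1: "integrable lborel (\<lambda>x. tent (x + s k *\<^sub>R a) * \<phi> x)"
      by (rule integrable_continuous_support[of _ \<rho>, OF c1]) (use in\<rho> tent_outside in force)
    have i2: "integrable lborel (\<lambda>x. tent x * \<phi> x)"
      by (rule integrable_continuous_support[of _ r, OF c2]) (use r tent_outside in force)
    have i3: "integrable lborel (\<lambda>x. tent x * \<phi> (x - s k *\<^sub>R a))"
      by (rule integrable_continuous_support[of _ r, OF c3]) (use r tent_outside in force)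
    have "(\<integral>x. tent (x + s k *\<^sub>R a) * \<phi> x \<partial>lborel) = (\<integral>x. tent x * \<phi> (x - s k *\<^sub>R a) \<partial>lborel)"
      using integral_lborel_translate[OF borel_measurable_continuous_onI[OF c3], of "s k *\<^sub>R a"] by simp
    moreover have "integral\<^sup>L lborel (A k) =
        ((\<integral>x. tent (x + s k *\<^sub>R a) * \<phi> x \<partial>lborel) - (\<integral>x. tent x * \<phi> x \<partial>lborel)) / s k"
    proof -
      have "A k = (\<lambda>x. (tent (x + s k *\<^sub>R a) * \<phi> x - tent x * \<phi> x) / s k)"
        by (simp add: A_def fun_eq_iff left_diff_distrib)
      then show ?thesis using i1 i2 by simp
    qed
    moreover have "integral\<^sup>L lborel (B k) =
        ((\<integral>x. tent x * \<phi> (x - s k *\<^sub>R a) \<partial>lborel) - (\<integral>x. tent x * \<phi> x \<partial>lborel)) / s k"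
    proof -
      have "B k = (\<lambda>x. (tent x * \<phi> (x - s k *\<^sub>R a) - tent x * \<phi> x) / s k)"
        by (simp add: B_def fun_eq_iff right_diff_distrib)
      then show ?thesis using i3 i2 by simp
    qed
    ultimately show ?thesis by simp
  qed
  have limB: "(\<lambda>k. integral\<^sup>L lborel (B k)) \<longlonglongrightarrow> (\<integral>x. tent x * (- (G x \<bullet> a)) \<partial>lborel)"
  proof (rule integral_dominated_convergence[where w = "\<lambda>x. indicator (cball 0 r) x * (bG * norm a)"])
    show "(\<lambda>x. tent x * (- (G x \<bullet> a))) \<in> borel_measurable lborel"
      using continuous_tent G by (auto intro!: borel_measurable_continuous_onI continuous_intros)
    show "B k \<in> borel_measurable lborel" for k using cB by (auto intro!: borel_measurable_continuous_onI)
    show "integrable lborel (\<lambda>x::real^'n. indicator (cball 0 r) x * (bG * norm a))"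
      by (intro integrable_mult_left integrable_real_indicator) (use emeasure_bounded_finite[OF bounded_cball[of 0 r]] in simp_all)
    show "AE x in lborel. (\<lambda>k. B k x) \<longlonglongrightarrow> tent x * (- (G x \<bullet> a))"
      unfolding B_def
      by (intro AE_I2 tendsto_mult tendsto_const directional_difference_quotient[OF \<phi> s0 s(3)])
    fix k
    show "AE x in lborel. norm (B k x) \<le> indicator (cball 0 r) x * (bG * norm a)"
    proof (rule AE_I2)
      fix x
      show "norm (B k x) \<le> indicator (cball 0 r) x * (bG * norm a)"
      proof (cases "x \<in> K")
        case False
        have "0 \<le> bG * norm a"
        proof -
          have "c \<in> cball 0 \<rho>" using r[OF center] r\<rho> by simp
          from bG[OF this] have "0 \<le> bG" using norm_ge_zero[of "G c"] by linarith
          then show ?thesis by simp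
        qed
        then show ?thesis using tent_outside[OF False] by (simp add: B_def indicator_def)
      next
        case True
        have "norm (\<phi> (x - s k *\<^sub>R a) - \<phi> x) \<le> bG * norm (x - s k *\<^sub>R a - x)"
        proof (rule differentiable_bound[of "cball 0 \<rho>"])
          show "x - s k *\<^sub>R a \<in> cball 0 \<rho>" "x \<in> cball 0 \<rho>"
            using in\<rho>'[OF True] r[OF True] r\<rho> by auto
          fix z assume z: "z \<in> cball (0::real^'n) \<rho>"
          show "(\<phi> has_derivative (\<lambda>h. G z \<bullet> h)) (at z within cball 0 \<rho>)"
            using \<phi> by (rule has_derivative_at_withinI)
          show "onorm (\<lambda>h. G z \<bullet> h) \<le> bG"
          proof (rule onorm_le)
            fix v
            have "norm (G z \<bullet> v) \<le> norm (G z) * norm v" using Cauchy_Schwarz_ineq2 by auto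
            also have "\<dots> \<le> bG * norm v" by (intro mult_right_mono bG z) simp
            finally show "norm (G z \<bullet> v) \<le> bG * norm v" .
          qed
        qed simp
        also have "\<dots> = bG * norm a * s k" using s(1)[of k] by simp
        finally have "\<bar>(\<phi> (x - s k *\<^sub>R a) - \<phi> x) / s k\<bar> \<le> bG * norm a"
          using s(1)[of k] by (simp add: abs_divide divide_le_eq)
        then have "norm (B k x) \<le> 1 * (bG * norm a)"
          unfolding B_def real_norm_def abs_mult using tent_bounds[of x] by (intro mult_mono) auto
        then show ?thesis using r[OF True] by simp
      qed
    qed
  qed
  let ?S = "\<lambda>x. \<Sum>\<sigma>\<in>E. indicator (face_cone c \<sigma>) x *\<^sub>R (- ((N \<sigma> \<bullet> a) / d \<sigma> * \<phi> x))"
  have cone_b: "face_cone c \<sigma> \<in> sets borel" if "\<sigma> \<in> E" for \<sigma>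
    using hyperplane_cone.cone_borel[OF hyperplane_cone[OF that]] .
  have \<phi>b: "\<phi> \<in> borel_measurable borel" by (rule borel_measurable_continuous_onI[OF c\<phi>])
  \<comment> \<open>Domination comes from the Lipschitz bound on \<open>tent\<close>. The pointwise
    limit holds off \<open>null_part\<close>, where \<open>tent\<close> is affine or zero near the
    point.\<close>
  have limA: "(\<lambda>k. integral\<^sup>L lborel (A k)) \<longlonglongrightarrow> integral\<^sup>L lborel ?S"
  proof (rule integral_dominated_convergence[where w = "\<lambda>x. indicator (cball 0 \<rho>) x * (Lip * norm a * b\<phi>)"])
    show "?S \<in> borel_measurable lborel"
      using cone_b \<phi>b by (intro borel_measurable_sum borel_measurable_scaleR) auto
    show "A k \<in> borel_measurable lborel" for k using cA by (auto intro!: borel_measurable_continuous_onI)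
    show "integrable lborel (\<lambda>x::real^'n. indicator (cball 0 \<rho>) x * (Lip * norm a * b\<phi>))"
      by (intro integrable_mult_left integrable_real_indicator) (use emeasure_bounded_finite[OF bounded_cball[of 0 \<rho>]] in simp_all)
    have "AE x in lborel. x \<notin> null_part"
      using AE_not_null_part by (simp add: AE_completion_iff)
    then show "AE x in lborel. (\<lambda>k. A k x) \<longlonglongrightarrow> ?S x"
    proof eventually_elim
      case (elim x)
      have near: "\<forall>\<^sub>F k in sequentially. x + s k *\<^sub>R a \<in> U" if "open U" "x \<in> U" for U
      proof -
        have "(\<lambda>k. x + s k *\<^sub>R a) \<longlonglongrightarrow> x + 0 *\<^sub>R a" by (intro tendsto_intros s0)
        then have "(\<lambda>k. x + s k *\<^sub>R a) \<longlonglongrightarrow> x" by simp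
        then show ?thesis using that by (rule topological_tendstoD)
      qed
      show ?case
      proof (cases "x \<in> K")
        case True
        then obtain \<sigma> where \<sigma>: "\<sigma> \<in> E" "x \<in> face_cone c \<sigma>"
          "\<And>\<tau>. \<tau> \<in> E \<Longrightarrow> x \<in> face_cone c \<tau> \<longleftrightarrow> \<tau> = \<sigma>"
          using unique_cone[OF elim] by metis
        \<comment> \<open>The cone is open, so eventually both points of the quotient lie in it and
          the quotient of the affine function is exact.\<close>
        have "\<forall>\<^sub>F k in sequentially. A k x = - ((N \<sigma> \<bullet> a) / d \<sigma> * \<phi> x)"
          using near[OF hyperplane_cone.open_cone[OF hyperplane_cone[OF \<sigma>(1)]] \<sigma>(2)]
        proof eventually_elim
          case (elim k)
          have "tent (x + s k *\<^sub>R a) - tent x = - (s k * (N \<sigma> \<bullet> a) / d \<sigma>)"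
            using tent_on_cone[OF \<sigma>(1) elim] tent_on_cone[OF \<sigma>(1,2)]
            by (simp add: inner_diff_right inner_add_right diff_divide_distrib add_divide_distrib)
          then show ?case using s(3)[of k] by (simp add: A_def)
        qed
        moreover have "?S x = - ((N \<sigma> \<bullet> a) / d \<sigma> * \<phi> x)"
          by (rule sum_cones[OF \<sigma>(1,3)])
        ultimately show ?thesis by (simp add: tendsto_eventually)
      next
        case False
        have "x \<notin> closure K"
          using elim False by (auto simp: null_part_def frontier_def interior_open[OF open_cell])
        then have "\<forall>\<^sub>F k in sequentially. x + s k *\<^sub>R a \<in> - closure K"
          by (intro near) auto
        then have "\<forall>\<^sub>F k in sequentially. A k x = 0"
        proof eventually_elim
          case (elim k)
          then have "x + s k *\<^sub>R a \<notin> K" using closure_subset by blast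
          then show ?case using tent_outside False by (simp add: A_def)
        qed
        moreover have "?S x = 0" using not_in_cone[OF elim False] by simp
        ultimately show ?thesis by (simp add: tendsto_eventually)
      qed
    qed
    fix k
    show "AE x in lborel. norm (A k x) \<le> indicator (cball 0 \<rho>) x * (Lip * norm a * b\<phi>)"
    proof (rule AE_I2)
      fix x
      show "norm (A k x) \<le> indicator (cball 0 \<rho>) x * (Lip * norm a * b\<phi>)"
      proof (cases "x \<in> cball 0 \<rho>")
        case False
        then have "x \<notin> K" "x + s k *\<^sub>R a \<notin> K" using r[of x] r\<rho> in\<rho>[of x k] by auto
        then show ?thesis using False tent_outside by (simp add: A_def)
      next
        case True
        have "\<bar>tent (x + s k *\<^sub>R a) - tent x\<bar> \<le> Lip * norm a * s k"
          using lipschitz_tent[where x=x and y="x + s k *\<^sub>R a"] s(1)[of k]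
          by (simp add: dist_norm mult_ac)
        then have "\<bar>(tent (x + s k *\<^sub>R a) - tent x) / s k\<bar> \<le> Lip * norm a"
          using s(1)[of k] by (simp add: abs_divide divide_le_eq)
        then have "\<bar>A k x\<bar> \<le> Lip * norm a * b\<phi>"
          unfolding A_def abs_mult using b\<phi>[OF True] Lip_nonneg s(1)[of k] by (intro mult_mono) auto
        then show ?thesis using True by simp
      qed
    qed
  qed
  have eq: "(\<integral>x. tent x * (- (G x \<bullet> a)) \<partial>lborel) = integral\<^sup>L lborel ?S"
    using LIMSEQ_unique[OF limB] limA unfolding AB by blast
  have "(LINT x:K|lebesgue. tent x * (G x \<bullet> a)) = (LINT x:K|lborel. tent x * (G x \<bullet> a))"
    using open_cell continuous_tent G
    by (intro set_lebesgue_integral_lebesgue) (auto intro!: borel_measurable_continuous_onI continuous_intros)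
  also have "\<dots> = (\<integral>x. tent x * (G x \<bullet> a) \<partial>lborel)"
    unfolding set_lebesgue_integral_def
    by (intro Bochner_Integration.integral_cong) (auto simp: indicator_def tent_outside)
  also have "\<dots> = - integral\<^sup>L lborel ?S" using eq by simp
  also have "integral\<^sup>L lborel ?S =
      (\<Sum>\<sigma>\<in>E. LINT x:face_cone c \<sigma>|lborel. - ((N \<sigma> \<bullet> a) / d \<sigma> * \<phi> x))"
    unfolding set_lebesgue_integral_def
  proof (rule Bochner_Integration.integral_sum)
    fix \<sigma> assume "\<sigma> \<in> E"
    then interpret C: hyperplane_cone c "N \<sigma>" "d \<sigma>" \<sigma> by (rule hyperplane_cone)
    have "set_integrable lborel (face_cone c \<sigma>) (\<lambda>x. - ((N \<sigma> \<bullet> a) / d \<sigma> * \<phi> x))"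
      using c\<phi> by (intro C.cone_integrable continuous_intros)
    then show "integrable lborel (\<lambda>x. indicator (face_cone c \<sigma>) x *\<^sub>R (- ((N \<sigma> \<bullet> a) / d \<sigma> * \<phi> x)))"
      by (simp add: set_integrable_def)
  qed
  also have "\<dots> = (\<Sum>\<sigma>\<in>E. - ((N \<sigma> \<bullet> a) / d \<sigma> * (LINT x:face_cone c \<sigma>|lebesgue. \<phi> x)))"
  proof (rule sum.cong[OF refl])
    fix \<sigma> assume "\<sigma> \<in> E"
    have "(LINT x:face_cone c \<sigma>|lborel. - ((N \<sigma> \<bullet> a) / d \<sigma> * \<phi> x)) =
        (LINT x:face_cone c \<sigma>|lborel. (- (N \<sigma> \<bullet> a) / d \<sigma>) * \<phi> x)" by simp
    also have "\<dots> = (- (N \<sigma> \<bullet> a) / d \<sigma>) * (LINT x:face_cone c \<sigma>|lborel. \<phi> x)"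
      by (rule set_integral_mult_right)
    finally show "(LINT x:face_cone c \<sigma>|lborel. - ((N \<sigma> \<bullet> a) / d \<sigma> * \<phi> x)) =
        - ((N \<sigma> \<bullet> a) / d \<sigma> * (LINT x:face_cone c \<sigma>|lebesgue. \<phi> x))"
      using set_lebesgue_integral_lebesgue[OF cone_b[OF \<open>\<sigma> \<in> E\<close>] \<phi>b] by simp
  qed
  finally show ?thesis by (simp add: sum_negf)
qed

text \<open>With \<open>X\<close> the radial field $x - c$ and \<open>D\<close> the dimension, $\partial_a (X + D) = (X + D + 1)\partial_a$.
  So \<open>tent_divergence\<close> for $(X + D)\phi$ has $\int_K \partial_a\phi$ on the left, by
  \<open>cone_weighted_radial_divergence\<close>, and the face integrals on the right.\<close>

lemma cell_divergence:
  fixes \<phi> :: "real^'n \<Rightarrow> real" and G :: "real^'n \<Rightarrow> real^'n" and H :: "real^'n \<Rightarrow> real^'n \<Rightarrow> real^'n"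
  assumes \<phi>: "\<And>x. (\<phi> has_derivative (\<lambda>v. G x \<bullet> v)) (at x)"
    and G: "\<And>x. (G has_derivative H x) (at x)"
    and H: "\<And>v. continuous_on UNIV (\<lambda>x. H x v)"
    and sym: "\<And>x u v. H x u \<bullet> v = H x v \<bullet> u"
  shows "(LINT x:K|lebesgue. G x \<bullet> a) =
    (\<Sum>\<sigma>\<in>E. (N \<sigma> \<bullet> a) * (LINT y:\<sigma>|flat_lborel (affine hull \<sigma>). \<phi> y))"
proof -
  have cG: "continuous_on UNIV G"
    using G by (meson continuous_at_imp_continuous_on has_derivative_continuous)
  have c\<phi>: "continuous_on UNIV \<phi>"
    using \<phi> by (meson continuous_at_imp_continuous_on has_derivative_continuous)
  have linH: "linear (H x)" for x using G has_derivative_linear by blast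
  \<comment> \<open>\<open>H\<close> is continuous for each fixed direction only, so the varying
    direction x - c is expanded in the basis.\<close>
  have HX: "continuous_on UNIV (\<lambda>x. H x (x - c))"
  proof -
    have "H x (x - c) = (\<Sum>b\<in>Basis. ((x - c) \<bullet> b) *\<^sub>R H x b)" for x
    proof -
      have "H x (x - c) = H x (\<Sum>b\<in>Basis. ((x - c) \<bullet> b) *\<^sub>R b)" by (simp only: euclidean_representation)
      then show ?thesis using linH[of x] by (simp add: linear_sum linear_scale)
    qed
    then show ?thesis by (auto intro!: continuous_intros H)
  qed
  let ?D = "real CARD('n)"
  \<comment> \<open>\<open>\<psi>\<close> is the integrand of \<open>cone_radial_divergence\<close>,
    so its cone integrals are face integrals. Its gradient \<open>G'\<close>, tested with
    \<open>a\<close>, is by symmetry of the Hessian the second factor in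
    \<open>cone_weighted_radial_divergence\<close> for the directional derivative
    \<open>G x \<bullet> a\<close>.\<close>
  define \<psi> where "\<psi> x = G x \<bullet> (x - c) + ?D * \<phi> x" for x
  define G' where "G' x = H x (x - c) + (?D + 1) *\<^sub>R G x" for x
  have \<psi>: "(\<psi> has_derivative (\<lambda>v. G' x \<bullet> v)) (at x)" for x
    unfolding \<psi>_def
  proof (rule has_derivative_eq_rhs)
    show "((\<lambda>x. G x \<bullet> (x - c) + ?D * \<phi> x) has_derivative
        (\<lambda>v. G x \<bullet> v + H x v \<bullet> (x - c) + ?D * (G x \<bullet> v))) (at x)"
      by (auto intro!: derivative_eq_intros G \<phi>)
    show "(\<lambda>v. G x \<bullet> v + H x v \<bullet> (x - c) + ?D * (G x \<bullet> v)) = (\<lambda>v. G' x \<bullet> v)"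
      using sym by (auto simp: G'_def inner_add_left algebra_simps fun_eq_iff)
  qed
  have cG': "continuous_on UNIV G'" unfolding G'_def by (intro continuous_intros HX cG)
  have Ga: "((\<lambda>x. G x \<bullet> a) has_derivative (\<lambda>v. H x a \<bullet> v)) (at x)" for x
    by (rule has_derivative_eq_rhs[OF has_derivative_inner_left[OF G]]) (auto simp: sym fun_eq_iff)
  have "(LINT x:K|lebesgue. G x \<bullet> a) = (\<Sum>\<sigma>\<in>E. LINT x:face_cone c \<sigma>|lebesgue. G x \<bullet> a)"
    by (rule cell_integral_split(1)[OF negligible_empty]) (auto intro!: continuous_intros cG)
  also have "\<dots> = (\<Sum>\<sigma>\<in>E. LINT x:face_cone c \<sigma>|lebesgue.
      (1 - N \<sigma> \<bullet> (x - c) / d \<sigma>) * (H x a \<bullet> (x - c) + (?D + 1) * (G x \<bullet> a)))"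
  proof (rule sum.cong[OF refl])
    fix \<sigma> assume "\<sigma> \<in> E"
    from hyperplane_cone.cone_weighted_radial_divergence[OF hyperplane_cone[OF this] Ga H]
    show "(LINT x:face_cone c \<sigma>|lebesgue. G x \<bullet> a) = (LINT x:face_cone c \<sigma>|lebesgue.
        (1 - N \<sigma> \<bullet> (x - c) / d \<sigma>) * (H x a \<bullet> (x - c) + (?D + 1) * (G x \<bullet> a)))"
      by (simp add: add.commute)
  qed
  also have "\<dots> = (\<Sum>\<sigma>\<in>E. LINT x:face_cone c \<sigma>|lebesgue. (1 - N \<sigma> \<bullet> (x - c) / d \<sigma>) * (G' x \<bullet> a))"
    by (simp add: G'_def inner_add_left sym)
  also have "\<dots> = (LINT x:K|lebesgue. tent x * (G' x \<bullet> a))"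
    by (rule cell_integral_split(1)[OF negligible_empty, symmetric])
      (use dist_pos tent_on_cone in \<open>auto intro!: continuous_intros cG' simp: less_imp_neq[THEN not_sym]\<close>)
  also have "\<dots> = (\<Sum>\<sigma>\<in>E. (N \<sigma> \<bullet> a) / d \<sigma> * (LINT x:face_cone c \<sigma>|lebesgue. \<psi> x))"
    by (rule tent_divergence[OF \<psi> cG'])
  also have "\<dots> = (\<Sum>\<sigma>\<in>E. (N \<sigma> \<bullet> a) * (LINT y:\<sigma>|flat_lborel (affine hull \<sigma>). \<phi> y))"
  proof (rule sum.cong[OF refl])
    fix \<sigma> assume "\<sigma> \<in> E"
    then interpret C: hyperplane_cone c "N \<sigma>" "d \<sigma>" \<sigma> by (rule hyperplane_cone)
    show "(N \<sigma> \<bullet> a) / d \<sigma> * (LINT x:face_cone c \<sigma>|lebesgue. \<psi> x) =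
        (N \<sigma> \<bullet> a) * (LINT y:\<sigma>|flat_lborel (affine hull \<sigma>). \<phi> y)"
      unfolding \<psi>_def using C.cone_radial_divergence[OF \<phi> cG] C.d by simp
  qed
  finally show ?thesis .
qed

lemma sum_normals: "(\<Sum>\<sigma>\<in>E. face_area \<sigma> * (N \<sigma> \<bullet> a)) = 0"
proof -
  have "(LINT x:K|lebesgue. (0::real^'n) \<bullet> a) =
      (\<Sum>\<sigma>\<in>E. (N \<sigma> \<bullet> a) * (LINT y:\<sigma>|flat_lborel (affine hull \<sigma>). 1))"
    by (rule cell_divergence[where H = "\<lambda>_ _. 0"]) auto
  also have "\<dots> = (\<Sum>\<sigma>\<in>E. face_area \<sigma> * (N \<sigma> \<bullet> a))"
    using hyperplane_cone.face_area_eq[OF hyperplane_cone] by (intro sum.cong) (auto simp: mult.commute)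
  finally show ?thesis by simp
qed

text \<open>The case of the affine function with gradient \<open>e\<close> that vanishes at
  \<open>c\<close>; its face integrals are expressed by the centres of gravity.\<close>

lemma sum_normals_moment:
  "(\<Sum>\<sigma>\<in>E. face_area \<sigma> * (N \<sigma> \<bullet> a) * ((face_center \<sigma> - c) \<bullet> e)) = measure lebesgue K * (a \<bullet> e)"
proof -
  have "(LINT x:K|lebesgue. e \<bullet> a) =
      (\<Sum>\<sigma>\<in>E. (N \<sigma> \<bullet> a) * (LINT y:\<sigma>|flat_lborel (affine hull \<sigma>). (y - c) \<bullet> e))"
  proof (rule cell_divergence[where H = "\<lambda>_ _. 0"])
    show "((\<lambda>y. (y - c) \<bullet> e) has_derivative (\<lambda>v. e \<bullet> v)) (at x)" for x
      by (auto intro!: derivative_eq_intros simp: inner_commute)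
  qed auto
  also have "\<dots> = (\<Sum>\<sigma>\<in>E. face_area \<sigma> * (N \<sigma> \<bullet> a) * ((face_center \<sigma> - c) \<bullet> e))"
    using hyperplane_cone.face_moment[OF hyperplane_cone] by (intro sum.cong) auto
  finally show ?thesis using open_cell by (simp add: set_lebesgue_integral_def inner_commute)
qed

end

section \<open>Test functions and the uniqueness of the divergence\<close>

text \<open>The mean value theorem in direction \<open>u\<close>, then in direction
  \<open>v\<close>. The left-hand side is symmetric in \<open>u\<close> and \<open>v\<close> and the
  right-hand side is not, from which the symmetry of the Hessian results.\<close>

lemma second_difference:
  fixes f :: "'a::euclidean_space \<Rightarrow> real"
  assumes f: "\<And>x. (f has_derivative (\<lambda>v. G x \<bullet> v)) (at x)"
    and G: "\<And>x. (G has_derivative H x) (at x)" and s: "0 < (s::real)"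
  obtains \<xi> \<eta> where "0 < \<xi>" "\<xi> < s" "0 < \<eta>" "\<eta> < s"
    and "f (x + s *\<^sub>R u + s *\<^sub>R v) - f (x + s *\<^sub>R u) - f (x + s *\<^sub>R v) + f x =
      s\<^sup>2 * (H (x + \<xi> *\<^sub>R u + \<eta> *\<^sub>R v) v \<bullet> u)"
proof -
  define q where "q r = f (x + r *\<^sub>R u + s *\<^sub>R v) - f (x + r *\<^sub>R u)" for r
  have q: "(q has_real_derivative G (x + r *\<^sub>R u + s *\<^sub>R v) \<bullet> u - G (x + r *\<^sub>R u) \<bullet> u) (at r)" for r
  proof -
    have "((\<lambda>r. f (x + r *\<^sub>R u + w)) has_real_derivative G (x + r *\<^sub>R u + w) \<bullet> u) (at r)" for w
      unfolding has_field_derivative_def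
      by (rule has_derivative_eq_rhs[OF has_derivative_compose[OF _ f]])
        (auto intro!: derivative_eq_intros simp: fun_eq_iff)
    from this[of "s *\<^sub>R v"] this[of 0] show ?thesis
      unfolding q_def by (auto intro: DERIV_diff)
  qed
  obtain \<xi> where \<xi>: "0 < \<xi>" "\<xi> < s"
    and 1: "q s - q 0 = (s - 0) * (G (x + \<xi> *\<^sub>R u + s *\<^sub>R v) \<bullet> u - G (x + \<xi> *\<^sub>R u) \<bullet> u)"
    using MVT2[OF s q] by blast
  define p where "p r = G (x + \<xi> *\<^sub>R u + r *\<^sub>R v) \<bullet> u" for r
  have p: "(p has_real_derivative H (x + \<xi> *\<^sub>R u + r *\<^sub>R v) v \<bullet> u) (at r)" for r
  proof -
    have lin: "linear (H z)" for z using G has_derivative_linear by blast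
    have "((\<lambda>r. G (x + \<xi> *\<^sub>R u + r *\<^sub>R v)) has_derivative (\<lambda>t. H (x + \<xi> *\<^sub>R u + r *\<^sub>R v) (t *\<^sub>R v))) (at r)"
      by (rule has_derivative_compose[OF _ G]) (auto intro!: derivative_eq_intros)
    from has_derivative_inner_left[OF this, of u] show ?thesis
      unfolding p_def has_field_derivative_def
      by (rule has_derivative_eq_rhs) (simp add: linear_scale[OF lin] fun_eq_iff mult.commute)
  qed
  obtain \<eta> where \<eta>: "0 < \<eta>" "\<eta> < s"
    and 2: "p s - p 0 = (s - 0) * (H (x + \<xi> *\<^sub>R u + \<eta> *\<^sub>R v) v \<bullet> u)"
    using MVT2[OF s p] by blast
  have "f (x + s *\<^sub>R u + s *\<^sub>R v) - f (x + s *\<^sub>R u) - f (x + s *\<^sub>R v) + f x = q s - q 0"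
    by (simp add: q_def)
  also have "\<dots> = s\<^sup>2 * (H (x + \<xi> *\<^sub>R u + \<eta> *\<^sub>R v) v \<bullet> u)"
    using 1 2 by (simp add: p_def power2_eq_square)
  finally show thesis by (rule that[OF \<xi> \<eta>])
qed

text \<open>Second differences divided by the squared step converge to both expressions, because the
  intermediate points tend to \<open>x\<close> and \<open>H\<close> is continuous for a fixed
  direction. \<open>lim\<close> is stated for any pair of directions so that the roles can be
  exchanged.\<close>

lemma second_derivative_symmetric:
  fixes f :: "'a::euclidean_space \<Rightarrow> real"
  assumes f: "\<And>x. (f has_derivative (\<lambda>v. G x \<bullet> v)) (at x)"
    and G: "\<And>x. (G has_derivative H x) (at x)"
    and H: "\<And>v. continuous_on UNIV (\<lambda>x. H x v)"
  shows "H x u \<bullet> v = H x v \<bullet> u"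
proof -
  define s where "s k = 1 / real (Suc k)" for k
  have s: "0 < s k" for k by (simp add: s_def)
  have s0: "s \<longlonglongrightarrow> 0" unfolding s_def by (intro LIMSEQ_Suc lim_1_over_n)
  define \<Delta> where "\<Delta> k = (f (x + s k *\<^sub>R u + s k *\<^sub>R v) - f (x + s k *\<^sub>R u) - f (x + s k *\<^sub>R v) + f x) / (s k)\<^sup>2" for k
  have lim: "\<Delta>' \<longlonglongrightarrow> H x v \<bullet> u"
    if ex: "\<And>k. \<exists>\<xi> \<eta>. 0 < \<xi> \<and> \<xi> < s k \<and> 0 < \<eta> \<and> \<eta> < s k \<and> \<Delta>' k = H (x + \<xi> *\<^sub>R u + \<eta> *\<^sub>R v) v \<bullet> u"
    for \<Delta>' u v
  proof -
    obtain \<xi> \<eta> where *: "\<And>k. 0 < \<xi> k \<and> \<xi> k < s k \<and> 0 < \<eta> k \<and> \<eta> k < s k \<and>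
        \<Delta>' k = H (x + \<xi> k *\<^sub>R u + \<eta> k *\<^sub>R v) v \<bullet> u"
      using ex by metis
    have "\<xi> \<longlonglongrightarrow> 0" "\<eta> \<longlonglongrightarrow> 0"
      by (rule tendsto_sandwich[OF _ _ tendsto_const s0]; use * in \<open>auto intro!: always_eventually less_imp_le\<close>)+
    then have "(\<lambda>k. x + \<xi> k *\<^sub>R u + \<eta> k *\<^sub>R v) \<longlonglongrightarrow> x + 0 *\<^sub>R u + 0 *\<^sub>R v" by (intro tendsto_intros)
    moreover have "isCont (\<lambda>x. H x v \<bullet> u) x"
      using H by (intro continuous_intros) (simp add: continuous_on_eq_continuous_at)
    ultimately have "(\<lambda>k. H (x + \<xi> k *\<^sub>R u + \<eta> k *\<^sub>R v) v \<bullet> u) \<longlonglongrightarrow> H x v \<bullet> u"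
      using isCont_tendsto_compose by force
    moreover have "\<Delta>' = (\<lambda>k. H (x + \<xi> k *\<^sub>R u + \<eta> k *\<^sub>R v) v \<bullet> u)" using * by auto
    ultimately show ?thesis by (simp only:)
  qed
  have "\<Delta> \<longlonglongrightarrow> H x v \<bullet> u"
  proof (rule lim)
    fix k
    obtain \<xi> \<eta> where "0 < \<xi>" "\<xi> < s k" "0 < \<eta>" "\<eta> < s k"
      "f (x + s k *\<^sub>R u + s k *\<^sub>R v) - f (x + s k *\<^sub>R u) - f (x + s k *\<^sub>R v) + f x =
      (s k)\<^sup>2 * (H (x + \<xi> *\<^sub>R u + \<eta> *\<^sub>R v) v \<bullet> u)"
      by (rule second_difference[OF f G s])
    then show "\<exists>\<xi> \<eta>. 0 < \<xi> \<and> \<xi> < s k \<and> 0 < \<eta> \<and> \<eta> < s k \<and> \<Delta> k = H (x + \<xi> *\<^sub>R u + \<eta> *\<^sub>R v) v \<bullet> u"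
      using s[of k] unfolding \<Delta>_def by (intro exI[of _ \<xi>] exI[of _ \<eta>]) simp
  qed
  moreover have "\<Delta> \<longlonglongrightarrow> H x u \<bullet> v"
  proof (rule lim)
    fix k
    obtain \<xi> \<eta> where "0 < \<xi>" "\<xi> < s k" "0 < \<eta>" "\<eta> < s k"
      and eq: "f (x + s k *\<^sub>R v + s k *\<^sub>R u) - f (x + s k *\<^sub>R v) - f (x + s k *\<^sub>R u) + f x =
      (s k)\<^sup>2 * (H (x + \<xi> *\<^sub>R v + \<eta> *\<^sub>R u) u \<bullet> v)"
      by (rule second_difference[OF f G s])
    have "x + s k *\<^sub>R u + s k *\<^sub>R v = x + s k *\<^sub>R v + s k *\<^sub>R u" by simp
    then have "f (x + s k *\<^sub>R u + s k *\<^sub>R v) - f (x + s k *\<^sub>R u) - f (x + s k *\<^sub>R v) + f x =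
      (s k)\<^sup>2 * (H (x + \<xi> *\<^sub>R v + \<eta> *\<^sub>R u) u \<bullet> v)" using eq by (simp only:)
    then show "\<exists>\<xi> \<eta>. 0 < \<xi> \<and> \<xi> < s k \<and> 0 < \<eta> \<and> \<eta> < s k \<and> \<Delta> k = H (x + \<xi> *\<^sub>R v + \<eta> *\<^sub>R u) u \<bullet> v"
      using s[of k] \<open>0 < \<xi>\<close> \<open>\<xi> < s k\<close> \<open>0 < \<eta>\<close> \<open>\<eta> < s k\<close>
      unfolding \<Delta>_def by (intro exI[of _ \<xi>] exI[of _ \<eta>]) simp
  qed
  ultimately show ?thesis by (rule LIMSEQ_unique[rotated])
qed

lemma gradient_eq:
  assumes "(f has_derivative (\<lambda>v. g \<bullet> v)) (at x)"
  shows "partial_deriv i f x = g $ i" and "gradient f x = g"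
proof -
  have "frechet_derivative f (at x) = (\<lambda>v. g \<bullet> v)" using frechet_derivative_at[OF assms] by simp
  then show *: "partial_deriv i f x = g $ i" for i
    by (simp add: partial_deriv_def inner_axis)
  show "gradient f x = g" by (simp add: gradient_def * vec_eq_iff)
qed

lemma has_derivative_gradient:
  fixes f :: "real^'n \<Rightarrow> real"
  assumes "f differentiable (at x)"
  shows "(f has_derivative (\<lambda>v. gradient f x \<bullet> v)) (at x)"
proof -
  let ?f' = "frechet_derivative f (at x)"
  have f': "(f has_derivative ?f') (at x)" using assms frechet_derivative_works by blast
  then have lin: "linear ?f'" by (rule has_derivative_linear)
  have "?f' v = gradient f x \<bullet> v" for v
  proof -
    have "?f' v = ?f' (\<Sum>i\<in>UNIV. v $ i *\<^sub>R axis i 1)"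
      by (simp add: basis_expansion flip: scalar_mult_eq_scaleR)
    also have "\<dots> = gradient f x \<bullet> v"
      by (simp add: linear_sum[OF lin] linear_scale[OF lin] inner_vec_def gradient_def
        partial_deriv_def mult.commute)
    finally show ?thesis .
  qed
  then have "?f' = (\<lambda>v. gradient f x \<bullet> v)" by (rule ext)
  then show ?thesis using f' by (simp only:)
qed

text \<open>Test functions are described by iterated partial derivatives, whereas
  \<open>cell_divergence\<close> asks for a gradient with a continuous symmetric derivative; this
  translates between the two.\<close>

lemma C_diff_derivatives:
  fixes \<phi> :: "real^'n \<Rightarrow> real"
  assumes \<phi>: "\<And>k. C_diff k \<phi>"
  obtains H where "\<And>x. (\<phi> has_derivative (\<lambda>v. gradient \<phi> x \<bullet> v)) (at x)"
    and "\<And>x. (gradient \<phi> has_derivative H x) (at x)"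
    and "\<And>v. continuous_on UNIV (\<lambda>x. H x v)"
    and "\<And>x u v. H x u \<bullet> v = H x v \<bullet> u"
proof -
  have d1: "\<phi> differentiable (at x)" for x
    using \<phi>[of 1] by (simp add: differentiable_on_def)
  have p: "C_diff k (partial_deriv i \<phi>)" for k i using \<phi>[of "Suc k"] by simp
  have d2: "partial_deriv i \<phi> differentiable (at x)" for i x
    using p[of 1 i] by (simp add: differentiable_on_def)
  have c: "continuous_on UNIV (partial_deriv j (partial_deriv i \<phi>))" for i j
    using p[of 1 i] by simp
  define H where "H x v = (\<chi> i. gradient (partial_deriv i \<phi>) x \<bullet> v)" for x v
  have 1: "(\<phi> has_derivative (\<lambda>v. gradient \<phi> x \<bullet> v)) (at x)" for x
    by (rule has_derivative_gradient[OF d1])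
  have 2: "(gradient \<phi> has_derivative H x) (at x)" for x
  proof -
    have "((\<lambda>y. gradient \<phi> y \<bullet> b) has_derivative (\<lambda>v. H x v \<bullet> b)) (at x)" if b: "b \<in> Basis" for b
    proof -
      obtain i where "b = axis i 1" using b by (auto simp: Basis_vec_def)
      then show ?thesis
        using has_derivative_gradient[OF d2[of i x]]
        by (simp add: inner_axis gradient_def[of \<phi>] H_def)
    qed
    then show ?thesis by (subst has_derivative_componentwise_within) blast
  qed
  have 3: "continuous_on UNIV (\<lambda>x. H x v)" for v
    unfolding H_def gradient_def by (intro continuous_intros continuous_on_vec_lambda c)
  show thesis by (rule that[OF 1 2 3 second_derivative_symmetric[OF 1 2 3]])
qed

section \<open>Smooth cutoff functions of an open set\<close>

definition bump :: "real poly \<Rightarrow> real \<Rightarrow> real" where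
  "bump P t = (if t \<le> 0 then 0 else poly P (1 / t) * exp (- 1 / t))"

lemma bump_limit: "((\<lambda>t. poly P (1 / t) * exp (- 1 / t)) \<longlongrightarrow> 0) (at_right (0::real))"
proof -
  have "((\<lambda>y. \<Sum>i\<le>degree P. coeff P i * (y ^ i / exp y)) \<longlongrightarrow> (\<Sum>i\<le>degree P. coeff P i * 0)) at_top"
    by (intro tendsto_intros tendsto_power_div_exp_0)
  then have "((\<lambda>y. poly P y * exp (- y)) \<longlongrightarrow> 0) at_top"
    by (simp add: poly_altdef exp_minus sum_distrib_right divide_inverse mult.assoc)
  from filterlim_compose[OF this filterlim_inverse_at_top_right] show ?thesis
    by (simp add: inverse_eq_divide)
qed

text \<open>With u = 1/t, the derivative of P(u) exp(-u) in t is u^2 (P - P')(u) exp(-u), and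
  \<open>[:0, 0, 1:]\<close> is u^2. Carrying a polynomial in 1/t thus closes the family under
  differentiation, also at t = 0.\<close>

lemma bump_deriv: "(bump P has_real_derivative bump ([:0, 0, 1:] * (P - pderiv P)) t) (at t)"
proof (cases "t = 0")
  case False
  show ?thesis
  proof (cases "t < 0")
    case True
    have "((\<lambda>_. 0) has_real_derivative 0) (at t)" by simp
    moreover have "\<forall>\<^sub>F s in nhds t. bump P s = 0"
      using eventually_nhds_in_open[of "{..<0}" t] True
      by (auto simp: bump_def elim!: eventually_mono)
    ultimately show ?thesis using True DERIV_cong_ev[OF refl _ refl, of "bump P" "\<lambda>_. 0" t 0]
      by (simp add: bump_def)
  next
    case f2: False
    then have t: "0 < t" using False by simp
    have "((\<lambda>t. poly P (1 / t) * exp (- 1 / t)) has_real_derivative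
        bump ([:0, 0, 1:] * (P - pderiv P)) t) (at t)"
    proof (rule DERIV_cong)
      have p: "((\<lambda>t. poly P (1 / t)) has_real_derivative poly (pderiv P) (1 / t) * (- (1 / t\<^sup>2))) (at t)"
        using t by (intro DERIV_chain2[OF poly_DERIV])
          (auto intro!: derivative_eq_intros simp: power2_eq_square)
      have e: "((\<lambda>t. exp (- 1 / t)) has_real_derivative exp (- 1 / t) * (1 / t\<^sup>2)) (at t)"
        using t by (auto intro!: derivative_eq_intros simp: power2_eq_square)
      show "((\<lambda>t. poly P (1 / t) * exp (- 1 / t)) has_real_derivative
          poly (pderiv P) (1 / t) * (- (1 / t\<^sup>2)) * exp (- 1 / t) +
          exp (- 1 / t) * (1 / t\<^sup>2) * poly P (1 / t)) (at t)"
        by (rule DERIV_mult[OF p e])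
      show "poly (pderiv P) (1 / t) * (- (1 / t\<^sup>2)) * exp (- 1 / t) +
          exp (- 1 / t) * (1 / t\<^sup>2) * poly P (1 / t) = bump ([:0, 0, 1:] * (P - pderiv P)) t"
        using t by (simp add: bump_def power2_eq_square field_simps)
    qed
    moreover have "\<forall>\<^sub>F s in nhds t. bump P s = poly P (1 / s) * exp (- 1 / s)"
      using eventually_nhds_in_open[of "{0<..}" t] t
      by (auto simp: bump_def elim!: eventually_mono)
    ultimately show ?thesis
      using DERIV_cong_ev[OF refl _ refl, of "bump P" "\<lambda>t. poly P (1 / t) * exp (- 1 / t)" t] by simp
  qed
next
  case True
  have "((\<lambda>s. (bump P s - bump P 0) / (s - 0)) \<longlongrightarrow> 0) (at 0)"
  proof (rule filterlim_split_at)
    show "((\<lambda>s. (bump P s - bump P 0) / (s - 0)) \<longlongrightarrow> 0) (at_left 0)"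
      by (rule tendsto_eventually) (auto simp: bump_def eventually_at_filter)
    \<comment> \<open>Division by \<open>s\<close> multiplies the polynomial by u, hence
      \<open>[:0, 1:]\<close>, so the difference quotient at 0 is again covered by
      \<open>bump_limit\<close>.\<close>
    have "((\<lambda>t. poly ([:0, 1:] * P) (1 / t) * exp (- 1 / t)) \<longlongrightarrow> 0) (at_right (0::real))"
      by (rule bump_limit)
    moreover have "\<forall>\<^sub>F s in at_right 0. poly ([:0, 1:] * P) (1 / s) * exp (- 1 / s) =
        (bump P s - bump P 0) / (s - 0)"
      by (auto simp: bump_def eventually_at_filter)
    ultimately show "((\<lambda>s. (bump P s - bump P 0) / (s - 0)) \<longlongrightarrow> 0) (at_right 0)"
      by (rule Lim_transform_eventually)
  qed
  then show ?thesis unfolding True has_field_derivative_iff by (simp add: bump_def)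
qed

text \<open>A class of functions that is closed under partial derivatives consists of smooth functions.\<close>

inductive elementary :: "(real^'n \<Rightarrow> real) \<Rightarrow> bool" where
  const: "elementary (\<lambda>x. a)"
| bump: "elementary (\<lambda>x. bump P (\<alpha> * x $ i + \<beta>))"
| add: "elementary f \<Longrightarrow> elementary g \<Longrightarrow> elementary (\<lambda>x. f x + g x)"
| mult: "elementary f \<Longrightarrow> elementary g \<Longrightarrow> elementary (\<lambda>x. f x * g x)"
| exp: "elementary f \<Longrightarrow> elementary (\<lambda>x. exp (f x))"

lemma elementary_derivative:
  assumes "elementary f"
  shows "\<exists>G. (\<forall>x. (f has_derivative (\<lambda>v. G x \<bullet> v)) (at x)) \<and> (\<forall>i. elementary (\<lambda>x. G x $ i))"
  using assms
proof induction
  case (const a)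
  show ?case by (rule exI[of _ "\<lambda>_. 0"]) (auto intro: elementary.const)
next
  case (bump P \<alpha> i \<beta>)
  let ?Q = "[:0, 0, 1:] * (P - pderiv P)"
  let ?G = "\<lambda>x. axis i (\<alpha> * bump ?Q (\<alpha> * x $ i + \<beta>))"
  have "((\<lambda>x. bump P (\<alpha> * x $ i + \<beta>)) has_derivative (\<lambda>v. ?G x \<bullet> v)) (at x)" for x
  proof (rule has_derivative_eq_rhs)
    show "((\<lambda>x. bump P (\<alpha> * x $ i + \<beta>)) has_derivative (\<lambda>v. bump ?Q (\<alpha> * x $ i + \<beta>) * (\<alpha> * v $ i))) (at x)"
    proof (rule has_derivative_compose[where g = "bump P" and g' = "(*) (bump ?Q (\<alpha> * x $ i + \<beta>))"
          and f' = "\<lambda>v. \<alpha> * v $ i"])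
      show "((\<lambda>x. \<alpha> * x $ i + \<beta>) has_derivative (\<lambda>v. \<alpha> * v $ i)) (at x)"
        by (auto intro!: derivative_eq_intros bounded_linear.has_derivative[OF bounded_linear_vec_nth])
      show "(bump P has_derivative (*) (bump ?Q (\<alpha> * x $ i + \<beta>))) (at (\<alpha> * x $ i + \<beta>))"
        using bump_deriv unfolding has_field_derivative_def .
    qed
    show "(\<lambda>v. bump ?Q (\<alpha> * x $ i + \<beta>) * (\<alpha> * v $ i)) = (\<lambda>v. ?G x \<bullet> v)"
      by (simp add: fun_eq_iff inner_axis' algebra_simps)
  qed
  moreover have "elementary (\<lambda>x. ?G x $ j)" for j
  proof (cases "j = i")
    case True
    have "elementary (\<lambda>x. \<alpha> * bump ?Q (\<alpha> * x $ i + \<beta>))"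
      by (intro elementary.mult elementary.const elementary.bump)
    then show ?thesis using True by (simp add: axis_def)
  qed (simp add: axis_def elementary.const)
  ultimately show ?case by (intro exI[of _ ?G]) blast
next
  case (add f g)
  then obtain F G where F: "\<And>x. (f has_derivative (\<lambda>v. F x \<bullet> v)) (at x)" "\<And>i. elementary (\<lambda>x. F x $ i)"
    and G: "\<And>x. (g has_derivative (\<lambda>v. G x \<bullet> v)) (at x)" "\<And>i. elementary (\<lambda>x. G x $ i)" by blast
  have "((\<lambda>x. f x + g x) has_derivative (\<lambda>v. (F x + G x) \<bullet> v)) (at x)" for x
    unfolding inner_add_left by (rule has_derivative_add[OF F(1) G(1)])
  then show ?case using F(2) G(2)
    by (intro exI[of _ "\<lambda>x. F x + G x"]) (auto intro: elementary.add)
next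
  case (mult f g)
  then obtain F G where F: "\<And>x. (f has_derivative (\<lambda>v. F x \<bullet> v)) (at x)" "\<And>i. elementary (\<lambda>x. F x $ i)"
    and G: "\<And>x. (g has_derivative (\<lambda>v. G x \<bullet> v)) (at x)" "\<And>i. elementary (\<lambda>x. G x $ i)" by blast
  have "((\<lambda>x. f x * g x) has_derivative (\<lambda>v. (f x *\<^sub>R G x + g x *\<^sub>R F x) \<bullet> v)) (at x)" for x
    by (rule has_derivative_eq_rhs[OF has_derivative_mult[OF F(1) G(1)]])
      (simp add: fun_eq_iff inner_add_left)
  then show ?case using F(2) G(2) mult.hyps
    by (intro exI[of _ "\<lambda>x. f x *\<^sub>R G x + g x *\<^sub>R F x"]) (auto intro!: elementary.add elementary.mult)
next
  case (exp f)
  then obtain F where F: "\<And>x. (f has_derivative (\<lambda>v. F x \<bullet> v)) (at x)" "\<And>i. elementary (\<lambda>x. F x $ i)"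
    by blast
  have "((\<lambda>x. exp (f x)) has_derivative (\<lambda>v. (exp (f x) *\<^sub>R F x) \<bullet> v)) (at x)" for x
    by (rule has_derivative_eq_rhs[OF has_derivative_exp[OF F(1)]]) (simp add: fun_eq_iff)
  then show ?case using F(2) exp.hyps
    by (intro exI[of _ "\<lambda>x. exp (f x) *\<^sub>R F x"]) (auto intro!: elementary.mult elementary.exp)
qed

lemma elementary_C_diff: "elementary f \<Longrightarrow> C_diff k f"
proof (induction k arbitrary: f)
  case 0
  then obtain G where "\<And>x. (f has_derivative (\<lambda>v. G x \<bullet> v)) (at x)" using elementary_derivative by blast
  then show ?case by (auto intro!: continuous_at_imp_continuous_on has_derivative_continuous)
next
  case (Suc k)
  then obtain G where G: "\<And>x. (f has_derivative (\<lambda>v. G x \<bullet> v)) (at x)" "\<And>i. elementary (\<lambda>x. G x $ i)"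
    using elementary_derivative by blast
  have "partial_deriv i f = (\<lambda>x. G x $ i)" for i using gradient_eq(1)[OF G(1)] by blast
  moreover have "f differentiable_on UNIV"
    using G(1) by (auto simp: differentiable_on_def differentiable_def)
  ultimately show ?case using Suc.IH G(2) by simp
qed

lemma elementary_sum: "finite A \<Longrightarrow> (\<And>a. a \<in> A \<Longrightarrow> elementary (f a)) \<Longrightarrow> elementary (\<lambda>x. \<Sum>a\<in>A. f a x)"
  by (induction A rule: finite_induct) (auto intro: elementary.const elementary.add)

lemma elementary_prod: "finite A \<Longrightarrow> (\<And>a. a \<in> A \<Longrightarrow> elementary (f a)) \<Longrightarrow> elementary (\<lambda>x. \<Prod>a\<in>A. f a x)"
  by (induction A rule: finite_induct) (auto intro: elementary.const elementary.mult)

lemma box_bump: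
  fixes l u :: "real^'n"
  obtains \<psi> where "elementary \<psi>" "\<And>x. 0 \<le> \<psi> x" "\<And>x. x \<in> box l u \<Longrightarrow> 0 < \<psi> x" "\<And>x. x \<notin> box l u \<Longrightarrow> \<psi> x = 0"
proof -
  let ?b = "bump 1"
  have b: "0 \<le> ?b t" "0 < ?b t \<longleftrightarrow> 0 < t" "?b t = 0 \<longleftrightarrow> t \<le> 0" for t by (auto simp: bump_def)
  \<comment> \<open>In each coordinate one factor is positive to the right of \<open>l $ i\<close>
    and the other to the left of \<open>u $ i\<close>. The explicit coefficients 1 and -1 match the
    constructor \<open>bump\<close> of \<open>elementary\<close>.\<close>
  define \<psi> where "\<psi> x = (\<Prod>i\<in>UNIV. ?b (1 * x $ i + (- (l $ i))) * ?b ((-1) * x $ i + u $ i))" for x :: "real^'n"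
  show thesis
  proof (rule that[of \<psi>])
    show "elementary \<psi>"
      unfolding \<psi>_def by (intro elementary_prod elementary.mult elementary.bump) simp
    fix x
    show "0 \<le> \<psi> x" unfolding \<psi>_def by (intro prod_nonneg mult_nonneg_nonneg b(1) ballI)
    show "0 < \<psi> x" if "x \<in> box l u"
      unfolding \<psi>_def using that by (intro prod_pos ballI mult_pos_pos) (auto simp: b mem_box_cart)
    show "\<psi> x = 0" if "x \<notin> box l u"
      using that by (auto simp: \<psi>_def mem_box_cart b not_less)
  qed
qed

text \<open>The set is a countable union of open boxes whose closures lie in it. With
  \<open>S k\<close> the sum of the first bumps, 1 - exp(-k S_k) lies between 0 and 1, vanishes off
  a compact subset, and tends to 1 wherever one bump is positive. For this construction
  \<open>elementary\<close> is closed under \<open>exp\<close>.\<close>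

lemma cutoff_functions:
  fixes K :: "(real^'n) set"
  assumes K: "open K" "K \<noteq> {}"
  obtains \<phi> where "\<And>k::nat. \<phi> k \<in> test_functions K" "\<And>k x. 0 \<le> \<phi> k x" "\<And>k x. \<phi> k x \<le> 1"
    "\<And>x. x \<in> K \<Longrightarrow> (\<lambda>k. \<phi> k x) \<longlonglongrightarrow> 1" "\<And>k x. x \<notin> K \<Longrightarrow> \<phi> k x = 0"
proof -
  \<comment> \<open>The closed box is required to lie in \<open>K\<close>, so that finite unions of
    closed boxes serve as compact supports.\<close>
  define \<F> where "\<F> = {X. \<exists>l u. X = box l u \<and> cbox l u \<subseteq> K}"
  have UF: "\<Union>\<F> = K"
  proof (intro equalityI subsetI)
    fix x assume "x \<in> K"
    then obtain l u where "x \<in> box l u" "cbox l u \<subseteq> K" using open_contains_cbox K(1) by metis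
    then show "x \<in> \<Union>\<F>" by (auto simp: \<F>_def)
  qed (use box_subset_cbox in \<open>auto simp: \<F>_def\<close>)
  have "\<And>S. S \<in> \<F> \<Longrightarrow> open S" by (auto simp: \<F>_def open_box)
  from Lindelof[OF this] obtain \<F>' where F': "\<F>' \<subseteq> \<F>" "countable \<F>'" "\<Union>\<F>' = \<Union>\<F>" by blast
  then have ne: "\<F>' \<noteq> {}" using UF K(2) by auto
  \<comment> \<open>The enumeration may repeat boxes, which merely counts some bumps several
    times.\<close>
  define X where "X = from_nat_into \<F>'"
  have X: "X j \<in> \<F>" for j using from_nat_into[OF ne] F'(1) by (auto simp: X_def)
  then obtain l u where lu: "\<And>j. X j = box (l j) (u j)" "\<And>j. cbox (l j) (u j) \<subseteq> K"
    unfolding \<F>_def mem_Collect_eq by metis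
  have cover: "\<exists>j. x \<in> X j" if "x \<in> K" for x
    using that UF F'(3) from_nat_into_surj[OF F'(2)] by (metis UnionE X_def)
  have "\<exists>\<psi>. elementary \<psi> \<and> (\<forall>x. 0 \<le> \<psi> x) \<and> (\<forall>x\<in>X j. 0 < \<psi> x) \<and> (\<forall>x. x \<notin> X j \<longrightarrow> \<psi> x = 0)" for j
    unfolding lu(1) using box_bump[of "l j" "u j"] by metis
  then obtain \<psi> where \<psi>: "\<And>j. elementary (\<psi> j)" "\<And>j x. 0 \<le> \<psi> j x" "\<And>j x. x \<in> X j \<Longrightarrow> 0 < \<psi> j x"
    "\<And>j x. x \<notin> X j \<Longrightarrow> \<psi> j x = 0" by metis
  define S where "S k x = (\<Sum>j\<le>k. \<psi> j x)" for k :: nat and x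
  have S0: "0 \<le> S k x" for k x unfolding S_def by (intro sum_nonneg \<psi>(2))
  have Sout: "S k x = 0" if "x \<notin> (\<Union>j\<le>k. cbox (l j) (u j))" for k x
    unfolding S_def using that box_subset_cbox by (intro sum.neutral ballI \<psi>(4)) (auto simp: lu(1))
  define \<phi> where "\<phi> k x = 1 + (-1) * exp ((- real k) * S k x)" for k x
  show thesis
  proof (rule that[of \<phi>])
    fix k x
    show "0 \<le> \<phi> k x" "\<phi> k x \<le> 1" using S0[of k x] by (auto simp: \<phi>_def)
    show "\<phi> k x = 0" if "x \<notin> K"
      using Sout[of x k] lu(2) that by (auto simp: \<phi>_def)
    have "elementary (\<phi> k)" unfolding \<phi>_def S_def
      by (intro elementary.add elementary.const elementary.mult elementary.exp elementary_sum \<psi>(1)) simp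
    moreover have "\<exists>C. compact C \<and> C \<subseteq> K \<and> (\<forall>x. x \<notin> C \<longrightarrow> \<phi> k x = 0)"
    proof (intro exI conjI allI impI)
      show "compact (\<Union>j\<le>k. cbox (l j) (u j))" by (intro compact_UN) auto
      show "(\<Union>j\<le>k. cbox (l j) (u j)) \<subseteq> K" using lu(2) by blast
      show "\<phi> k x = 0" if "x \<notin> (\<Union>j\<le>k. cbox (l j) (u j))" for x using Sout[OF that] by (simp add: \<phi>_def)
    qed
    ultimately show "\<phi> k \<in> test_functions K" by (simp add: test_functions_def elementary_C_diff)
  next
    fix x assume "x \<in> K"
    then obtain j where j: "x \<in> X j" using cover by blast
    have expto0: "(\<lambda>k. exp (- (real k * \<psi> j x))) \<longlonglongrightarrow> 0"
    proof -
      have "filterlim (\<lambda>k. real k * \<psi> j x) at_top sequentially"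
        by (rule filterlim_at_top_mult_tendsto_pos[OF tendsto_const _ filterlim_real_sequentially, where c = "\<psi> j x", unfolded mult.commute[of "\<psi> j x"]])
          (rule \<psi>(3)[OF j])
      then have "filterlim (\<lambda>k. - (real k * \<psi> j x)) at_bot sequentially"
        by (simp add: filterlim_uminus_at_top[symmetric])
      then show ?thesis by (rule filterlim_compose[OF exp_at_bot])
    qed
    \<comment> \<open>One bump that is positive at \<open>x\<close> is enough: from index
      \<open>j\<close> on it is a summand of \<open>S k x\<close>, and the others are
      nonnegative.\<close>
    have lex: "\<forall>\<^sub>F k in sequentially. exp ((- real k) * S k x) \<le> exp (- (real k * \<psi> j x))"
      using eventually_ge_at_top[of j]
    proof eventually_elim
      case (elim k)
      have "\<psi> j x \<le> S k x" unfolding S_def using elim \<psi>(2) by (intro member_le_sum) auto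
      then show ?case by (simp add: mult_left_mono)
    qed
    have "(\<lambda>k. exp ((- real k) * S k x)) \<longlonglongrightarrow> 0"
      by (rule tendsto_sandwich[OF _ lex tendsto_const expto0]) (rule always_eventually, simp)
    then have "(\<lambda>k. 1 + (-1) * exp ((- real k) * S k x)) \<longlonglongrightarrow> 1 + (-1) * 0" by (intro tendsto_intros)
    then show "(\<lambda>k. \<phi> k x) \<longlonglongrightarrow> 1" by (simp add: \<phi>_def)
  qed
qed

section \<open>Cell integrals of a weak divergence\<close>

lemma L2_on_set_integrable:
  fixes f :: "real^'n \<Rightarrow> real"
  assumes f: "L2_on S f" and S: "S \<in> sets lebesgue" "bounded S"
  shows "set_integrable lebesgue S f"
proof -
  have fin: "emeasure lebesgue S < \<infinity>"
    using fmeasurableD2[OF bounded_set_imp_lmeasurable[OF S(2,1)]] by (simp only: infinity_ennreal_def top.not_eq_extremum)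
  have "integrable (lebesgue_on S) (\<lambda>x. 1 + (norm (f x))\<^sup>2)"
  proof (rule Bochner_Integration.integrable_add)
    show "integrable (lebesgue_on S) (\<lambda>x. 1::real)"
    proof -
      have "integrable lebesgue (\<lambda>x. indicator S x :: real)"
        using fin S(1) by (intro integrable_real_indicator)
      then show ?thesis using S(1) by (simp add: integrable_restrict_space)
    qed
  qed (use f in \<open>simp add: L2_on_def\<close>)
  then have "integrable (lebesgue_on S) f"
  proof (rule Bochner_Integration.integrable_bound)
    show "f \<in> borel_measurable (lebesgue_on S)" using f by (simp add: L2_on_def)
    have "\<bar>t\<bar> \<le> 1 + t\<^sup>2" for t :: real
      using zero_le_power2[of "\<bar>t\<bar> - 1/2"] by (simp add: power2_eq_square algebra_simps)
    then show "AE x in lebesgue_on S. norm (f x) \<le> norm (1 + (norm (f x))\<^sup>2)" by simp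
  qed
  then show ?thesis
    using S(1) by (simp add: integrable_restrict_space set_integrable_def)
qed

text \<open>The formulation multiplies the divergence by functions that are constant on cells, so
  uniqueness is stated for integrals over cells. Both candidates are tested with functions supported
  in \<open>K\<close> that converge to its indicator; the candidate itself dominates.\<close>

lemma has_weak_div_cell_integral:
  fixes u :: "real^'n \<Rightarrow> real^'n"
  assumes g1: "has_weak_div \<Omega> u g1" and g2: "has_weak_div \<Omega> u g2"
    and \<Omega>: "open \<Omega>" "bounded \<Omega>" and K: "open K" "K \<subseteq> \<Omega>"
  shows "(LINT x:K|lebesgue. g1 x) = (LINT x:K|lebesgue. g2 x)"
proof (cases "K = {}")
  case False
  have \<Omega>m: "\<Omega> \<in> sets lebesgue" using \<Omega>(1) by auto
  obtain \<phi> where \<phi>: "\<And>k::nat. \<phi> k \<in> test_functions K" "\<And>k x. 0 \<le> \<phi> k x" "\<And>k x. \<phi> k x \<le> 1"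
    "\<And>x. x \<in> K \<Longrightarrow> (\<lambda>k. \<phi> k x) \<longlonglongrightarrow> 1" "\<And>k x. x \<notin> K \<Longrightarrow> \<phi> k x = 0"
    using cutoff_functions[OF K(1) False] by blast
  have \<phi>\<Omega>: "\<phi> k \<in> test_functions \<Omega>" for k
    using \<phi>(1)[of k] K(2) by (auto simp: test_functions_def)
  have lim: "(\<lambda>k. LINT x:\<Omega>|lebesgue. g x * \<phi> k x) \<longlonglongrightarrow> (LINT x:K|lebesgue. g x)"
    if g: "has_weak_div \<Omega> u g" for g
  proof -
    have gi: "integrable lebesgue (\<lambda>x. indicator \<Omega> x *\<^sub>R g x)"
      using L2_on_set_integrable[OF _ \<Omega>m \<Omega>(2)] g by (simp add: has_weak_div_def set_integrable_def)
    have mK: "(\<lambda>x. indicator K x *\<^sub>R g x) \<in> borel_measurable lebesgue"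
    proof -
      have "(\<lambda>x. indicator K x *\<^sub>R (indicator \<Omega> x *\<^sub>R g x)) \<in> borel_measurable lebesgue"
        using K(1) by (intro borel_measurable_scaleR[OF _ borel_measurable_integrable[OF gi]]
          borel_measurable_indicator) auto
      moreover have "(\<lambda>x. indicator K x *\<^sub>R (indicator \<Omega> x *\<^sub>R g x)) = (\<lambda>x. indicator K x *\<^sub>R g x)"
        using K(2) by (auto simp: indicator_def fun_eq_iff)
      ultimately show ?thesis by (simp only:)
    qed
    have m\<phi>: "\<phi> k \<in> borel_measurable lebesgue" for k
    proof -
      have "C_diff 0 (\<phi> k)" using \<phi>(1)[of k] unfolding test_functions_def by blast
      then show ?thesis by (auto intro!: measurable_completion borel_measurable_continuous_onI)
    qed
    show ?thesis unfolding set_lebesgue_integral_def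
    proof (rule integral_dominated_convergence[where w = "\<lambda>x. norm (indicator \<Omega> x *\<^sub>R g x)"])
      show "(\<lambda>x. indicator K x *\<^sub>R g x) \<in> borel_measurable lebesgue" by (rule mK)
      show "integrable lebesgue (\<lambda>x. norm (indicator \<Omega> x *\<^sub>R g x))" using gi by (rule integrable_norm)
      show "AE x in lebesgue. (\<lambda>k. indicator \<Omega> x *\<^sub>R (g x * \<phi> k x)) \<longlonglongrightarrow> indicator K x *\<^sub>R g x"
      proof (rule AE_I2)
        fix x
        show "(\<lambda>k. indicator \<Omega> x *\<^sub>R (g x * \<phi> k x)) \<longlonglongrightarrow> indicator K x *\<^sub>R g x"
        proof (cases "x \<in> K")
          case True
          have "(\<lambda>k. g x * \<phi> k x) \<longlonglongrightarrow> g x * 1" by (intro tendsto_intros \<phi>(4) True)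
          then show ?thesis using True K(2) by (auto simp: indicator_def)
        next
          case False
          then show ?thesis using \<phi>(5) by simp
        qed
      qed
      fix k
      have "(\<lambda>x. (indicator \<Omega> x *\<^sub>R g x) * \<phi> k x) \<in> borel_measurable lebesgue"
        by (rule borel_measurable_times[OF borel_measurable_integrable[OF gi] m\<phi>])
      then show "(\<lambda>x. indicator \<Omega> x *\<^sub>R (g x * \<phi> k x)) \<in> borel_measurable lebesgue"
        by (simp add: mult.assoc)
      show "AE x in lebesgue. norm (indicator \<Omega> x *\<^sub>R (g x * \<phi> k x)) \<le> norm (indicator \<Omega> x *\<^sub>R g x)"
      proof (rule AE_I2)
        fix x
        have "norm (indicator \<Omega> x *\<^sub>R (g x * \<phi> k x)) = norm (indicator \<Omega> x *\<^sub>R g x) * \<bar>\<phi> k x\<bar>"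
          by (simp add: abs_mult)
        also have "\<dots> \<le> norm (indicator \<Omega> x *\<^sub>R g x) * 1"
          using \<phi>(2,3)[of k x] by (intro mult_left_mono) auto
        finally show "norm (indicator \<Omega> x *\<^sub>R (g x * \<phi> k x)) \<le> norm (indicator \<Omega> x *\<^sub>R g x)" by simp
      qed
    qed
  qed
  have "(LINT x:\<Omega>|lebesgue. g1 x * \<phi> k x) = (LINT x:\<Omega>|lebesgue. g2 x * \<phi> k x)" for k
  proof -
    have "(LINT x:\<Omega>|lebesgue. g x * \<phi> k x) = - (LINT x:\<Omega>|lebesgue. u x \<bullet> gradient (\<phi> k) x)"
      if "has_weak_div \<Omega> u g" for g
    proof -
      from that have "\<forall>\<phi>\<in>test_functions \<Omega>.
          (LINT x:\<Omega>|lebesgue. u x \<bullet> gradient \<phi> x) = - (LINT x:\<Omega>|lebesgue. g x * \<phi> x)"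
        unfolding has_weak_div_def by (elim conjE)
      from bspec[OF this \<phi>\<Omega>[of k]] show ?thesis by linarith
    qed
    from this[OF g1] this[OF g2] show ?thesis by linarith
  qed
  then have "(\<lambda>k. LINT x:\<Omega>|lebesgue. g1 x * \<phi> k x) = (\<lambda>k. LINT x:\<Omega>|lebesgue. g2 x * \<phi> k x)"
    by (rule ext)
  from LIMSEQ_unique[OF lim[OF g1, unfolded this] lim[OF g2]] show ?thesis .
qed (simp add: set_lebesgue_integral_def)

section \<open>The local bilinear form\<close>

lemma matrix_inv_mult:
  fixes A :: "real^'n^'n"
  assumes "\<And>x. A *v x = 0 \<Longrightarrow> x = 0"
  shows "A *v (matrix_inv A *v x) = x" and "matrix_inv A *v (A *v x) = x"
proof -
  have "invertible A" using assms by (simp add: invertible_left_inverse matrix_left_invertible_ker)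
  then have "A ** matrix_inv A = mat 1 \<and> matrix_inv A ** A = mat 1"
    unfolding invertible_def matrix_inv_def by (rule someI_ex)
  then show "A *v (matrix_inv A *v x) = x" and "matrix_inv A *v (A *v x) = x"
    by (simp_all add: matrix_vector_mul_assoc)
qed

text \<open>Unit vectors of the local flux space. Multiplied by weights depending on the cell, they
  also give the global test fluxes through a single face.\<close>

definition unit_flux :: "(real^'n) set \<Rightarrow> (real^'n) set \<Rightarrow> real" where
  "unit_flux \<sigma> \<tau> = (if \<tau> = \<sigma> then 1 else 0)"

text \<open>\<open>A\<close> stands for the mean tensor of the cell, of which only symmetry and
  positive definiteness matter. The local objects of the scheme are restated for this fixed tensor,
  and the locale \<open>mesh\<close> identifies them with the global definitions.\<close>

locale diffusion_cell = star_cell K c E for K :: "(real^'n) set" and c E +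
  fixes A :: "real^'n^'n"
  assumes A_sym: "\<And>x y. (A *v x) \<bullet> y = (A *v y) \<bullet> x"
    and A_pos: "\<And>x. x \<noteq> 0 \<Longrightarrow> 0 < (A *v x) \<bullet> x"
begin

lemma A_ker: "A *v x = 0 \<Longrightarrow> x = 0"
  using A_pos[of x] by force

lemma A_inv: "A *v (matrix_inv A *v x) = x" "matrix_inv A *v (A *v x) = x"
  by (rule matrix_inv_mult, erule A_ker)+

lemma A_inj: "A *v x = A *v y \<Longrightarrow> x = y"
  using A_inv(2) by metis

definition grad :: "((real^'n) set \<Rightarrow> real) \<Rightarrow> real^'n" where
  "grad f = (THE v. measure lebesgue K *\<^sub>R (A *v v) =
     - (\<Sum>\<sigma>\<in>E. (face_area \<sigma> * f \<sigma>) *\<^sub>R (face_center \<sigma> - c)))"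

definition residual :: "((real^'n) set \<Rightarrow> real) \<Rightarrow> (real^'n) set \<Rightarrow> real" where
  "residual f \<sigma> = f \<sigma> + (A *v grad f) \<bullet> outward_normal K \<sigma>"

definition gam :: "(real^'n) set \<Rightarrow> real" where
  "gam \<sigma> = (LINT x:face_cone c \<sigma>|lebesgue.
     (matrix_inv A *v ((1 / d \<sigma>) *\<^sub>R (x - c))) \<bullet> ((1 / d \<sigma>) *\<^sub>R (x - c)))"

definition flux :: "((real^'n) set \<Rightarrow> real) \<Rightarrow> (real^'n) set \<Rightarrow> real^'n \<Rightarrow> real^'n" where
  "flux f \<sigma> x = - (A *v grad f) + residual f \<sigma> *\<^sub>R ((1 / d \<sigma>) *\<^sub>R (x - c))"

text \<open>The left-hand side of the local equation for the diagonal matrix, with the unknown flux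
  first and the test flux second.\<close>

definition form :: "((real^'n) set \<Rightarrow> real) \<Rightarrow> ((real^'n) set \<Rightarrow> real) \<Rightarrow> real" where
  "form f f' = measure lebesgue K * (grad f \<bullet> (A *v grad f')) +
     (\<Sum>\<sigma>\<in>E. residual f' \<sigma> * gam \<sigma> * residual f \<sigma>)"

lemma grad_eqI:
  assumes "measure lebesgue K *\<^sub>R (A *v v) = - (\<Sum>\<sigma>\<in>E. (face_area \<sigma> * f \<sigma>) *\<^sub>R (face_center \<sigma> - c))"
  shows "grad f = v"
  unfolding grad_def assms[symmetric]
proof (rule the_equality)
  fix w assume "measure lebesgue K *\<^sub>R (A *v w) = measure lebesgue K *\<^sub>R (A *v v)"
  then show "w = v" using measure_pos by (auto intro: A_inj)
qed simp

lemma grad: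
  "measure lebesgue K *\<^sub>R (A *v grad f) = - (\<Sum>\<sigma>\<in>E. (face_area \<sigma> * f \<sigma>) *\<^sub>R (face_center \<sigma> - c))"
    (is "_ = ?r")
proof -
  have "measure lebesgue K *\<^sub>R (A *v (matrix_inv A *v ((1 / measure lebesgue K) *\<^sub>R ?r))) = ?r"
    unfolding A_inv(1) using measure_pos by simp
  from grad_eqI[OF this] this show ?thesis by simp
qed

lemma grad_inner:
  "measure lebesgue K * ((A *v grad f) \<bullet> e) =
    - (\<Sum>\<sigma>\<in>E. face_area \<sigma> * f \<sigma> * ((face_center \<sigma> - c) \<bullet> e))"
  using arg_cong[OF grad[of f], of "\<lambda>v. v \<bullet> e"] by (simp add: inner_sum_left)

lemma sum_unit_flux: "\<sigma> \<in> E \<Longrightarrow> (\<Sum>\<tau>\<in>E. f \<tau> * unit_flux \<tau> \<sigma>) = f \<sigma>"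
proof -
  assume "\<sigma> \<in> E"
  have "(\<Sum>\<tau>\<in>E. f \<tau> * unit_flux \<tau> \<sigma>) = (\<Sum>\<tau>\<in>E. if \<tau> = \<sigma> then f \<sigma> else 0)"
    by (intro sum.cong) (auto simp: unit_flux_def)
  then show ?thesis using finite_faces \<open>\<sigma> \<in> E\<close> by simp
qed

text \<open>Linearity is put as an expansion in unit fluxes: the sum runs over the faces of the cell
  only, so values at all other sets drop out at the same time.\<close>

lemma grad_expansion: "grad f = (\<Sum>\<tau>\<in>E. f \<tau> *\<^sub>R grad (unit_flux \<tau>))"
proof (rule grad_eqI)
  have "measure lebesgue K *\<^sub>R (A *v (\<Sum>\<tau>\<in>E. f \<tau> *\<^sub>R grad (unit_flux \<tau>))) =
      (\<Sum>\<tau>\<in>E. f \<tau> *\<^sub>R (measure lebesgue K *\<^sub>R (A *v grad (unit_flux \<tau>))))"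
    by (simp add: linear_sum[OF matrix_vector_mul_linear] matrix_vector_mult_scaleR scaleR_sum_right mult.commute)
  also have "\<dots> = (\<Sum>\<tau>\<in>E. - ((face_area \<tau> * f \<tau>) *\<^sub>R (face_center \<tau> - c)))"
  proof (rule sum.cong[OF refl])
    fix \<tau> assume "\<tau> \<in> E"
    have "(\<Sum>\<sigma>\<in>E. (face_area \<sigma> * unit_flux \<tau> \<sigma>) *\<^sub>R (face_center \<sigma> - c)) =
        (\<Sum>\<sigma>\<in>E. if \<sigma> = \<tau> then face_area \<tau> *\<^sub>R (face_center \<tau> - c) else 0)"
      by (intro sum.cong) (auto simp: unit_flux_def)
    also have "\<dots> = face_area \<tau> *\<^sub>R (face_center \<tau> - c)" using finite_faces \<open>\<tau> \<in> E\<close> by simp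
    finally show "f \<tau> *\<^sub>R (measure lebesgue K *\<^sub>R (A *v grad (unit_flux \<tau>))) =
        - ((face_area \<tau> * f \<tau>) *\<^sub>R (face_center \<tau> - c))"
      unfolding grad by (simp add: mult.commute)
  qed
  finally show "measure lebesgue K *\<^sub>R (A *v (\<Sum>\<tau>\<in>E. f \<tau> *\<^sub>R grad (unit_flux \<tau>))) =
      - (\<Sum>\<sigma>\<in>E. (face_area \<sigma> * f \<sigma>) *\<^sub>R (face_center \<sigma> - c))" by (simp add: sum_negf)
qed

lemma residual_expansion:
  assumes "\<sigma> \<in> E" shows "residual f \<sigma> = (\<Sum>\<tau>\<in>E. f \<tau> * residual (unit_flux \<tau>) \<sigma>)"
proof -
  have "A *v grad f = (\<Sum>\<tau>\<in>E. f \<tau> *\<^sub>R (A *v grad (unit_flux \<tau>)))"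
    by (subst grad_expansion) (simp add: linear_sum[OF matrix_vector_mul_linear] matrix_vector_mult_scaleR)
  then show ?thesis
    by (simp add: residual_def distrib_left sum.distrib sum_unit_flux[OF assms] inner_sum_left)
qed

text \<open>It reduces a local equation to unit fluxes, that is, to one number per face.\<close>

lemma form_expansion: "form f f' = (\<Sum>\<tau>\<in>E. f' \<tau> * form f (unit_flux \<tau>))"
proof -
  have 1: "measure lebesgue K * (grad f \<bullet> (A *v grad f')) =
      (\<Sum>\<tau>\<in>E. f' \<tau> * (measure lebesgue K * (grad f \<bullet> (A *v grad (unit_flux \<tau>)))))"
    by (subst (2) grad_expansion)
      (simp add: linear_sum[OF matrix_vector_mul_linear] matrix_vector_mult_scaleR inner_sum_right
        sum_distrib_left mult_ac)
  have "(\<Sum>\<sigma>\<in>E. residual f' \<sigma> * gam \<sigma> * residual f \<sigma>) =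
      (\<Sum>\<sigma>\<in>E. \<Sum>\<tau>\<in>E. f' \<tau> * (residual (unit_flux \<tau>) \<sigma> * gam \<sigma> * residual f \<sigma>))"
    by (intro sum.cong refl, subst residual_expansion[of _ f'])
      (simp_all add: sum_distrib_left sum_distrib_right mult_ac)
  also have "\<dots> = (\<Sum>\<tau>\<in>E. f' \<tau> * (\<Sum>\<sigma>\<in>E. residual (unit_flux \<tau>) \<sigma> * gam \<sigma> * residual f \<sigma>))"
    by (subst sum.swap) (simp add: sum_distrib_left)
  finally show ?thesis by (simp add: form_def 1 distrib_left sum.distrib)
qed

lemma residual_normal: "\<sigma> \<in> E \<Longrightarrow> residual f \<sigma> = f \<sigma> + N \<sigma> \<bullet> (A *v grad f)"
  by (simp add: residual_def outward_normal_eq inner_commute)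

text \<open>By \<open>sum_normals_moment\<close> the normal part of the residual contributes |K|
  times \<open>(A *v grad f) \<bullet> e\<close>, and the defining equation of \<open>grad\<close>
  makes the remaining part its negative.\<close>

lemma residual_moment: "(\<Sum>\<sigma>\<in>E. residual f \<sigma> * (face_area \<sigma> * ((face_center \<sigma> - c) \<bullet> e))) = 0"
proof -
  have "(\<Sum>\<sigma>\<in>E. residual f \<sigma> * (face_area \<sigma> * ((face_center \<sigma> - c) \<bullet> e))) =
      (\<Sum>\<sigma>\<in>E. face_area \<sigma> * f \<sigma> * ((face_center \<sigma> - c) \<bullet> e)) +
      (\<Sum>\<sigma>\<in>E. face_area \<sigma> * (N \<sigma> \<bullet> (A *v grad f)) * ((face_center \<sigma> - c) \<bullet> e))"
    unfolding sum.distrib[symmetric]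
    by (intro sum.cong) (simp_all add: residual_normal algebra_simps)
  then show ?thesis unfolding sum_normals_moment using grad_inner[of f e] by simp
qed

text \<open>Since the normals weighted by areas sum to zero, the constant part of the flux carries
  nothing through the whole boundary of the cell.\<close>

lemma residual_area: "(\<Sum>\<sigma>\<in>E. residual f \<sigma> * face_area \<sigma>) = (\<Sum>\<sigma>\<in>E. face_area \<sigma> * f \<sigma>)"
proof -
  have "(\<Sum>\<sigma>\<in>E. residual f \<sigma> * face_area \<sigma>) =
      (\<Sum>\<sigma>\<in>E. face_area \<sigma> * f \<sigma>) + (\<Sum>\<sigma>\<in>E. face_area \<sigma> * (N \<sigma> \<bullet> (A *v grad f)))"
    unfolding sum.distrib[symmetric]
    by (intro sum.cong) (simp_all add: residual_normal algebra_simps)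
  then show ?thesis by (simp add: sum_normals)
qed

lemma continuous_flux: "continuous_on UNIV (flux f \<sigma>)"
  unfolding flux_def by (intro continuous_intros)

lemma continuous_matrix [continuous_intros]:
  fixes B :: "real^'n^'n"
  assumes "continuous_on S f" shows "continuous_on S (\<lambda>x. B *v f x)"
  using bounded_linear.continuous_on[OF matrix_vector_mul_bounded_linear assms] .

lemma inv_sym: "(matrix_inv A *v x) \<bullet> (A *v y) = x \<bullet> y"
  using A_sym[of y "matrix_inv A *v x"] by (simp add: A_inv inner_commute)

text \<open>The integrand is positive away from \<open>c\<close>, and the cone is a nonempty open
  set that omits \<open>c\<close>; a vanishing integral would make the cone negligible.\<close>

lemma gam_pos:
  assumes \<sigma>: "\<sigma> \<in> E" shows "0 < gam \<sigma>"
proof -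
  interpret C: hyperplane_cone c "N \<sigma>" "d \<sigma>" \<sigma> by (rule hyperplane_cone[OF \<sigma>])
  let ?y = "\<lambda>x. (1 / d \<sigma>) *\<^sub>R (x - c)"
  let ?q = "\<lambda>x. (matrix_inv A *v ?y x) \<bullet> ?y x"
  have pos: "0 < (matrix_inv A *v y) \<bullet> y" if "y \<noteq> 0" for y
  proof -
    have "matrix_inv A *v y \<noteq> 0" using that A_inv(1)[of y] by auto
    from A_pos[OF this] show ?thesis by (simp add: A_inv inner_commute)
  qed
  have nonneg: "0 \<le> (matrix_inv A *v y) \<bullet> y" for y using pos[of y] by (cases "y = 0") auto
  have cont: "continuous_on UNIV ?q" by (intro continuous_intros)
  have int: "integrable lebesgue (\<lambda>x. indicator (face_cone c \<sigma>) x *\<^sub>R ?q x)"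
    using cone_set_integrable[OF \<sigma> cont] by (simp add: set_integrable_def)
  have "0 \<le> gam \<sigma>" unfolding gam_def set_lebesgue_integral_def
    by (intro Bochner_Integration.integral_nonneg scaleR_nonneg_nonneg nonneg) (simp add: indicator_def)
  moreover have "gam \<sigma> \<noteq> 0"
  proof
    assume "gam \<sigma> = 0"
    then have "AE x in lebesgue. indicator (face_cone c \<sigma>) x *\<^sub>R ?q x = 0"
      unfolding gam_def set_lebesgue_integral_def
      by (subst (asm) integral_nonneg_eq_0_iff_AE[OF int])
        (intro AE_I2 scaleR_nonneg_nonneg nonneg; simp add: indicator_def)
    then have "AE x in lebesgue. x \<notin> face_cone c \<sigma>"
    proof eventually_elim
      case (elim x)
      show ?case
      proof
        assume x: "x \<in> face_cone c \<sigma>"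
        then have "x \<noteq> c" unfolding C.cone_alt by auto
        then have "?y x \<noteq> 0" using C.d by simp
        from pos[OF this] show False using elim x by auto
      qed
    qed
    then have "face_cone c \<sigma> \<in> null_sets lebesgue"
      using C.cone_borel by (subst AE_iff_null_sets) auto
    then have "negligible (face_cone c \<sigma>)" by (simp add: negligible_iff_null_sets)
    then show False using open_not_negligible[OF C.open_cone C.cone_nonempty] by blast
  qed
  ultimately show ?thesis by simp
qed

text \<open>On a cone, constant against constant gives the gradient term of \<open>form\<close> and
  radial against radial gives \<open>gam\<close>. The cross terms are first moments of the cone, in
  which \<open>d \<sigma>\<close> cancels and the common factor \<open>?k\<close> remains; summed
  over the faces they vanish by \<open>residual_moment\<close>.\<close>

lemma energy_integral:
  assumes T: "negligible T"
    and F: "\<And>\<sigma> x. x \<notin> T \<Longrightarrow> \<sigma> \<in> E \<Longrightarrow> x \<in> K \<Longrightarrow> (\<And>\<tau>. \<tau> \<in> E \<Longrightarrow> x \<in> face_cone c \<tau> \<longleftrightarrow> \<tau> = \<sigma>) \<Longrightarrow>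
      F x = (matrix_inv A *v flux f \<sigma> x) \<bullet> flux f' \<sigma> x"
  shows "(LINT x:K|lebesgue. F x) = form f f'" and "set_integrable lebesgue K F"
proof -
  have cont: "continuous_on UNIV (\<lambda>x. (matrix_inv A *v flux f \<sigma> x) \<bullet> flux f' \<sigma> x)" for \<sigma>
    by (intro continuous_intros continuous_flux)
  have split: "(LINT x:K|lebesgue. F x) =
      (\<Sum>\<sigma>\<in>E. LINT x:face_cone c \<sigma>|lebesgue. (matrix_inv A *v flux f \<sigma> x) \<bullet> flux f' \<sigma> x)"
    by (rule cell_integral_split(1)[OF T cont]) (rule F)
  show "set_integrable lebesgue K F"
    by (rule cell_integral_split(2)[OF T cont]) (rule F)
  let ?v = "grad f" and ?v' = "grad f'" and ?T = "residual f" and ?T' = "residual f'"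
  let ?k = "1 / (real CARD('n) + 1)"
  have "(LINT x:face_cone c \<sigma>|lebesgue. (matrix_inv A *v flux f \<sigma> x) \<bullet> flux f' \<sigma> x) =
      measure lebesgue (face_cone c \<sigma>) * (?v \<bullet> (A *v ?v')) + ?T' \<sigma> * gam \<sigma> * ?T \<sigma>
      - ?k * (?T' \<sigma> * (face_area \<sigma> * ((face_center \<sigma> - c) \<bullet> ?v)))
      - ?k * (?T \<sigma> * (face_area \<sigma> * ((face_center \<sigma> - c) \<bullet> ?v')))" if \<sigma>: "\<sigma> \<in> E" for \<sigma>
  proof -
    interpret C: hyperplane_cone c "N \<sigma>" "d \<sigma>" \<sigma> by (rule hyperplane_cone[OF \<sigma>])
    let ?y = "\<lambda>x. (1 / d \<sigma>) *\<^sub>R (x - c)"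
    let ?C = "face_cone c \<sigma>"
    have expand: "(matrix_inv A *v flux f \<sigma> x) \<bullet> flux f' \<sigma> x =
        (?v \<bullet> (A *v ?v') + (?T \<sigma> * ?T' \<sigma>) * ((matrix_inv A *v ?y x) \<bullet> ?y x))
        - ((?T' \<sigma> / d \<sigma>) * ((x - c) \<bullet> ?v) + (?T \<sigma> / d \<sigma>) * ((x - c) \<bullet> ?v'))" for x
    proof -
      have 1: "matrix_inv A *v flux f \<sigma> x = - ?v + ?T \<sigma> *\<^sub>R (matrix_inv A *v ?y x)"
        unfolding flux_def
        by (simp only: matrix_vector_right_distrib matrix_vector_mult_scaleR A_inv
            linear_neg[OF matrix_vector_mul_linear])
      have 2: "(matrix_inv A *v ?y x) \<bullet> (A *v ?v') = (1 / d \<sigma>) * ((x - c) \<bullet> ?v')"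
        by (simp only: inv_sym inner_scaleR_left)
      have 3: "?v \<bullet> ?y x = (1 / d \<sigma>) * ((x - c) \<bullet> ?v)"
        by (simp only: inner_scaleR_right inner_commute)
      have "(matrix_inv A *v flux f \<sigma> x) \<bullet> flux f' \<sigma> x =
          ?v \<bullet> (A *v ?v') - ?T' \<sigma> * (?v \<bullet> ?y x) - ?T \<sigma> * ((matrix_inv A *v ?y x) \<bullet> (A *v ?v'))
          + (?T \<sigma> * ?T' \<sigma>) * ((matrix_inv A *v ?y x) \<bullet> ?y x)"
        unfolding 1 unfolding flux_def[of f' \<sigma> x]
        by (simp only: inner_add_left inner_add_right inner_minus_left inner_minus_right
            inner_scaleR_left inner_scaleR_right) (simp add: algebra_simps)
      then show ?thesis unfolding 2 3 by (simp add: algebra_simps)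
    qed
    have cq: "continuous_on UNIV (\<lambda>x. (matrix_inv A *v ?y x) \<bullet> ?y x)" by (intro continuous_intros)
    have ce: "continuous_on UNIV (\<lambda>x. (x - c) \<bullet> e)" for e by (intro continuous_intros)
    note int = cone_set_integrable[OF \<sigma>]
    have "(LINT x:?C|lebesgue. (matrix_inv A *v flux f \<sigma> x) \<bullet> flux f' \<sigma> x) =
        ((LINT x:?C|lebesgue. ?v \<bullet> (A *v ?v')) +
          (LINT x:?C|lebesgue. (?T \<sigma> * ?T' \<sigma>) * ((matrix_inv A *v ?y x) \<bullet> ?y x)))
        - ((LINT x:?C|lebesgue. (?T' \<sigma> / d \<sigma>) * ((x - c) \<bullet> ?v)) +
          (LINT x:?C|lebesgue. (?T \<sigma> / d \<sigma>) * ((x - c) \<bullet> ?v')))"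
      unfolding expand
      by (subst set_integral_diff set_integral_add; (intro int continuous_intros cq ce)?)+ simp
    also have "(LINT x:?C|lebesgue. ?v \<bullet> (A *v ?v')) = measure lebesgue ?C * (?v \<bullet> (A *v ?v'))"
      using C.cone_borel by (simp add: set_lebesgue_integral_def)
    also have "(LINT x:?C|lebesgue. (?T \<sigma> * ?T' \<sigma>) * ((matrix_inv A *v ?y x) \<bullet> ?y x)) = (?T \<sigma> * ?T' \<sigma>) * gam \<sigma>"
      unfolding gam_def by (rule set_integral_mult_right)
    also have "(LINT x:?C|lebesgue. (?T' \<sigma> / d \<sigma>) * ((x - c) \<bullet> ?v)) =
        (?T' \<sigma> / d \<sigma>) * (face_area \<sigma> * d \<sigma> * ?k * ((face_center \<sigma> - c) \<bullet> ?v))"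
      by (simp only: set_integral_mult_right C.cone_moment) (simp add: add.commute)
    also have "(LINT x:?C|lebesgue. (?T \<sigma> / d \<sigma>) * ((x - c) \<bullet> ?v')) =
        (?T \<sigma> / d \<sigma>) * (face_area \<sigma> * d \<sigma> * ?k * ((face_center \<sigma> - c) \<bullet> ?v'))"
      by (simp only: set_integral_mult_right C.cone_moment) (simp add: add.commute)
    finally show ?thesis using C.d by (simp add: algebra_simps)
  qed
  then have "(LINT x:K|lebesgue. F x) = (\<Sum>\<sigma>\<in>E.
      measure lebesgue (face_cone c \<sigma>) * (?v \<bullet> (A *v ?v')) + ?T' \<sigma> * gam \<sigma> * ?T \<sigma>
      - ?k * (?T' \<sigma> * (face_area \<sigma> * ((face_center \<sigma> - c) \<bullet> ?v)))
      - ?k * (?T \<sigma> * (face_area \<sigma> * ((face_center \<sigma> - c) \<bullet> ?v'))))"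
    unfolding split by (rule sum.cong[OF refl])
  also have "\<dots> = form f f'"
    by (simp only: sum_subtractf sum.distrib sum_distrib_left[symmetric] sum_distrib_right[symmetric]
        residual_moment cell_measure[symmetric] form_def mult_zero_right diff_zero)
  finally show "(LINT x:K|lebesgue. F x) = form f f'" .
qed

text \<open>The divergence of \<open>flux\<close> on a cone: the field x - c has divergence
  \<open>CARD('n)\<close> and the constant part has none.\<close>

definition cone_div :: "((real^'n) set \<Rightarrow> real) \<Rightarrow> (real^'n) set \<Rightarrow> real" where
  "cone_div f \<sigma> = residual f \<sigma> * CARD('n) / d \<sigma>"

lemma integral_cone_div:
  assumes T: "negligible T"
    and F: "\<And>\<sigma> x. x \<notin> T \<Longrightarrow> \<sigma> \<in> E \<Longrightarrow> x \<in> K \<Longrightarrow> (\<And>\<tau>. \<tau> \<in> E \<Longrightarrow> x \<in> face_cone c \<tau> \<longleftrightarrow> \<tau> = \<sigma>) \<Longrightarrow>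
      F x = cone_div f \<sigma>"
  shows "(LINT x:K|lebesgue. F x) = (\<Sum>\<sigma>\<in>E. face_area \<sigma> * f \<sigma>)"
proof -
  have "(LINT x:K|lebesgue. F x) = (\<Sum>\<sigma>\<in>E. LINT x:face_cone c \<sigma>|lebesgue. cone_div f \<sigma>)"
    by (rule cell_integral_split(1)[OF T _ F]) auto
  also have "\<dots> = (\<Sum>\<sigma>\<in>E. residual f \<sigma> * face_area \<sigma>)"
  proof (rule sum.cong[OF refl])
    fix \<sigma> assume "\<sigma> \<in> E"
    then interpret C: hyperplane_cone c "N \<sigma>" "d \<sigma>" \<sigma> by (rule hyperplane_cone)
    have "(LINT x:face_cone c \<sigma>|lebesgue. cone_div f \<sigma>) = measure lebesgue (face_cone c \<sigma>) * cone_div f \<sigma>"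
      using C.cone_borel by (simp add: set_lebesgue_integral_def)
    then show "(LINT x:face_cone c \<sigma>|lebesgue. cone_div f \<sigma>) = residual f \<sigma> * face_area \<sigma>"
      using C.d by (simp add: C.measure_cone cone_div_def)
  qed
  finally show ?thesis by (simp add: residual_area)
qed

text \<open>Green's formula, showing that the normal component of the flux on \<sigma> is
  \<open>f \<sigma>\<close>. The radial part contributes \<open>residual f \<sigma>\<close> by
  integration along rays; the constant part, the same in all cones of the cell, contributes
  \<open>- (N \<sigma> \<bullet> (A *v grad f))\<close> by \<open>cell_divergence\<close>; the sum
  of both is \<open>f \<sigma>\<close>.\<close>

lemma cell_green:
  fixes \<phi> :: "real^'n \<Rightarrow> real"
  assumes T: "negligible T" and \<phi>: "\<And>k. C_diff k \<phi>"
    and F: "\<And>\<sigma> x. x \<notin> T \<Longrightarrow> \<sigma> \<in> E \<Longrightarrow> x \<in> K \<Longrightarrow> (\<And>\<tau>. \<tau> \<in> E \<Longrightarrow> x \<in> face_cone c \<tau> \<longleftrightarrow> \<tau> = \<sigma>) \<Longrightarrow>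
      F x = flux f \<sigma> x \<bullet> gradient \<phi> x"
    and F': "\<And>\<sigma> x. x \<notin> T \<Longrightarrow> \<sigma> \<in> E \<Longrightarrow> x \<in> K \<Longrightarrow> (\<And>\<tau>. \<tau> \<in> E \<Longrightarrow> x \<in> face_cone c \<tau> \<longleftrightarrow> \<tau> = \<sigma>) \<Longrightarrow>
      F' x = cone_div f \<sigma> * \<phi> x"
  shows "(LINT x:K|lebesgue. F x) = - (LINT x:K|lebesgue. F' x) +
      (\<Sum>\<sigma>\<in>E. f \<sigma> * (LINT y:\<sigma>|flat_lborel (affine hull \<sigma>). \<phi> y))"
    and "set_integrable lebesgue K F" and "set_integrable lebesgue K F'"
proof -
  obtain H where D: "\<And>x. (\<phi> has_derivative (\<lambda>v. gradient \<phi> x \<bullet> v)) (at x)"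
      "\<And>x. (gradient \<phi> has_derivative H x) (at x)"
      "\<And>v. continuous_on UNIV (\<lambda>x. H x v)" "\<And>x u v. H x u \<bullet> v = H x v \<bullet> u"
    using C_diff_derivatives[OF \<phi>] by blast
  let ?G = "gradient \<phi>"
  have cG: "continuous_on UNIV ?G"
    using D(2) by (meson continuous_at_imp_continuous_on has_derivative_continuous)
  have c\<phi>: "continuous_on UNIV \<phi>"
    using D(1) by (meson continuous_at_imp_continuous_on has_derivative_continuous)
  let ?a = "A *v grad f"
  let ?I = "\<lambda>\<sigma>. LINT y:\<sigma>|flat_lborel (affine hull \<sigma>). \<phi> y"
  have c1: "continuous_on UNIV (\<lambda>x. flux f \<sigma> x \<bullet> ?G x)"
    and c2: "continuous_on UNIV (\<lambda>x. cone_div f \<sigma> * \<phi> x)" for \<sigma>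
    by (intro continuous_intros continuous_flux cG c\<phi>)+
  have s1: "(LINT x:K|lebesgue. F x) = (\<Sum>\<sigma>\<in>E. LINT x:face_cone c \<sigma>|lebesgue. flux f \<sigma> x \<bullet> ?G x)"
    by (rule cell_integral_split(1)[OF T c1]) (rule F)
  have s2: "(LINT x:K|lebesgue. F' x) = (\<Sum>\<sigma>\<in>E. LINT x:face_cone c \<sigma>|lebesgue. cone_div f \<sigma> * \<phi> x)"
    by (rule cell_integral_split(1)[OF T c2]) (rule F')
  show "set_integrable lebesgue K F" by (rule cell_integral_split(2)[OF T c1]) (rule F)
  show "set_integrable lebesgue K F'" by (rule cell_integral_split(2)[OF T c2]) (rule F')
  have s3: "(LINT x:K|lebesgue. ?G x \<bullet> ?a) = (\<Sum>\<sigma>\<in>E. LINT x:face_cone c \<sigma>|lebesgue. ?G x \<bullet> ?a)"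
    by (rule cell_integral_split(1)[OF T]) (intro continuous_intros cG refl)+
  have "(LINT x:face_cone c \<sigma>|lebesgue. flux f \<sigma> x \<bullet> ?G x) =
      residual f \<sigma> * ?I \<sigma> - (LINT x:face_cone c \<sigma>|lebesgue. cone_div f \<sigma> * \<phi> x)
      - (LINT x:face_cone c \<sigma>|lebesgue. ?G x \<bullet> ?a)" if \<sigma>: "\<sigma> \<in> E" for \<sigma>
  proof -
    interpret C: hyperplane_cone c "N \<sigma>" "d \<sigma>" \<sigma> by (rule hyperplane_cone[OF \<sigma>])
    let ?C = "face_cone c \<sigma>"
    note int = cone_set_integrable[OF \<sigma>]
    have "flux f \<sigma> x \<bullet> ?G x = ((residual f \<sigma> / d \<sigma>) * (?G x \<bullet> (x - c) + CARD('n) * \<phi> x) -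
        cone_div f \<sigma> * \<phi> x) - ?G x \<bullet> ?a" for x
    proof -
      have "- q + r * (1 / D * p) = (r / D * (p + m * t) - r * m / D * t) - q" for p q r m t D :: real
        by (simp add: algebra_simps add_divide_distrib)
      then show ?thesis
        unfolding flux_def cone_div_def
        by (simp only: inner_add_left inner_minus_left inner_scaleR_left
            inner_commute[of "x - c"] inner_commute[of ?a])
    qed
    then have "(LINT x:?C|lebesgue. flux f \<sigma> x \<bullet> ?G x) =
        (LINT x:?C|lebesgue. ((residual f \<sigma> / d \<sigma>) * (?G x \<bullet> (x - c) + CARD('n) * \<phi> x) -
        cone_div f \<sigma> * \<phi> x) - ?G x \<bullet> ?a)" by simp
    also have "\<dots> = (LINT x:?C|lebesgue. (residual f \<sigma> / d \<sigma>) * (?G x \<bullet> (x - c) + CARD('n) * \<phi> x)) -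
        (LINT x:?C|lebesgue. cone_div f \<sigma> * \<phi> x) - (LINT x:?C|lebesgue. ?G x \<bullet> ?a)"
    proof -
      have i1: "set_integrable lebesgue ?C (\<lambda>x. (residual f \<sigma> / d \<sigma>) * (?G x \<bullet> (x - c) + CARD('n) * \<phi> x))"
        and i2: "set_integrable lebesgue ?C (\<lambda>x. cone_div f \<sigma> * \<phi> x)"
        and i3: "set_integrable lebesgue ?C (\<lambda>x. ?G x \<bullet> ?a)"
        by (intro int continuous_intros cG c\<phi>)+
      show ?thesis
        using set_integral_diff(2)[OF set_integral_diff(1)[OF i1 i2] i3] set_integral_diff(2)[OF i1 i2]
        by simp
    qed
    also have "(LINT x:?C|lebesgue. (residual f \<sigma> / d \<sigma>) * (?G x \<bullet> (x - c) + CARD('n) * \<phi> x)) =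
        (residual f \<sigma> / d \<sigma>) * (d \<sigma> * ?I \<sigma>)"
      by (simp only: set_integral_mult_right C.cone_radial_divergence[OF D(1) cG])
    finally show ?thesis using C.d by simp
  qed
  then have "(LINT x:K|lebesgue. F x) = (\<Sum>\<sigma>\<in>E. residual f \<sigma> * ?I \<sigma> -
      (LINT x:face_cone c \<sigma>|lebesgue. cone_div f \<sigma> * \<phi> x)
      - (LINT x:face_cone c \<sigma>|lebesgue. ?G x \<bullet> ?a))"
    unfolding s1 by (rule sum.cong[OF refl])
  also have "\<dots> = (\<Sum>\<sigma>\<in>E. residual f \<sigma> * ?I \<sigma>) - (LINT x:K|lebesgue. F' x) -
      (\<Sum>\<sigma>\<in>E. (N \<sigma> \<bullet> ?a) * ?I \<sigma>)"
    unfolding cell_divergence[OF D, symmetric] s2 s3 by (simp add: sum_subtractf)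
  also have "(\<Sum>\<sigma>\<in>E. residual f \<sigma> * ?I \<sigma>) =
      (\<Sum>\<sigma>\<in>E. f \<sigma> * ?I \<sigma>) + (\<Sum>\<sigma>\<in>E. (N \<sigma> \<bullet> ?a) * ?I \<sigma>)"
    unfolding sum.distrib[symmetric] by (intro sum.cong) (simp_all add: residual_normal distrib_right)
  finally show "(LINT x:K|lebesgue. F x) = - (LINT x:K|lebesgue. F' x) + (\<Sum>\<sigma>\<in>E. f \<sigma> * ?I \<sigma>)" by simp
qed

end

section \<open>The mean diffusion tensor of a cell\<close>

text \<open>Testing a matrix with two fixed vectors is a bounded linear functional and passes
  through the mean, so symmetry and ellipticity can be transferred under the integral.\<close>

lemma cell_tensor_form:
  fixes \<Lambda> :: "real^'n \<Rightarrow> real^'n^'n"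
  assumes \<Lambda>: "diffusion_tensor \<Omega> \<Lambda>" and \<Omega>: "open \<Omega>" "bounded \<Omega>" and K: "open K" "K \<subseteq> \<Omega>"
  shows "(cell_tensor \<Lambda> K *v x) \<bullet> y = (1 / measure lebesgue K) * (LINT z:K|lebesgue. (\<Lambda> z *v x) \<bullet> y)"
    and "set_integrable lebesgue K (\<lambda>z. (\<Lambda> z *v x) \<bullet> y)"
proof -
  have Km: "K \<in> sets lebesgue" and \<Omega>m: "\<Omega> \<in> sets lebesgue" using K(1) \<Omega>(1) by auto
  have fin: "emeasure lebesgue \<Omega> < \<infinity>"
    using fmeasurableD2[OF bounded_set_imp_lmeasurable[OF \<Omega>(2) \<Omega>m]]
    by (simp only: infinity_ennreal_def top.not_eq_extremum)
  obtain C where C: "AE x in lebesgue_on \<Omega>. norm (\<Lambda> x) \<le> C" using \<Lambda> by (auto simp: diffusion_tensor_def)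
  have "integrable (lebesgue_on \<Omega>) (\<lambda>_. C)"
  proof -
    have "integrable lebesgue (\<lambda>x. indicator \<Omega> x *\<^sub>R C)"
      using fin \<Omega>m by (intro integrable_scaleR_left integrable_real_indicator)
    then show ?thesis using \<Omega>m by (simp add: integrable_restrict_space)
  qed
  then have "integrable (lebesgue_on \<Omega>) \<Lambda>"
  proof (rule Bochner_Integration.integrable_bound)
    show "\<Lambda> \<in> borel_measurable (lebesgue_on \<Omega>)" using \<Lambda> by (simp add: diffusion_tensor_def)
    show "AE x in lebesgue_on \<Omega>. norm (\<Lambda> x) \<le> norm C" using C by eventually_elim simp
  qed
  then have "set_integrable lebesgue \<Omega> \<Lambda>"
    using \<Omega>m by (simp add: integrable_restrict_space set_integrable_def)
  then have int: "set_integrable lebesgue K \<Lambda>" using Km K(2) by (rule set_integrable_subset)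
  have lin: "bounded_linear (\<lambda>A :: real^'n^'n. (A *v x) \<bullet> y)"
    by (simp add: linear_conv_bounded_linear[symmetric])
      (auto intro!: linearI simp: matrix_vector_mult_add_rdistrib inner_add_left scaleR_matrix_vector_assoc[symmetric])
  have eq: "(indicator K z *\<^sub>R \<Lambda> z *v x) \<bullet> y = indicator K z *\<^sub>R ((\<Lambda> z *v x) \<bullet> y)" for z
    by (simp add: scaleR_matrix_vector_assoc[symmetric])
  show "set_integrable lebesgue K (\<lambda>z. (\<Lambda> z *v x) \<bullet> y)"
    using integrable_bounded_linear[OF lin int[unfolded set_integrable_def]]
    unfolding set_integrable_def eq .
  have "((LINT z:K|lebesgue. \<Lambda> z) *v x) \<bullet> y = (LINT z:K|lebesgue. (\<Lambda> z *v x) \<bullet> y)"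
    using integral_bounded_linear[OF lin int[unfolded set_integrable_def]]
    unfolding set_lebesgue_integral_def eq by simp
  then show "(cell_tensor \<Lambda> K *v x) \<bullet> y = (1 / measure lebesgue K) * (LINT z:K|lebesgue. (\<Lambda> z *v x) \<bullet> y)"
    by (simp add: cell_tensor_def scaleR_matrix_vector_assoc[symmetric])
qed

lemma AE_on_subset:
  assumes "AE x in lebesgue_on \<Omega>. P x" "\<Omega> \<in> sets lebesgue" "K \<subseteq> \<Omega>"
  shows "AE x in lebesgue. x \<in> K \<longrightarrow> P x"
proof -
  have "AE x in lebesgue. x \<in> \<Omega> \<longrightarrow> P x" using assms(1,2) by (simp add: AE_restrict_space_iff)
  then show ?thesis by eventually_elim (use assms(3) in auto)
qed

lemma cell_tensor_symmetric:
  assumes \<Lambda>: "diffusion_tensor \<Omega> \<Lambda>" and \<Omega>: "open \<Omega>" "bounded \<Omega>" and K: "open K" "K \<subseteq> \<Omega>"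
  shows "(cell_tensor \<Lambda> K *v x) \<bullet> y = (cell_tensor \<Lambda> K *v y) \<bullet> x"
proof -
  note form = cell_tensor_form[OF assms]
  have \<Omega>m: "\<Omega> \<in> sets lebesgue" using \<Omega>(1) by auto
  have "AE z in lebesgue_on \<Omega>. transpose (\<Lambda> z) = \<Lambda> z" using \<Lambda> by (simp add: diffusion_tensor_def)
  from AE_on_subset[OF this \<Omega>m K(2)]
  have "AE z in lebesgue. indicator K z *\<^sub>R ((\<Lambda> z *v x) \<bullet> y) = indicator K z *\<^sub>R ((\<Lambda> z *v y) \<bullet> x)"
  proof eventually_elim
    case (elim z)
    show ?case
    proof (cases "z \<in> K")
      case True
      then have t: "transpose (\<Lambda> z) = \<Lambda> z" using elim by simp
      have "(\<Lambda> z *v x) \<bullet> y = (transpose (\<Lambda> z) *v x) \<bullet> y" using t by simp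
      also have "\<dots> = x \<bullet> (\<Lambda> z *v y)" by (simp add: dot_lmul_matrix)
      finally show ?thesis by (simp add: inner_commute)
    qed simp
  qed
  then have "(LINT z:K|lebesgue. (\<Lambda> z *v x) \<bullet> y) = (LINT z:K|lebesgue. (\<Lambda> z *v y) \<bullet> x)"
    using form(2)[of x y] form(2)[of y x] unfolding set_lebesgue_integral_def set_integrable_def
    by (intro integral_cong_AE) auto
  then show ?thesis by (simp add: form(1))
qed

text \<open>Averaging the pointwise bound keeps the ellipticity constant \<zeta>.\<close>

lemma cell_tensor_positive:
  assumes \<Lambda>: "diffusion_tensor \<Omega> \<Lambda>" and \<Omega>: "open \<Omega>" "bounded \<Omega>" and K: "open K" "K \<subseteq> \<Omega>"
    and pos: "0 < measure lebesgue K" and x: "x \<noteq> 0"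
  shows "0 < (cell_tensor \<Lambda> K *v x) \<bullet> x"
proof -
  note form = cell_tensor_form[OF \<Lambda> \<Omega> K]
  have Km: "K \<in> sets lebesgue" and \<Omega>m: "\<Omega> \<in> sets lebesgue" using K(1) \<Omega>(1) by auto
  have Kl: "K \<in> lmeasurable" using bounded_subset[OF \<Omega>(2) K(2)] Km by (rule bounded_set_imp_lmeasurable)
  obtain \<zeta> where \<zeta>: "0 < \<zeta>" "AE z in lebesgue_on \<Omega>. \<forall>\<xi>. (\<Lambda> z *v \<xi>) \<bullet> \<xi> \<ge> \<zeta> * (norm \<xi>)\<^sup>2"
    using \<Lambda> by (auto simp: diffusion_tensor_def)
  have "measure lebesgue K * (\<zeta> * (norm x)\<^sup>2) = (\<integral>z. indicator K z *\<^sub>R (\<zeta> * (norm x)\<^sup>2) \<partial>lebesgue)"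
    using Km by simp
  also have "\<dots> \<le> (LINT z:K|lebesgue. (\<Lambda> z *v x) \<bullet> x)"
    unfolding set_lebesgue_integral_def
  proof (rule integral_mono_AE)
    show "integrable lebesgue (\<lambda>z. indicator K z *\<^sub>R (\<zeta> * (norm x)\<^sup>2))"
      using fmeasurableD2[OF Kl] Km
      by (intro integrable_scaleR_left integrable_real_indicator) (simp_all only: infinity_ennreal_def top.not_eq_extremum)
    show "integrable lebesgue (\<lambda>z. indicator K z *\<^sub>R ((\<Lambda> z *v x) \<bullet> x))"
      using form(2) by (simp only: set_integrable_def)
    show "AE z in lebesgue. indicator K z *\<^sub>R (\<zeta> * (norm x)\<^sup>2) \<le> indicator K z *\<^sub>R ((\<Lambda> z *v x) \<bullet> x)"
      using AE_on_subset[OF \<zeta>(2) \<Omega>m K(2)] by eventually_elim (simp add: indicator_def)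
  qed
  finally have "\<zeta> * (norm x)\<^sup>2 \<le> (cell_tensor \<Lambda> K *v x) \<bullet> x"
    using pos by (simp add: form(1) pos_le_divide_eq mult.commute)
  moreover have "0 < \<zeta> * (norm x)\<^sup>2" using \<zeta>(1) x by simp
  ultimately show ?thesis by linarith
qed

section \<open>The mesh\<close>

locale mesh =
  fixes \<Omega> :: "(real^'n) set" and \<Lambda> :: "real^'n \<Rightarrow> real^'n^'n" and M :: "(real^'n) set set"
    and E :: "(real^'n) set \<Rightarrow> (real^'n) set set" and c :: "(real^'n) set \<Rightarrow> real^'n"
  assumes bounded_domain: "bounded \<Omega>" and open_domain: "open \<Omega>"
    and tensor: "diffusion_tensor \<Omega> \<Lambda>" and mesh: "polytopal_mesh \<Omega> M E c"
begin

lemma finite_cells: "finite M" using mesh by (simp add: polytopal_mesh_def)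

lemma cell_subset: "K \<in> M \<Longrightarrow> K \<subseteq> \<Omega>" using mesh by (auto simp: polytopal_mesh_def)

lemma cells_disjoint: "K \<in> M \<Longrightarrow> L \<in> M \<Longrightarrow> x \<in> K \<Longrightarrow> x \<in> L \<Longrightarrow> K = L"
  using mesh by (auto simp: polytopal_mesh_def disjoint_def)

lemma cells_cover: "negligible (\<Omega> - \<Union>M)" using mesh by (simp add: polytopal_mesh_def)

lemma domain_lebesgue: "\<Omega> \<in> sets lebesgue" using open_domain by auto

lemma star_cell:
  assumes K: "K \<in> M"
  shows "star_cell K (c K) (E K)"
proof -
  have 1: "\<forall>K\<in>M. polytopal_open K \<and> K \<subseteq> \<Omega>"
    using mesh unfolding polytopal_mesh_def by (elim conjE)
  have 2: "\<forall>K\<in>M. finite (E K) \<and> disjoint (E K) \<and> (\<forall>\<sigma>\<in>E K. hyperplane_piece \<sigma> \<and> \<sigma> \<subseteq> frontier K) \<and>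
      frontier K = (\<Union>\<sigma>\<in>E K. closure \<sigma>)"
    using mesh unfolding polytopal_mesh_def by (elim conjE)
  have 3: "\<forall>K\<in>M. c K \<in> K \<and> (\<forall>y\<in>K. closed_segment (c K) y \<subseteq> K) \<and>
      (\<forall>\<sigma>\<in>E K. face_dist (c K) \<sigma> > 0) \<and>
      negligible (K - (\<Union>\<sigma>\<in>E K. face_cone (c K) \<sigma>)) \<and>
      negligible ((\<Union>\<sigma>\<in>E K. face_cone (c K) \<sigma>) - K) \<and>
      pairwise (\<lambda>\<sigma> \<tau>. negligible (face_cone (c K) \<sigma> \<inter> face_cone (c K) \<tau>)) (E K)"
    using mesh unfolding polytopal_mesh_def by (elim conjE)
  note facts = bspec[OF 1 K] bspec[OF 2 K] bspec[OF 3 K]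
  show ?thesis
  proof
    show "open K" using facts(1) by (simp add: polytopal_open_def)
    show "bounded K" by (rule bounded_subset[OF bounded_domain cell_subset[OF K]])
    show "frontier K = (\<Union>\<sigma>\<in>E K. closure \<sigma>)" using facts(2) by (elim conjE)
  qed (insert facts(2,3), (elim conjE, blast)+)
qed

lemma diffusion_cell:
  assumes K: "K \<in> M" shows "diffusion_cell K (c K) (E K) (cell_tensor \<Lambda> K)"
proof -
  interpret star_cell K "c K" "E K" by (rule star_cell[OF K])
  show ?thesis
    using cell_tensor_symmetric[OF tensor open_domain bounded_domain open_cell cell_subset[OF K]]
      cell_tensor_positive[OF tensor open_domain bounded_domain open_cell cell_subset[OF K] measure_pos]
    by unfold_locales
qed

lemma cell_grad_eq: "K \<in> M \<Longrightarrow> cell_grad \<Lambda> E c K f = diffusion_cell.grad K (c K) (E K) (cell_tensor \<Lambda> K) f"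
  by (simp add: cell_grad_def diffusion_cell.grad_def[OF diffusion_cell])

lemma flux_residual_eq:
  "K \<in> M \<Longrightarrow> flux_residual \<Lambda> E c K f = diffusion_cell.residual K (c K) (E K) (cell_tensor \<Lambda> K) f"
  by (simp add: fun_eq_iff flux_residual_def diffusion_cell.residual_def[OF diffusion_cell] cell_grad_eq)

lemma cone_gamma_eq: "K \<in> M \<Longrightarrow> cone_gamma \<Lambda> c K \<sigma> = diffusion_cell.gam (c K) (cell_tensor \<Lambda> K) \<sigma>"
  by (simp add: cone_gamma_def diffusion_cell.gam_def[OF diffusion_cell])

text \<open>One null set for all almost-everywhere statements on the mesh: off it, a point of the
  domain lies in exactly one cell, in exactly one cone of that cell, and in no cone of another
  cell.\<close>

definition exceptional :: "(real^'n) set" where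
  "exceptional = (\<Omega> - \<Union>M) \<union> (\<Union>K\<in>M. star_cell.null_part K (c K) (E K))"

lemma negligible_exceptional: "negligible exceptional"
  unfolding exceptional_def using finite_cells cells_cover star_cell.negligible_null_part[OF star_cell]
  by (intro negligible_Un negligible_Union) auto

lemma domain_integral:
  fixes F :: "real^'n \<Rightarrow> real"
  assumes F: "\<And>K. K \<in> M \<Longrightarrow> set_integrable lebesgue K F"
  shows "(LINT x:\<Omega>|lebesgue. F x) = (\<Sum>K\<in>M. LINT x:K|lebesgue. F x)"
    and "set_integrable lebesgue \<Omega> F"
proof -
  let ?S = "\<lambda>x. \<Sum>K\<in>M. indicator K x *\<^sub>R F x"
  have int: "integrable lebesgue (\<lambda>x. indicator K x *\<^sub>R F x)" if "K \<in> M" for K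
    using F[OF that] by (simp only: set_integrable_def)
  have S: "integrable lebesgue ?S" by (rule Bochner_Integration.integrable_sum[OF int])
  have eq: "indicator \<Omega> x *\<^sub>R F x = ?S x" if nx: "x \<notin> \<Omega> - \<Union>M" for x
  proof (cases "x \<in> \<Omega>")
    case True
    with nx obtain K where K: "K \<in> M" "x \<in> K" by blast
    have "?S x = (\<Sum>L\<in>M. if L = K then F x else 0)"
    proof (rule sum.cong[OF refl])
      fix L assume "L \<in> M"
      then show "indicator L x *\<^sub>R F x = (if L = K then F x else 0)"
        using cells_disjoint[OF K(1) \<open>L \<in> M\<close> K(2)] K(2) by (cases "x \<in> L") auto
    qed
    then show ?thesis using True K(1) finite_cells by simp
  next
    case False
    then have "x \<notin> K" if "K \<in> M" for K using cell_subset[OF that] by blast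
    then show ?thesis using False by simp
  qed
  show "set_integrable lebesgue \<Omega> F"
    unfolding set_integrable_def by (rule integrable_spike_lebesgue(1)[OF S cells_cover eq])
  have "(LINT x:\<Omega>|lebesgue. F x) = integral\<^sup>L lebesgue ?S"
    unfolding set_lebesgue_integral_def by (rule integrable_spike_lebesgue(2)[OF S cells_cover eq])
  also have "\<dots> = (\<Sum>K\<in>M. LINT x:K|lebesgue. F x)"
    unfolding set_lebesgue_integral_def by (rule Bochner_Integration.integral_sum[OF int])
  finally show "(LINT x:\<Omega>|lebesgue. F x) = (\<Sum>K\<in>M. LINT x:K|lebesgue. F x)" .
qed

lemma piecewise_const_on: "K \<in> M \<Longrightarrow> x \<in> K \<Longrightarrow> piecewise_const M p x = p K"
proof -
  assume K: "K \<in> M" "x \<in> K"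
  have "piecewise_const M p x = (\<Sum>L\<in>M. if L = K then p K else 0)"
    unfolding piecewise_const_def
  proof (rule sum.cong[OF refl])
    fix L assume "L \<in> M"
    then show "indicator L x *\<^sub>R p L = (if L = K then p K else 0)"
      using cells_disjoint[OF K(1) \<open>L \<in> M\<close> K(2)] K(2) by (cases "x \<in> L") auto
  qed
  then show ?thesis using K(1) finite_cells by simp
qed

lemma domain_integral_piecewise_const:
  fixes F :: "real^'n \<Rightarrow> real"
  assumes F: "set_integrable lebesgue \<Omega> F"
  shows "(LINT x:\<Omega>|lebesgue. piecewise_const M p x * F x) = (\<Sum>K\<in>M. p K * (LINT x:K|lebesgue. F x))"
proof -
  have FK: "set_integrable lebesgue K F" if "K \<in> M" for K
    using F _ cell_subset[OF that] by (rule set_integrable_subset) (use star_cell.open_cell[OF star_cell[OF that]] in auto)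
  have eq: "indicator K x *\<^sub>R (piecewise_const M p x * F x) = indicator K x *\<^sub>R (p K * F x)"
    if "K \<in> M" for K x
    by (simp add: indicator_def piecewise_const_on[OF that])
  have "set_integrable lebesgue K (\<lambda>x. piecewise_const M p x * F x)" if "K \<in> M" for K
    using set_integrable_mult_right[of "p K" lebesgue K F] FK[OF that]
    unfolding set_integrable_def eq[OF that] by blast
  then have "(LINT x:\<Omega>|lebesgue. piecewise_const M p x * F x) =
      (\<Sum>K\<in>M. LINT x:K|lebesgue. piecewise_const M p x * F x)"
    by (rule domain_integral(1))
  also have "\<dots> = (\<Sum>K\<in>M. p K * (LINT x:K|lebesgue. F x))"
  proof (rule sum.cong[OF refl])
    fix K assume "K \<in> M"
    have "(LINT x:K|lebesgue. piecewise_const M p x * F x) = (LINT x:K|lebesgue. p K * F x)"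
      unfolding set_lebesgue_integral_def eq[OF \<open>K \<in> M\<close>] ..
    then show "(LINT x:K|lebesgue. piecewise_const M p x * F x) = p K * (LINT x:K|lebesgue. F x)"
      by (simp only: set_integral_mult_right)
  qed
  finally show ?thesis .
qed

text \<open>Cells are disjoint and a cone sticks out of its cell only inside
  \<open>null_part\<close>, so the cones of the other cells miss \<open>x\<close> and one term of
  the double sum survives.\<close>

lemma sum_cells_cones:
  fixes w :: "(real^'n) set \<Rightarrow> (real^'n) set \<Rightarrow> 'b::real_vector"
  assumes x: "x \<notin> exceptional" and K: "K \<in> M" "x \<in> K" and \<sigma>: "\<sigma> \<in> E K"
    and u: "\<And>\<tau>. \<tau> \<in> E K \<Longrightarrow> x \<in> face_cone (c K) \<tau> \<longleftrightarrow> \<tau> = \<sigma>"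
  shows "(\<Sum>L\<in>M. \<Sum>\<tau>\<in>E L. indicator (face_cone (c L) \<tau>) x *\<^sub>R w L \<tau>) = w K \<sigma>"
proof -
  have "(\<Sum>\<tau>\<in>E L. indicator (face_cone (c L) \<tau>) x *\<^sub>R w L \<tau>) = (if L = K then w K \<sigma> else 0)"
    if L: "L \<in> M" for L
  proof (cases "L = K")
    case True
    then show ?thesis using star_cell.sum_cones[OF star_cell[OF K(1)] \<sigma> u, where w = "w K"] by simp
  next
    case False
    then have "x \<notin> L" using cells_disjoint[OF K(1) L K(2)] by blast
    moreover have "x \<notin> star_cell.null_part L (c L) (E L)" using x L by (auto simp: exceptional_def)
    ultimately have "x \<notin> face_cone (c L) \<tau>" if "\<tau> \<in> E L" for \<tau>
      using star_cell.not_in_cone[OF star_cell[OF L]] that by blast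
    then show ?thesis using False by (simp add: indicator_def)
  qed
  then have "(\<Sum>L\<in>M. \<Sum>\<tau>\<in>E L. indicator (face_cone (c L) \<tau>) x *\<^sub>R w L \<tau>) = (\<Sum>L\<in>M. if L = K then w K \<sigma> else 0)"
    by (rule sum.cong[OF refl])
  then show ?thesis using K(1) finite_cells by simp
qed

lemma flux_hat_on:
  assumes x: "x \<notin> exceptional" and K: "K \<in> M" "x \<in> K" and \<sigma>: "\<sigma> \<in> E K"
    and u: "\<And>\<tau>. \<tau> \<in> E K \<Longrightarrow> x \<in> face_cone (c K) \<tau> \<longleftrightarrow> \<tau> = \<sigma>"
  shows "flux_hat M E c \<Lambda> F x = diffusion_cell.flux K (c K) (E K) (cell_tensor \<Lambda> K) (F K) \<sigma> x"
  unfolding flux_hat_def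
  by (rule trans[OF sum_cells_cones[OF x K \<sigma> u]])
    (simp_all add: diffusion_cell.flux_def[OF diffusion_cell[OF K(1)]] flux_residual_eq[OF K(1)] cell_grad_eq[OF K(1)])

text \<open>An explicit divergence, constant on each cone up to a null set. It shows that the choice
  in \<open>weak_div\<close> is not vacuous, and the cell integrals of the chosen representative are
  computed through it.\<close>

definition div_hat :: "((real^'n) set \<Rightarrow> (real^'n) set \<Rightarrow> real) \<Rightarrow> real^'n \<Rightarrow> real" where
  "div_hat F x = (\<Sum>K\<in>M. \<Sum>\<sigma>\<in>E K. indicator (face_cone (c K) \<sigma>) x *\<^sub>R
     diffusion_cell.cone_div K (c K) (E K) (cell_tensor \<Lambda> K) (F K) \<sigma>)"

lemma div_hat_on:
  assumes x: "x \<notin> exceptional" and K: "K \<in> M" "x \<in> K" and \<sigma>: "\<sigma> \<in> E K"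
    and u: "\<And>\<tau>. \<tau> \<in> E K \<Longrightarrow> x \<in> face_cone (c K) \<tau> \<longleftrightarrow> \<tau> = \<sigma>"
  shows "div_hat F x = diffusion_cell.cone_div K (c K) (E K) (cell_tensor \<Lambda> K) (F K) \<sigma>"
  unfolding div_hat_def by (rule sum_cells_cones[OF assms])

end

section \<open>Equivalence of the two formulations\<close>

context mesh
begin

lemma finite_cell_faces: "K \<in> M \<Longrightarrow> finite (E K)"
  using star_cell.finite_faces[OF star_cell] .

lemma face_cells:
  assumes "\<sigma> \<in> (\<Union>K\<in>M. E K)"
  shows "(\<sigma> \<subseteq> frontier \<Omega> \<and> card {K\<in>M. \<sigma> \<in> E K} = 1) \<or>
    (\<not> \<sigma> \<subseteq> frontier \<Omega> \<and> card {K\<in>M. \<sigma> \<in> E K} = 2)"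
proof -
  have "\<forall>\<sigma>\<in>(\<Union>K\<in>M. E K). (\<sigma> \<subseteq> frontier \<Omega> \<and> card {K\<in>M. \<sigma> \<in> E K} = 1) \<or>
        (\<not> \<sigma> \<subseteq> frontier \<Omega> \<and> card {K\<in>M. \<sigma> \<in> E K} = 2)"
    using mesh unfolding polytopal_mesh_def by (elim conjE)
  from bspec[OF this assms] show ?thesis .
qed

text \<open>The sum is reorganised by faces: an interior face belongs to exactly two cells with
  opposite fluxes, and on the boundary the factor \<open>b\<close> vanishes. It is applied to face
  integrals of test functions and to face values times areas.\<close>

lemma flux_sum_faces:
  assumes F: "F \<in> flux_space M E"
    and b: "\<And>\<sigma>. \<sigma> \<in> (\<Union>K\<in>M. E K) \<Longrightarrow> \<sigma> \<subseteq> frontier \<Omega> \<Longrightarrow> b \<sigma> = 0"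
  shows "(\<Sum>K\<in>M. \<Sum>\<sigma>\<in>E K. F K \<sigma> * b \<sigma>) = 0"
proof -
  let ?E = "\<Union>K\<in>M. E K"
  have "(\<Sum>K\<in>M. \<Sum>\<sigma>\<in>E K. F K \<sigma> * b \<sigma>) = (\<Sum>K\<in>M. \<Sum>\<sigma>\<in>{\<sigma>\<in>?E. \<sigma> \<in> E K}. F K \<sigma> * b \<sigma>)"
    by (intro sum.cong refl) auto
  also have "\<dots> = (\<Sum>\<sigma>\<in>?E. \<Sum>K\<in>{K\<in>M. \<sigma> \<in> E K}. F K \<sigma> * b \<sigma>)"
    by (rule sum.swap_restrict) (use finite_cells finite_cell_faces in auto)
  also have "\<dots> = (\<Sum>\<sigma>\<in>?E. 0)"
  proof (rule sum.cong[OF refl])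
    fix \<sigma> assume \<sigma>: "\<sigma> \<in> ?E"
    show "(\<Sum>K\<in>{K\<in>M. \<sigma> \<in> E K}. F K \<sigma> * b \<sigma>) = 0"
    proof (cases "\<sigma> \<subseteq> frontier \<Omega>")
      case True
      then show ?thesis using b[OF \<sigma>] by simp
    next
      case False
      then have "card {K\<in>M. \<sigma> \<in> E K} = 2" using face_cells[OF \<sigma>] by blast
      then obtain K L where KL: "{K\<in>M. \<sigma> \<in> E K} = {K, L}" "K \<noteq> L" by (auto simp: card_2_iff)
      then have "K \<in> M" "L \<in> M" "\<sigma> \<in> E K \<inter> E L" by blast+
      then have "F K \<sigma> + F L \<sigma> = 0" using F KL(2) unfolding flux_space_def by blast
      moreover have "(\<Sum>K\<in>{K\<in>M. \<sigma> \<in> E K}. F K \<sigma> * b \<sigma>) = (F K \<sigma> + F L \<sigma>) * b \<sigma>"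
        unfolding KL(1) using KL(2) by (simp add: distrib_right)
      ultimately show ?thesis by simp
    qed
  qed
  finally show ?thesis by simp
qed

section \<open>The weak divergence of a reconstructed flux\<close>

lemma L2_on_lebesgue:
  fixes u :: "real^'n \<Rightarrow> 'b::euclidean_space"
  assumes "u \<in> borel_measurable borel" "set_integrable lebesgue \<Omega> (\<lambda>x. (norm (u x))\<^sup>2)"
  shows "L2_on \<Omega> u"
proof -
  have "u \<in> borel_measurable lebesgue" using assms(1) by (intro measurable_completion) simp
  then have "u \<in> borel_measurable (lebesgue_on \<Omega>)" by (rule measurable_restrict_space1)
  then show ?thesis using assms(2) domain_lebesgue
    by (simp add: L2_on_def set_integrable_def integrable_restrict_space)
qed

lemma cone_indicator_borel:
  assumes "K \<in> M" "\<sigma> \<in> E K"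
  shows "(indicator (face_cone (c K) \<sigma>) :: _ \<Rightarrow> real) \<in> borel_measurable borel"
  using hyperplane_cone.cone_borel[OF star_cell.hyperplane_cone[OF star_cell[OF assms(1)] assms(2)]]
  by simp

lemma flux_hat_L2: "L2_on \<Omega> (flux_hat M E c \<Lambda> F)"
proof (rule L2_on_lebesgue)
  show "flux_hat M E c \<Lambda> F \<in> borel_measurable borel"
    unfolding flux_hat_def
    by (intro borel_measurable_sum borel_measurable_scaleR cone_indicator_borel
        borel_measurable_continuous_onI continuous_intros)
  show "set_integrable lebesgue \<Omega> (\<lambda>x. (norm (flux_hat M E c \<Lambda> F x))\<^sup>2)"
  proof (rule domain_integral(2))
    fix K assume K: "K \<in> M"
    interpret diffusion_cell K "c K" "E K" "cell_tensor \<Lambda> K" by (rule diffusion_cell[OF K])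
    have "continuous_on UNIV (\<lambda>x. (norm (flux (F K) \<sigma> x))\<^sup>2)" for \<sigma>
      by (intro continuous_intros continuous_flux)
    then show "set_integrable lebesgue K (\<lambda>x. (norm (flux_hat M E c \<Lambda> F x))\<^sup>2)"
      by (rule cell_integral_split(2)[OF negligible_exceptional])
        (simp add: flux_hat_on[OF _ K])
  qed
qed

lemma div_hat_L2: "L2_on \<Omega> (div_hat F)"
proof (rule L2_on_lebesgue)
  show "div_hat F \<in> borel_measurable borel"
    unfolding div_hat_def
    by (intro borel_measurable_sum borel_measurable_scaleR cone_indicator_borel)
      (assumption | rule borel_measurable_const)+
  show "set_integrable lebesgue \<Omega> (\<lambda>x. (norm (div_hat F x))\<^sup>2)"
  proof (rule domain_integral(2))
    fix K assume K: "K \<in> M"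
    interpret diffusion_cell K "c K" "E K" "cell_tensor \<Lambda> K" by (rule diffusion_cell[OF K])
    have "continuous_on UNIV (\<lambda>x. (norm (cone_div (F K) \<sigma>))\<^sup>2)" for \<sigma> by (rule continuous_on_const)
    then show "set_integrable lebesgue K (\<lambda>x. (norm (div_hat F x))\<^sup>2)"
      by (rule cell_integral_split(2)[OF negligible_exceptional])
        (simp add: div_hat_on[OF _ K])
  qed
qed

text \<open>Green's formula is summed over the cells. The face terms cancel in the interior by
  conservativity of \<open>F\<close>, and vanish on boundary faces because these are disjoint from
  the open domain, which carries the support of the test function.\<close>

lemma has_weak_div_flux_hat:
  assumes F: "F \<in> flux_space M E"
  shows "has_weak_div \<Omega> (flux_hat M E c \<Lambda> F) (div_hat F)"
  unfolding has_weak_div_def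
proof (intro conjI ballI flux_hat_L2 div_hat_L2)
  fix \<phi> assume "\<phi> \<in> test_functions \<Omega>"
  then have \<phi>: "\<And>k. C_diff k \<phi>" and supp: "\<And>x. x \<notin> \<Omega> \<Longrightarrow> \<phi> x = 0"
    unfolding test_functions_def by blast+
  let ?u = "\<lambda>x. flux_hat M E c \<Lambda> F x \<bullet> gradient \<phi> x" and ?g = "\<lambda>x. div_hat F x * \<phi> x"
  let ?I = "\<lambda>\<sigma>. LINT y:\<sigma>|flat_lborel (affine hull \<sigma>). \<phi> y"
  have cell: "(LINT x:K|lebesgue. ?u x) = - (LINT x:K|lebesgue. ?g x) + (\<Sum>\<sigma>\<in>E K. F K \<sigma> * ?I \<sigma>)"
    "set_integrable lebesgue K ?u" "set_integrable lebesgue K ?g" if K: "K \<in> M" for K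
  proof -
    interpret D: diffusion_cell K "c K" "E K" "cell_tensor \<Lambda> K" by (rule diffusion_cell[OF K])
    have u: "?u x = D.flux (F K) \<sigma> x \<bullet> gradient \<phi> x" and g: "?g x = D.cone_div (F K) \<sigma> * \<phi> x"
      if "x \<notin> exceptional" "\<sigma> \<in> E K" "x \<in> K" "\<And>\<tau>. \<tau> \<in> E K \<Longrightarrow> x \<in> face_cone (c K) \<tau> \<longleftrightarrow> \<tau> = \<sigma>" for \<sigma> x
      using flux_hat_on[OF that(1) K that(3,2,4)] div_hat_on[OF that(1) K that(3,2,4)] by simp_all
    show "(LINT x:K|lebesgue. ?u x) = - (LINT x:K|lebesgue. ?g x) + (\<Sum>\<sigma>\<in>E K. F K \<sigma> * ?I \<sigma>)"
      by (rule D.cell_green(1)[OF negligible_exceptional \<phi> u g])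
    show "set_integrable lebesgue K ?u"
      by (rule D.cell_green(2)[OF negligible_exceptional \<phi> u g])
    show "set_integrable lebesgue K ?g"
      by (rule D.cell_green(3)[OF negligible_exceptional \<phi> u g])
  qed
  have "(LINT x:\<Omega>|lebesgue. ?u x) = (\<Sum>K\<in>M. LINT x:K|lebesgue. ?u x)"
    by (rule domain_integral(1)[OF cell(2)])
  also have "\<dots> = (\<Sum>K\<in>M. - (LINT x:K|lebesgue. ?g x) + (\<Sum>\<sigma>\<in>E K. F K \<sigma> * ?I \<sigma>))"
    by (rule sum.cong[OF refl cell(1)])
  also have "\<dots> = - (\<Sum>K\<in>M. LINT x:K|lebesgue. ?g x) + (\<Sum>K\<in>M. \<Sum>\<sigma>\<in>E K. F K \<sigma> * ?I \<sigma>)"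
    by (simp add: sum.distrib sum_negf sum_subtractf)
  also have "(\<Sum>K\<in>M. \<Sum>\<sigma>\<in>E K. F K \<sigma> * ?I \<sigma>) = 0"
  proof (rule flux_sum_faces[OF F])
    fix \<sigma> assume "\<sigma> \<subseteq> frontier \<Omega>"
    moreover have "frontier \<Omega> \<inter> \<Omega> = {}" using open_domain by (auto simp: frontier_def interior_open)
    ultimately have "(\<lambda>y. indicator \<sigma> y *\<^sub>R \<phi> y) = (\<lambda>_. 0)" using supp by (auto simp: fun_eq_iff indicator_def)
    then show "?I \<sigma> = 0" unfolding set_lebesgue_integral_def by simp
  qed
  also have "(\<Sum>K\<in>M. LINT x:K|lebesgue. ?g x) = (LINT x:\<Omega>|lebesgue. ?g x)"
    by (rule domain_integral(1)[OF cell(3), symmetric])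
  finally show "(LINT x:\<Omega>|lebesgue. ?u x) = - (LINT x:\<Omega>|lebesgue. ?g x)" by simp
qed

lemma has_weak_div_weak_div:
  "F \<in> flux_space M E \<Longrightarrow> has_weak_div \<Omega> (flux_hat M E c \<Lambda> F) (weak_div \<Omega> (flux_hat M E c \<Lambda> F))"
  unfolding weak_div_def by (rule someI[of "has_weak_div \<Omega> (flux_hat M E c \<Lambda> F)"]) (rule has_weak_div_flux_hat)

lemma cell_integral_weak_div:
  assumes F: "F \<in> flux_space M E" and K: "K \<in> M"
  shows "(LINT x:K|lebesgue. weak_div \<Omega> (flux_hat M E c \<Lambda> F) x) = (\<Sum>\<sigma>\<in>E K. face_area \<sigma> * F K \<sigma>)"
proof -
  interpret D: diffusion_cell K "c K" "E K" "cell_tensor \<Lambda> K" by (rule diffusion_cell[OF K])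
  have "(LINT x:K|lebesgue. weak_div \<Omega> (flux_hat M E c \<Lambda> F) x) = (LINT x:K|lebesgue. div_hat F x)"
    by (rule has_weak_div_cell_integral[OF has_weak_div_weak_div[OF F] has_weak_div_flux_hat[OF F]
          open_domain bounded_domain D.open_cell cell_subset[OF K]])
  also have "\<dots> = (\<Sum>\<sigma>\<in>E K. face_area \<sigma> * F K \<sigma>)"
    by (rule D.integral_cone_div[OF negligible_exceptional]) (rule div_hat_on[OF _ K])
  finally show ?thesis .
qed

lemma integral_weak_div:
  assumes F: "F \<in> flux_space M E"
  shows "(LINT x:\<Omega>|lebesgue. piecewise_const M q x * weak_div \<Omega> (flux_hat M E c \<Lambda> F) x) =
    (\<Sum>K\<in>M. q K * (\<Sum>\<sigma>\<in>E K. face_area \<sigma> * F K \<sigma>))"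
proof -
  have "set_integrable lebesgue \<Omega> (weak_div \<Omega> (flux_hat M E c \<Lambda> F))"
    using has_weak_div_weak_div[OF F] L2_on_set_integrable[OF _ domain_lebesgue bounded_domain]
    by (simp add: has_weak_div_def)
  from domain_integral_piecewise_const[OF this] show ?thesis
    by (simp add: cell_integral_weak_div[OF F] cong: sum.cong)
qed

section \<open>Both problems in algebraic form\<close>

definition cell_form ::
    "(real^'n) set \<Rightarrow> ((real^'n) set \<Rightarrow> real) \<Rightarrow> ((real^'n) set \<Rightarrow> real) \<Rightarrow> real" where
  "cell_form K = diffusion_cell.form K (c K) (E K) (cell_tensor \<Lambda> K)"

lemma integral_energy:
  "(LINT x:\<Omega>|lebesgue. (matrix_inv (mean_tensor M \<Lambda> x) *v flux_hat M E c \<Lambda> F x) \<bullet> flux_hat M E c \<Lambda> G x) =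
    (\<Sum>K\<in>M. cell_form K (F K) (G K))"
proof -
  let ?e = "\<lambda>x. (matrix_inv (mean_tensor M \<Lambda> x) *v flux_hat M E c \<Lambda> F x) \<bullet> flux_hat M E c \<Lambda> G x"
  have cell: "(LINT x:K|lebesgue. ?e x) = cell_form K (F K) (G K)" "set_integrable lebesgue K ?e"
    if K: "K \<in> M" for K
  proof -
    interpret D: diffusion_cell K "c K" "E K" "cell_tensor \<Lambda> K" by (rule diffusion_cell[OF K])
    have e: "?e x = (matrix_inv (cell_tensor \<Lambda> K) *v D.flux (F K) \<sigma> x) \<bullet> D.flux (G K) \<sigma> x"
      if "x \<notin> exceptional" "\<sigma> \<in> E K" "x \<in> K" "\<And>\<tau>. \<tau> \<in> E K \<Longrightarrow> x \<in> face_cone (c K) \<tau> \<longleftrightarrow> \<tau> = \<sigma>" for \<sigma> x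
      using flux_hat_on[OF that(1) K that(3,2,4)] piecewise_const_on[OF K that(3), of "cell_tensor \<Lambda>"]
      by (simp add: mean_tensor_def)
    show "(LINT x:K|lebesgue. ?e x) = cell_form K (F K) (G K)"
      unfolding cell_form_def by (rule D.energy_integral(1)[OF negligible_exceptional e])
    show "set_integrable lebesgue K ?e"
      by (rule D.energy_integral(2)[OF negligible_exceptional e])
  qed
  show ?thesis
    using domain_integral(1)[OF cell(2)] cell(1) by simp
qed

text \<open>Here the analysis ends: the integrals of the formulation become finite sums over cells,
  in the same \<open>cell_form\<close> in which the scheme will be written.\<close>

lemma mixed_fe_solution_iff:
  assumes F: "F \<in> flux_space M E" and f: "L2_on \<Omega> f"
  shows "mixed_fe_solution \<Omega> M E c \<Lambda> f p (flux_hat M E c \<Lambda> F) \<longleftrightarrow>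
    (\<forall>G\<in>flux_space M E.
       (\<Sum>K\<in>M. cell_form K (F K) (G K) - p K * (\<Sum>\<sigma>\<in>E K. face_area \<sigma> * G K \<sigma>)) = 0) \<and>
    (\<forall>K\<in>M. (\<Sum>\<sigma>\<in>E K. face_area \<sigma> * F K \<sigma>) = (LINT x:K|lebesgue. f x))"
proof -
  have fi: "set_integrable lebesgue \<Omega> f"
    by (rule L2_on_set_integrable[OF f domain_lebesgue bounded_domain])
  let ?a = "\<lambda>K. \<Sum>\<sigma>\<in>E K. face_area \<sigma> * F K \<sigma>" and ?b = "\<lambda>K. LINT x:K|lebesgue. f x"
  \<comment> \<open>Taking for \<open>q\<close> the indicator of a single cell separates the balance
    equations.\<close>
  have q: "(\<forall>q. (\<Sum>K\<in>M. q K * ?a K) = (\<Sum>K\<in>M. q K * ?b K)) \<longleftrightarrow> (\<forall>K\<in>M. ?a K = ?b K)"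
  proof (intro iffI ballI allI)
    fix K assume eq: "\<forall>q. (\<Sum>K\<in>M. q K * ?a K) = (\<Sum>K\<in>M. q K * ?b K)" and K: "K \<in> M"
    have "(\<Sum>L\<in>M. (if L = K then 1 else 0) * w L) = w K" for w :: "_ \<Rightarrow> real"
    proof -
      have "(\<Sum>L\<in>M. (if L = K then 1 else 0) * w L) = (\<Sum>L\<in>M. if L = K then w K else 0)"
        by (intro sum.cong) auto
      then show ?thesis using finite_cells K by simp
    qed
    then show "?a K = ?b K" using spec[OF eq, of "\<lambda>L. if L = K then 1 else 0"] by (simp only:)
  qed (simp cong: sum.cong)
  show ?thesis
    unfolding mixed_fe_solution_def flux_hat_space_def integral_weak_div[OF F]
      domain_integral_piecewise_const[OF fi] q
    using F by (simp add: integral_energy integral_weak_div sum_subtractf)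
qed

text \<open>The matrix being diagonal, the double sum over faces collapses to the single sum in
  \<open>form\<close>.\<close>

lemma modified_mixed_solution_iff:
  assumes "\<And>K \<sigma>. K \<in> M \<Longrightarrow> \<sigma> \<in> E K \<Longrightarrow> B K \<sigma> \<sigma> = cone_gamma \<Lambda> c K \<sigma>"
    and "\<And>K \<sigma> \<tau>. K \<in> M \<Longrightarrow> \<sigma> \<in> E K \<Longrightarrow> \<tau> \<in> E K \<Longrightarrow> \<sigma> \<noteq> \<tau> \<Longrightarrow> B K \<sigma> \<tau> = 0"
  shows "modified_mixed_solution \<Omega> M E c \<Lambda> f B (p, s) F \<longleftrightarrow>
    (p, s) \<in> hybrid_space \<Omega> M E \<and> F \<in> flux_space M E \<and>
    (\<forall>K\<in>M. (\<Sum>\<sigma>\<in>E K. face_area \<sigma> * F K \<sigma>) = (LINT x:K|lebesgue. f x)) \<and>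
    (\<forall>K\<in>M. \<forall>g. cell_form K (F K) g = (\<Sum>\<sigma>\<in>E K. (p K - s \<sigma>) * face_area \<sigma> * g \<sigma>))"
proof -
  have "measure lebesgue K *
          (cell_grad \<Lambda> E c K (F K) \<bullet> (cell_tensor \<Lambda> K *v cell_grad \<Lambda> E c K g)) +
        (\<Sum>\<sigma>\<in>E K. \<Sum>\<tau>\<in>E K.
           flux_residual \<Lambda> E c K g \<sigma> * B K \<sigma> \<tau> * flux_residual \<Lambda> E c K (F K) \<tau>) =
        cell_form K (F K) g" if K: "K \<in> M" for K g
  proof -
    interpret D: diffusion_cell K "c K" "E K" "cell_tensor \<Lambda> K" by (rule diffusion_cell[OF K])
    have "(\<Sum>\<tau>\<in>E K. D.residual g \<sigma> * B K \<sigma> \<tau> * D.residual (F K) \<tau>) =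
        D.residual g \<sigma> * D.gam \<sigma> * D.residual (F K) \<sigma>" if \<sigma>: "\<sigma> \<in> E K" for \<sigma>
    proof -
      have "(\<Sum>\<tau>\<in>E K. D.residual g \<sigma> * B K \<sigma> \<tau> * D.residual (F K) \<tau>) =
          (\<Sum>\<tau>\<in>E K. if \<tau> = \<sigma> then D.residual g \<sigma> * D.gam \<sigma> * D.residual (F K) \<sigma> else 0)"
        using assms(1)[OF K \<sigma>] assms(2)[OF K \<sigma>] cone_gamma_eq[OF K] by (intro sum.cong) auto
      then show ?thesis using finite_cell_faces[OF K] \<sigma> by simp
    qed
    then show ?thesis
      by (simp add: cell_grad_eq[OF K] flux_residual_eq[OF K] cell_form_def D.form_def cong: sum.cong)
  qed
  then show ?thesis unfolding modified_mixed_solution_def fst_conv snd_conv by simp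
qed

lemma cell_form_expansion:
  assumes K: "K \<in> M"
  shows "cell_form K a g = (\<Sum>\<sigma>\<in>E K. g \<sigma> * cell_form K a (unit_flux \<sigma>))"
proof -
  interpret D: diffusion_cell K "c K" "E K" "cell_tensor \<Lambda> K" by (rule diffusion_cell[OF K])
  show ?thesis unfolding cell_form_def by (rule D.form_expansion)
qed

section \<open>Recovery and elimination of the face values\<close>

lemma face_area_positive: "K \<in> M \<Longrightarrow> \<sigma> \<in> E K \<Longrightarrow> 0 < face_area \<sigma>"
  by (rule hyperplane_cone.face_area_pos[OF star_cell.hyperplane_cone[OF star_cell]])

text \<open>The face values are the Lagrange multipliers of the continuity of the normal fluxes: testing
  the global equation with the unit flux through one face shows that the defects of the local
  equations in the two adjacent cells agree, and that the defect vanishes on the boundary.\<close>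

lemma face_values_exist:
  assumes G: "\<And>G. G \<in> flux_space M E \<Longrightarrow>
      (\<Sum>K\<in>M. cell_form K (F K) (G K) - p K * (\<Sum>\<sigma>\<in>E K. face_area \<sigma> * G K \<sigma>)) = 0"
  shows "\<exists>s. (p, s) \<in> hybrid_space \<Omega> M E \<and>
      (\<forall>K\<in>M. \<forall>g. cell_form K (F K) g = (\<Sum>\<sigma>\<in>E K. (p K - s \<sigma>) * face_area \<sigma> * g \<sigma>))"
proof -
  \<comment> \<open>The defect of the local equation for a unit flux when face values are left out;
    the scheme asks that it equal \<open>- s \<sigma> * face_area \<sigma>\<close>.\<close>
  define \<delta> where "\<delta> K \<sigma> = cell_form K (F K) (unit_flux \<sigma>) - p K * face_area \<sigma>" for K \<sigma>
  have defect: "cell_form K (F K) g - p K * (\<Sum>\<sigma>\<in>E K. face_area \<sigma> * g \<sigma>) = (\<Sum>\<sigma>\<in>E K. g \<sigma> * \<delta> K \<sigma>)"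
    if "K \<in> M" for K g
    by (subst cell_form_expansion[OF that])
      (simp add: \<delta>_def right_diff_distrib sum_subtractf sum_distrib_left mult_ac)
  \<comment> \<open>Global test fluxes through the single face \<sigma>, with one weight per cell;
    only the cells adjacent to \<sigma> see them.\<close>
  have test: "(\<Sum>L\<in>{K\<in>M. \<sigma> \<in> E K}. w L * \<delta> L \<sigma>) = 0"
    if w: "(\<lambda>L \<tau>. w L * unit_flux \<sigma> \<tau>) \<in> flux_space M E" for w \<sigma>
  proof -
    have "(\<Sum>\<tau>\<in>E L. w L * unit_flux \<sigma> \<tau> * \<delta> L \<tau>) = (if \<sigma> \<in> E L then w L * \<delta> L \<sigma> else 0)" if "L \<in> M" for L
    proof -
      have "(\<Sum>\<tau>\<in>E L. w L * unit_flux \<sigma> \<tau> * \<delta> L \<tau>) = (\<Sum>\<tau>\<in>E L. if \<tau> = \<sigma> then w L * \<delta> L \<sigma> else 0)"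
        by (intro sum.cong) (auto simp: unit_flux_def)
      then show ?thesis using finite_cell_faces[OF that] by simp
    qed
    then have "(\<Sum>L\<in>M. \<Sum>\<tau>\<in>E L. w L * unit_flux \<sigma> \<tau> * \<delta> L \<tau>) =
        (\<Sum>L\<in>M. if \<sigma> \<in> E L then w L * \<delta> L \<sigma> else 0)" by (rule sum.cong[OF refl])
    also have "\<dots> = (\<Sum>L\<in>{K\<in>M. \<sigma> \<in> E K}. w L * \<delta> L \<sigma>)"
      using finite_cells by (simp add: sum.inter_filter)
    finally show ?thesis using G[OF w] by (simp add: defect cong: sum.cong)
  qed
  have interior: "\<delta> K \<sigma> = \<delta> L \<sigma>" if KL: "K \<in> M" "L \<in> M" "\<sigma> \<in> E K" "\<sigma> \<in> E L" for K L \<sigma>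
  proof (cases "K = L")
    case False
    have fin: "finite {K\<in>M. \<sigma> \<in> E K}" using finite_cells by simp
    have two: "{K, L} \<subseteq> {K\<in>M. \<sigma> \<in> E K}" using KL by blast
    have "\<sigma> \<in> (\<Union>K\<in>M. E K)" using KL by blast
    from face_cells[OF this] have "card {K\<in>M. \<sigma> \<in> E K} \<le> 2" by (elim disjE) simp_all
    then have cells: "{K\<in>M. \<sigma> \<in> E K} = {K, L}"
      using card_seteq[OF fin two] False by simp
    \<comment> \<open>Opposite weights on the two sides make the unit flux conservative; no third
      cell has this face.\<close>
    define w :: "(real^'n) set \<Rightarrow> real" where "w J = (if J = K then 1 else if J = L then -1 else 0)" for J
    have "(\<lambda>L \<tau>. w L * unit_flux \<sigma> \<tau>) \<in> flux_space M E"
      unfolding flux_space_def mem_Collect_eq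
    proof (intro ballI impI)
      fix I J \<tau> assume IJ: "I \<in> M" "J \<in> M" "\<tau> \<in> E I \<inter> E J" "I \<noteq> J"
      show "w I * unit_flux \<sigma> \<tau> + w J * unit_flux \<sigma> \<tau> = 0"
      proof (cases "\<tau> = \<sigma>")
        case True
        then have "I \<in> {K, L}" "J \<in> {K, L}" using IJ cells by blast+
        then have "w I + w J = 0" using IJ(4) False by (auto simp: w_def)
        then show ?thesis by (simp add: distrib_right[symmetric])
      qed (simp add: unit_flux_def)
    qed
    from test[OF this] show ?thesis using False by (simp add: cells w_def)
  qed simp
  have boundary: "\<delta> K \<sigma> = 0" if K: "K \<in> M" "\<sigma> \<in> E K" "\<sigma> \<subseteq> frontier \<Omega>" for K \<sigma>
  proof -
    have "card {K\<in>M. \<sigma> \<in> E K} = 1" using face_cells[of \<sigma>] K by blast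
    then obtain L where "{K\<in>M. \<sigma> \<in> E K} = {L}" by (auto simp: card_1_singleton_iff)
    moreover have "K \<in> {K\<in>M. \<sigma> \<in> E K}" using K by blast
    ultimately have cells: "{K\<in>M. \<sigma> \<in> E K} = {K}" by simp
    \<comment> \<open>A boundary face belongs to one cell only, so conservativity puts no condition
      on the flux through it.\<close>
    have "(\<lambda>L \<tau>. 1 * unit_flux \<sigma> \<tau>) \<in> flux_space M E"
      unfolding flux_space_def mem_Collect_eq
    proof (intro ballI impI)
      fix I J \<tau> assume IJ: "I \<in> M" "J \<in> M" "\<tau> \<in> E I \<inter> E J" "I \<noteq> J"
      have "\<tau> \<noteq> \<sigma>"
      proof
        assume "\<tau> = \<sigma>"
        then have "I \<in> {K}" "J \<in> {K}" using IJ cells by blast+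
        then show False using IJ(4) by simp
      qed
      then show "1 * unit_flux \<sigma> \<tau> + 1 * unit_flux \<sigma> \<tau> = 0" by (simp add: unit_flux_def)
    qed
    from test[OF this] show ?thesis by (simp add: cells)
  qed
  \<comment> \<open>By \<open>interior\<close> the result does not depend on the cell that is
    picked, and the division is legitimate because face areas are positive.\<close>
  define s where "s \<sigma> = - \<delta> (SOME K. K \<in> M \<and> \<sigma> \<in> E K) \<sigma> / face_area \<sigma>" for \<sigma>
  have s: "s \<sigma> * face_area \<sigma> = - \<delta> K \<sigma>" if K: "K \<in> M" "\<sigma> \<in> E K" for K \<sigma>
  proof -
    have "(SOME K. K \<in> M \<and> \<sigma> \<in> E K) \<in> M \<and> \<sigma> \<in> E (SOME K. K \<in> M \<and> \<sigma> \<in> E K)"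
      by (rule someI[where P = "\<lambda>K. K \<in> M \<and> \<sigma> \<in> E K"]) (use K in blast)
    then have "\<delta> (SOME K. K \<in> M \<and> \<sigma> \<in> E K) \<sigma> = \<delta> K \<sigma>" using interior K by blast
    then show ?thesis using face_area_positive[OF K] by (simp add: s_def)
  qed
  have "(p, s) \<in> hybrid_space \<Omega> M E"
  proof -
    have "s \<sigma> = 0" if "K \<in> M" "\<sigma> \<in> E K" "\<sigma> \<subseteq> frontier \<Omega>" for K \<sigma>
      using s[OF that(1,2)] boundary[OF that] face_area_positive[OF that(1,2)] by simp
    then show ?thesis by (auto simp: hybrid_space_def)
  qed
  moreover have "cell_form K (F K) g = (\<Sum>\<sigma>\<in>E K. (p K - s \<sigma>) * face_area \<sigma> * g \<sigma>)" if K: "K \<in> M" for K g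
  proof -
    have "cell_form K (F K) g = p K * (\<Sum>\<sigma>\<in>E K. face_area \<sigma> * g \<sigma>) + (\<Sum>\<sigma>\<in>E K. g \<sigma> * \<delta> K \<sigma>)"
      using defect[OF K, of g] by simp
    also have "\<dots> = (\<Sum>\<sigma>\<in>E K. p K * (face_area \<sigma> * g \<sigma>) + g \<sigma> * \<delta> K \<sigma>)"
      by (simp add: sum_distrib_left sum.distrib)
    also have "\<dots> = (\<Sum>\<sigma>\<in>E K. (p K - s \<sigma>) * face_area \<sigma> * g \<sigma>)"
    proof (rule sum.cong[OF refl])
      fix \<sigma> assume "\<sigma> \<in> E K"
      then have "\<delta> K \<sigma> = - (s \<sigma> * face_area \<sigma>)" using s[OF K] by simp
      then show "p K * (face_area \<sigma> * g \<sigma>) + g \<sigma> * \<delta> K \<sigma> = (p K - s \<sigma>) * face_area \<sigma> * g \<sigma>"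
        by (simp add: algebra_simps)
    qed
    finally show ?thesis .
  qed
  ultimately show ?thesis by blast
qed

text \<open>The terms with \<open>p K\<close> cancel within each cell. A face value is common to
  both sides of its face and is zero on the boundary, so conservativity of \<open>G\<close> removes
  the rest.\<close>

lemma face_values_test:
  assumes s: "(p, s) \<in> hybrid_space \<Omega> M E" and G: "G \<in> flux_space M E"
    and loc: "\<forall>K\<in>M. \<forall>g. cell_form K (F K) g = (\<Sum>\<sigma>\<in>E K. (p K - s \<sigma>) * face_area \<sigma> * g \<sigma>)"
  shows "(\<Sum>K\<in>M. cell_form K (F K) (G K) - p K * (\<Sum>\<sigma>\<in>E K. face_area \<sigma> * G K \<sigma>)) = 0"
proof -
  have "cell_form K (F K) (G K) - p K * (\<Sum>\<sigma>\<in>E K. face_area \<sigma> * G K \<sigma>) =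
      (\<Sum>\<sigma>\<in>E K. G K \<sigma> * (- s \<sigma> * face_area \<sigma>))" if K: "K \<in> M" for K
    using bspec[OF loc K] by (simp add: sum_distrib_left sum_subtractf[symmetric] algebra_simps)
  then have "(\<Sum>K\<in>M. cell_form K (F K) (G K) - p K * (\<Sum>\<sigma>\<in>E K. face_area \<sigma> * G K \<sigma>)) =
      (\<Sum>K\<in>M. \<Sum>\<sigma>\<in>E K. G K \<sigma> * (- s \<sigma> * face_area \<sigma>))" by (rule sum.cong[OF refl])
  also have "\<dots> = 0" by (rule flux_sum_faces[OF G]) (use s in \<open>auto simp: hybrid_space_def\<close>)
  finally show ?thesis .
qed

end

theorem mainTheorem5:
  fixes \<Omega> :: "(real^'n) set"
    and f :: "real^'n \<Rightarrow> real"
    and \<Lambda> :: "real^'n \<Rightarrow> real^'n^'n"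
    and M :: "(real^'n) set set"
    and E :: "(real^'n) set \<Rightarrow> (real^'n) set set"
    and c :: "(real^'n) set \<Rightarrow> real^'n"
    and B :: "(real^'n) set \<Rightarrow> (real^'n) set \<Rightarrow> (real^'n) set \<Rightarrow> real"
  assumes "bounded \<Omega>" and "polytopal_open \<Omega>"
    and "L2_on \<Omega> f"
    and "diffusion_tensor \<Omega> \<Lambda>"
    and "polytopal_mesh \<Omega> M E c"
    and "\<And>K \<sigma>. K \<in> M \<Longrightarrow> \<sigma> \<in> E K \<Longrightarrow> B K \<sigma> \<sigma> = cone_gamma \<Lambda> c K \<sigma>"
    and "\<And>K \<sigma> \<tau>. K \<in> M \<Longrightarrow> \<sigma> \<in> E K \<Longrightarrow> \<tau> \<in> E K \<Longrightarrow> \<sigma> \<noteq> \<tau> \<Longrightarrow> B K \<sigma> \<tau> = 0"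
  shows "(\<forall>K\<in>M. \<forall>\<sigma>\<in>E K. cone_gamma \<Lambda> c K \<sigma> > 0) \<and>
    (\<forall>p. \<forall>F\<in>flux_space M E.
       mixed_fe_solution \<Omega> M E c \<Lambda> f p (flux_hat M E c \<Lambda> F) \<longleftrightarrow>
       (\<exists>s. (p, s) \<in> hybrid_space \<Omega> M E \<and>
            modified_mixed_solution \<Omega> M E c \<Lambda> f B (p, s) F))"
proof -
  interpret mesh \<Omega> \<Lambda> M E c
    using assms(1,2,4,5) by unfold_locales (simp_all add: polytopal_open_def)
  have "cone_gamma \<Lambda> c K \<sigma> > 0" if "K \<in> M" "\<sigma> \<in> E K" for K \<sigma>
    using diffusion_cell.gam_pos[OF diffusion_cell[OF that(1)] that(2)] by (simp add: cone_gamma_eq[OF that(1)])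
  moreover have "mixed_fe_solution \<Omega> M E c \<Lambda> f p (flux_hat M E c \<Lambda> F) \<longleftrightarrow>
       (\<exists>s. (p, s) \<in> hybrid_space \<Omega> M E \<and> modified_mixed_solution \<Omega> M E c \<Lambda> f B (p, s) F)"
    if F: "F \<in> flux_space M E" for p F
  proof -
    have "modified_mixed_solution \<Omega> M E c \<Lambda> f B (p, s) F \<longleftrightarrow>
      (p, s) \<in> hybrid_space \<Omega> M E \<and> F \<in> flux_space M E \<and>
      (\<forall>K\<in>M. (\<Sum>\<sigma>\<in>E K. face_area \<sigma> * F K \<sigma>) = (LINT x:K|lebesgue. f x)) \<and>
      (\<forall>K\<in>M. \<forall>g. cell_form K (F K) g = (\<Sum>\<sigma>\<in>E K. (p K - s \<sigma>) * face_area \<sigma> * g \<sigma>))" for s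
      by (rule modified_mixed_solution_iff) (fact assms(6), fact assms(7))
    then show ?thesis
      unfolding mixed_fe_solution_iff[OF F assms(3)]
      using F face_values_exist[of F p] face_values_test[of p _ _ F] by blast
  qed
  ultimately show ?thesis by blast
qed

end
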